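(* Let $K\subseteq\mathbb{R}^n$ be an unbounded star-shaped set, let $\sigma>0$ and $\varepsilon\in(0,\tfrac{1}{32})$. For a constant $c>0$ define $$\delta^*=\sup\Big\{\delta\ge 0:\ N\frac{\delta^2}{\sigma^2}\le \log M^{\mathrm{loc}}(\delta,c)\Big\}.$$ Then, for $c$ a sufficiently large absolute constant and under the assumption $N\gtrsim \sup_{\delta>0}\log M^{\mathrm{loc}}(\delta,c)$, the minimax risk satisfies $$\mathfrak{M}\asymp \max\big(\delta^{*2},\ \varepsilon\sigma^2\big).$$
   Context: Model: fix integers $n,N\ge 1$, $\sigma>0$ and a contamination level $\varepsilon$. The unknown mean $\mu$ lies in a known set $K\subseteq\mathbb{R}^n$. The uncorrupted sample is $\tilde X_i=\mu+\xi_i$, $i=1,\dots,N$, where the $\xi_i$ are i.i.d. copies of a random vector $\xi$ whose distribution belongs to $\Xi_{\sigma^2}$, the family of all distributions on $\mathbb{R}^n$ with mean zero and covariance matrix $\Sigma\preceq\sigma^2 I$. An adversary $\mathcal{C}$, which may inspect the entire uncorrupted sample and knows the model and the estimator, replaces at most a fraction $\varepsilon$ of the $N$ points by arbitrary points; the statistician observes $X=\mathcal{C}(\tilde X)$. The minimax risk is $$\mathfrak{M}=\inf_{\hat\mu}\sup_{\mu\in K}\sup_{\xi\in\Xi_{\sigma^2}}\sup_{\mathcal{C}}\mathbb{E}_\mu\big\|\hat\mu(\mathcal{C}(\tilde X))-\mu\big\|^2,$$ the infimum over all estimators, $\|\cdot\|$ the Euclidean norm. Star-shaped: there is $k^*\in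 K$ with $(1-t)k^*+tk\in K$ for all $k\in K$, $t\in[0,1]$. Local metric entropy: $M(\eta,A)$ is the maximal cardinality of a subset of $A$ with pairwise distances $>\eta$; $M^{\mathrm{loc}}(\eta,c)=\sup_{\nu\in K}M(\eta/c,\ B(\nu,\eta)\cap K)$ with $B(\nu,\eta)$ the closed Euclidean ball. $\asymp$, $\gtrsim$: up to multiplicative constants not depending on $n,N,\sigma,\varepsilon,K$. *)

theory Defs
  imports "HOL-Probability.Probability"
begin

text \<open>Points of R^n are represented as extensional functions on {..<n}
  (so the dimension n is an ordinary natural number and constants may be
  required not to depend on it).\<close>

definition Rn :: "nat \<Rightarrow> (nat \<Rightarrow> real) set" where
  "Rn n = PiE {..<n} (\<lambda>_. UNIV)"

definition RnM :: "nat \<Rightarrow> (nat \<Rightarrow> real) measure" where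
  "RnM n = PiM {..<n} (\<lambda>_. borel)"

definition enorm :: "nat \<Rightarrow> (nat \<Rightarrow> real) \<Rightarrow> real" where
  "enorm n x = sqrt (\<Sum>i<n. (x i)^2)"

definition edist :: "nat \<Rightarrow> (nat \<Rightarrow> real) \<Rightarrow> (nat \<Rightarrow> real) \<Rightarrow> real" where
  "edist n x y = enorm n (\<lambda>i. x i - y i)"

definition vadd :: "nat \<Rightarrow> (nat \<Rightarrow> real) \<Rightarrow> (nat \<Rightarrow> real) \<Rightarrow> (nat \<Rightarrow> real)" where
  "vadd n x y = restrict (\<lambda>i. x i + y i) {..<n}"

definition vcomb :: "nat \<Rightarrow> real \<Rightarrow> (nat \<Rightarrow> real) \<Rightarrow> (nat \<Rightarrow> real) \<Rightarrow> (nat \<Rightarrow> real)" where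
  "vcomb n t x y = restrict (\<lambda>i. (1 - t) * x i + t * y i) {..<n}"

definition cballn :: "nat \<Rightarrow> (nat \<Rightarrow> real) \<Rightarrow> real \<Rightarrow> (nat \<Rightarrow> real) set" where
  "cballn n \<nu> r = {x \<in> Rn n. edist n \<nu> x \<le> r}"

definition star_shaped :: "nat \<Rightarrow> (nat \<Rightarrow> real) set \<Rightarrow> bool" where
  "star_shaped n K \<longleftrightarrow> (\<exists>k\<in>K. \<forall>x\<in>K. \<forall>t\<in>{0..1}. vcomb n t k x \<in> K)"

definition unbounded_n :: "nat \<Rightarrow> (nat \<Rightarrow> real) set \<Rightarrow> bool" where
  "unbounded_n n K \<longleftrightarrow> \<not> (\<exists>R. \<forall>x\<in>K. enorm n x \<le> R)"

definition packing :: "nat \<Rightarrow> real \<Rightarrow> (nat \<Rightarrow> real) set \<Rightarrow> nat" where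
  "packing n \<eta> A = Sup {card S | S. S \<subseteq> A \<and> finite S \<and>
      (\<forall>x\<in>S. \<forall>y\<in>S. x \<noteq> y \<longrightarrow> edist n x y > \<eta>)}"

definition Mloc :: "nat \<Rightarrow> (nat \<Rightarrow> real) set \<Rightarrow> real \<Rightarrow> real \<Rightarrow> real" where
  "Mloc n K \<delta> c = (SUP \<nu>\<in>K. real (packing n (\<delta> / c) (cballn n \<nu> \<delta> \<inter> K)))"

definition delta_star :: "nat \<Rightarrow> nat \<Rightarrow> real \<Rightarrow> (nat \<Rightarrow> real) set \<Rightarrow> real \<Rightarrow> real" where
  "delta_star n N \<sigma> K c = Sup {\<delta>. \<delta> \<ge> 0 \<and> real N * \<delta>^2 / \<sigma>^2 \<le> ln (Mloc n K \<delta> c)}"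

text \<open>The family Xi_{sigma^2}: distributions on R^n with mean zero and covariance
  matrix Sigma (Sigma_ij = E[x_i x_j]) satisfying Sigma \<preceq> sigma^2 I.\<close>
definition noise_dists :: "nat \<Rightarrow> real \<Rightarrow> (nat \<Rightarrow> real) measure set" where
  "noise_dists n s2 = {D. prob_space D \<and> sets D = sets (RnM n) \<and>
     (\<forall>i<n. integrable D (\<lambda>x. x i) \<and> (\<integral>x. x i \<partial>D) = 0) \<and>
     (\<forall>i<n. integrable D (\<lambda>x. (x i)^2)) \<and>
     (\<forall>v\<in>Rn n. (\<Sum>i<n. \<Sum>j<n. v i * v j * (\<integral>x. x i * x j \<partial>D))
                 \<le> s2 * (\<Sum>i<n. (v i)^2))}"

definition SampM :: "nat \<Rightarrow> nat \<Rightarrow> (nat \<Rightarrow> nat \<Rightarrow> real) measure" where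
  "SampM n N = PiM {..<N} (\<lambda>_. RnM n)"

definition estimators :: "nat \<Rightarrow> nat \<Rightarrow> ((nat \<Rightarrow> nat \<Rightarrow> real) \<Rightarrow> (nat \<Rightarrow> real)) set" where
  "estimators n N = measurable (SampM n N) (RnM n)"

definition adversaries :: "nat \<Rightarrow> nat \<Rightarrow> real \<Rightarrow>
    ((nat \<Rightarrow> nat \<Rightarrow> real) \<Rightarrow> (nat \<Rightarrow> nat \<Rightarrow> real)) set" where
  "adversaries n N \<epsilon> = {C. C \<in> measurable (SampM n N) (SampM n N) \<and>
     (\<forall>x\<in>space (SampM n N). real (card {i\<in>{..<N}. C x i \<noteq> x i}) \<le> \<epsilon> * real N)}"

definition shift_sample :: "nat \<Rightarrow> nat \<Rightarrow> (nat \<Rightarrow> real) \<Rightarrow> (nat \<Rightarrow> nat \<Rightarrow> real)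
    \<Rightarrow> (nat \<Rightarrow> nat \<Rightarrow> real)" where
  "shift_sample n N \<mu> \<xi> = restrict (\<lambda>i. vadd n \<mu> (\<xi> i)) {..<N}"

definition risk :: "nat \<Rightarrow> nat \<Rightarrow> ((nat \<Rightarrow> nat \<Rightarrow> real) \<Rightarrow> (nat \<Rightarrow> real)) \<Rightarrow> (nat \<Rightarrow> real)
    \<Rightarrow> (nat \<Rightarrow> real) measure \<Rightarrow> ((nat \<Rightarrow> nat \<Rightarrow> real) \<Rightarrow> (nat \<Rightarrow> nat \<Rightarrow> real)) \<Rightarrow> ennreal" where
  "risk n N est \<mu> D C =
     (\<integral>\<^sup>+ \<xi>. ennreal ((edist n (est (C (shift_sample n N \<mu> \<xi>))) \<mu>)^2) \<partial>(PiM {..<N} (\<lambda>_. D)))"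

definition minimax_risk :: "nat \<Rightarrow> nat \<Rightarrow> real \<Rightarrow> real \<Rightarrow> (nat \<Rightarrow> real) set \<Rightarrow> ennreal" where
  "minimax_risk n N \<sigma> \<epsilon> K =
     (INF est\<in>estimators n N. SUP \<mu>\<in>K. SUP D\<in>noise_dists n (\<sigma>^2).
        SUP C\<in>adversaries n N \<epsilon>. risk n N est \<mu> D C)"

end

theory Submission
  imports Defs
begin

text \<open>Lower bounds. If the estimator sees the constant sample \<open>k\<close>, the data may be genuine, or an
  adversary may have hidden the rare outliers that carry the mean to a point at distance of order
  \<open>\<sigma> \<surd>\<epsilon>\<close>; this gives \<open>\<epsilon> \<sigma>\<^sup>2\<close>. For \<open>\<delta>\<^sup>*\<^sup>2\<close>, tilted cube noise makes the members of a local packing hard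
  to distinguish, since the chi-square divergence of the samples stays below a power of the packing size.

  Upper bound. Take a maximal \<open>r\<close>-separated subset \<open>G\<close> of \<open>K\<close>, with \<open>r\<^sup>2\<close> a large multiple of
  \<open>max (\<delta>\<^sup>*\<^sup>2) (\<epsilon> \<sigma>\<^sup>2)\<close>, and compare its points pairwise with bounded-score tests, which \<open>\<epsilon> N\<close> corrupted points
  shift by at most \<open>2 \<epsilon> N\<close>. The estimator is a point that beats all its rivals beyond the smallest possible
  dyadic radius. A test at distance \<open>d\<close> fails with probability at most \<open>(1 + 4 d\<^sup>2/\<sigma>\<^sup>2)\<close> to the power
  \<open>- c N\<close>; the local entropy bound limits the number of points of \<open>G\<close> in each dyadic shell to a smaller power
  of the same quantity, so a union bound over shells also controls the expectation on an unbounded \<open>K\<close>.\<close>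

section \<open>Geometry and local packings\<close>

text \<open>Only two moments of the noise are known, and the squared loss is unbounded on
  \<open>K\<close>: a mistake at distance d costs about d^2, and many rivals may lie at that
  distance. Exponentially small failure that does not improve with d could not be summed, so the
  tests must fail with a probability that is a power of 1 + 4 d^2/\<sigma>^2 with exponent
  proportional to -N. The hypothesis relating \<open>N\<close> to the entropy keeps the number of
  rivals below a smaller power of the same base. It also forces every \<delta> in the set defining
  \<open>delta_star\<close> to be at most \<sigma>, the range in which cube noise can be tilted.
  Unboundedness and star-shapedness put segments of every length into \<open>K\<close>. They carry
  the contamination bound, and for c \<ge> 33 they give \<open>Mloc\<close> at least 33 at every
  radius, which is the origin of the threshold on c. Hence the entropy is at least 1 everywhere.
  This places \<open>delta_star\<close> above \<sigma>/sqrt N and, through the hypothesis, bounds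
  \<open>N\<close> from below; the sum over shells needs both.\<close>

lemma enorm_eq_L2_set: "enorm n x = L2_set x {..<n}"
  by (simp add: enorm_def L2_set_def)

lemma enorm_nonneg [simp]: "0 \<le> enorm n x"
  by (simp add: enorm_eq_L2_set)

lemma enorm_power2: "(enorm n x)\<^sup>2 = (\<Sum>i<n. (x i)\<^sup>2)"
  by (simp add: enorm_def sum_nonneg)

lemma edist_nonneg [simp]: "0 \<le> edist n x y"
  by (simp add: edist_def)

lemma edist_power2: "(edist n x y)\<^sup>2 = (\<Sum>i<n. (x i - y i)\<^sup>2)"
  by (simp add: edist_def enorm_power2)

lemma edist_commute: "edist n x y = edist n y x"
  by (simp add: edist_def enorm_def power2_commute)

lemma edist_refl [simp]: "edist n x x = 0"
  by (simp add: edist_def enorm_def)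

lemma edist_triangle: "edist n x z \<le> edist n x y + edist n y z"
  using L2_set_triangle_ineq[of "\<lambda>i. x i - y i" "\<lambda>i. y i - z i" "{..<n}"]
  by (simp add: edist_def enorm_eq_L2_set)

lemma abs_component_le_edist: "i < n \<Longrightarrow> \<bar>x i - y i\<bar> \<le> edist n x y"
  using member_le_L2_set[of "{..<n}" i "\<lambda>i. \<bar>x i - y i\<bar>"]
  by (simp add: edist_def enorm_eq_L2_set L2_set_def)

lemma edist_eq_0_iff:
  assumes "x \<in> Rn n" "y \<in> Rn n"
  shows "edist n x y = 0 \<longleftrightarrow> x = y"
proof
  assume "edist n x y = 0"
  then have "\<And>i. i < n \<Longrightarrow> x i = y i"
    using abs_component_le_edist[of _ n x y] by fastforce
  then show "x = y"
    using assms unfolding Rn_def by (intro PiE_ext) auto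
qed simp

lemma sum_mult_le_edist:
  "\<bar>\<Sum>k<n. (x k - y k) * (z k - w k)\<bar> \<le> edist n x y * edist n z w"
proof -
  have "\<bar>\<Sum>k<n. (x k - y k) * (z k - w k)\<bar> \<le> (\<Sum>k<n. \<bar>x k - y k\<bar> * \<bar>z k - w k\<bar>)"
    by (rule order_trans[OF sum_abs]) (simp add: abs_mult)
  also have "\<dots> \<le> edist n x y * edist n z w"
    using L2_set_mult_ineq[of "\<lambda>k. x k - y k" "\<lambda>k. z k - w k" "{..<n}"]
    by (simp add: edist_def enorm_eq_L2_set)
  finally show ?thesis .
qed

lemma vcomb_in_Rn [simp]: "vcomb n t x y \<in> Rn n"
  by (auto simp: vcomb_def Rn_def)

lemma edist_vcomb:
  assumes "0 \<le> t"
  shows "edist n (vcomb n t k x) (vcomb n t k y) = t * edist n x y"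
proof -
  have "edist n (vcomb n t k x) (vcomb n t k y) = L2_set (\<lambda>i. t * (x i - y i)) {..<n}"
    unfolding edist_def enorm_eq_L2_set
    by (rule L2_set_cong) (auto simp: vcomb_def algebra_simps)
  also have "\<dots> = t * edist n x y"
    using assms by (simp add: L2_set_right_distrib edist_def enorm_eq_L2_set)
  finally show ?thesis .
qed

lemma edist_vcomb_vcomb:
  "edist n (vcomb n s k x) (vcomb n t k x) = \<bar>s - t\<bar> * edist n k x"
proof -
  have "edist n (vcomb n s k x) (vcomb n t k x) = L2_set (\<lambda>i. (t - s) * (k i - x i)) {..<n}"
    unfolding edist_def enorm_eq_L2_set
    by (rule L2_set_cong) (auto simp: vcomb_def algebra_simps)
  also have "\<dots> = L2_set (\<lambda>i. \<bar>t - s\<bar> * (k i - x i)) {..<n}"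
    by (simp add: L2_set_def power_mult_distrib)
  also have "\<dots> = \<bar>s - t\<bar> * edist n k x"
    by (subst L2_set_right_distrib[symmetric]) (auto simp: edist_def enorm_eq_L2_set)
  finally show ?thesis .
qed

lemma vcomb_0: "k \<in> Rn n \<Longrightarrow> vcomb n 0 k x = k"
  unfolding vcomb_def Rn_def by (auto simp: restrict_def PiE_def extensional_def)

section \<open>Separated sets and the meaning of the suprema in \<open>packing\<close> and
  \<open>Mloc\<close>\<close>

definition separated :: "nat \<Rightarrow> real \<Rightarrow> (nat \<Rightarrow> real) set \<Rightarrow> bool" where
  "separated n \<eta> S \<longleftrightarrow> (\<forall>x\<in>S. \<forall>y\<in>S. x \<noteq> y \<longrightarrow> edist n x y > \<eta>)"

lemma separated_subset: "separated n \<eta> S \<Longrightarrow> T \<subseteq> S \<Longrightarrow> separated n \<eta> T"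
  unfolding separated_def by blast

lemma separated_insert:
  assumes "separated n \<eta> S" "\<And>p. p \<in> S \<Longrightarrow> \<eta> < edist n p x"
  shows "separated n \<eta> (insert x S)"
  unfolding separated_def
proof (intro ballI impI)
  fix y z assume yz: "y \<in> insert x S" "z \<in> insert x S" "y \<noteq> z"
  show "\<eta> < edist n y z"
  proof (cases "y = x \<or> z = x")
    case True
    then show ?thesis using yz assms(2)[of y] assms(2)[of z] edist_commute[of n y z] by (elim disjE) auto
  next
    case False
    then show ?thesis using yz assms(1) unfolding separated_def by simp
  qed
qed

text \<open>Pigeonhole on a grid of side \<open>\<eta> / (n + 1)\<close>: two points of one cell are
  at most \<eta> apart. The grid is anchored at \<nu>, which makes the bound independent of
  \<nu>.\<close>

lemma separated_in_ball_bounded: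
  assumes "\<delta> > 0" "\<eta> > 0"
  shows "\<exists>B. \<forall>\<nu> S. S \<subseteq> cballn n \<nu> \<delta> \<longrightarrow> separated n \<eta> S \<longrightarrow> finite S \<and> card S \<le> B"
proof -
  define q where "q = (real n + 1) / \<eta>"
  define Z where "Z = {- \<lceil>\<delta> * q\<rceil> - 1 .. \<lceil>\<delta> * q\<rceil>}"
  have q: "q > 0" using assms by (simp add: q_def add_pos_nonneg)
  let ?P = "PiE {..<n} (\<lambda>_. Z)"
  have fin: "finite ?P" by (rule finite_PiE) (auto simp: Z_def)
  show ?thesis
  proof (intro exI[of _ "card ?P"] allI impI)
    fix \<nu> S assume S: "S \<subseteq> cballn n \<nu> \<delta>" and sep: "separated n \<eta> S"
    define f where "f x = restrict (\<lambda>i. \<lfloor>(x i - \<nu> i) * q\<rfloor>) {..<n}" for x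
    have inj: "inj_on f S"
    proof (rule inj_onI, rule ccontr)
      fix x y assume xy: "x \<in> S" "y \<in> S" "f x = f y" "x \<noteq> y"
      have "\<bar>x i - y i\<bar> \<le> 1 / q" if "i < n" for i
      proof -
        have "\<lfloor>(x i - \<nu> i) * q\<rfloor> = \<lfloor>(y i - \<nu> i) * q\<rfloor>"
          using fun_cong[OF xy(3), of i] that by (simp add: f_def)
        then have "\<bar>(x i - \<nu> i) * q - (y i - \<nu> i) * q\<bar> \<le> 1" by linarith
        moreover have "(x i - \<nu> i) * q - (y i - \<nu> i) * q = (x i - y i) * q"
          by (simp add: algebra_simps)
        ultimately have "\<bar>x i - y i\<bar> * q \<le> 1" using q by (simp add: abs_mult)
        then show ?thesis using q by (simp add: pos_le_divide_eq)
      qed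
      then have "edist n x y \<le> (\<Sum>i<n. 1 / q)"
        unfolding edist_def enorm_eq_L2_set
        by (intro order_trans[OF L2_set_le_sum_abs] sum_mono) auto
      also have "\<dots> = \<eta> * (real n / (real n + 1))" by (simp add: q_def)
      also have "\<dots> \<le> \<eta>" using assms by (simp add: field_simps)
      finally show False using sep xy unfolding separated_def by fastforce
    qed
    have img: "f ` S \<subseteq> ?P"
    proof
      fix z assume "z \<in> f ` S"
      then obtain x where x: "x \<in> S" "z = f x" by blast
      have "\<lfloor>(x i - \<nu> i) * q\<rfloor> \<in> Z" if "i < n" for i
      proof -
        have "\<bar>\<nu> i - x i\<bar> \<le> \<delta>"
          using abs_component_le_edist[OF that, of \<nu> x] S x by (auto simp: cballn_def)
        then have "\<bar>(x i - \<nu> i) * q\<bar> \<le> \<delta> * q" using q by (simp add: abs_mult abs_minus_commute)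
        then show ?thesis unfolding Z_def by (simp add: abs_le_iff) linarith
      qed
      then show "z \<in> ?P" by (auto simp: x f_def)
    qed
    have "finite (f ` S)" using finite_subset[OF img fin] .
    then show "finite S \<and> card S \<le> card ?P"
      using finite_imageD[OF _ inj] card_inj_on_le[OF inj img fin] by blast
  qed
qed

text \<open>A \<open>Sup\<close> over \<open>nat\<close> has its intended meaning only for a
  nonempty bounded set. The grid bound makes the set of cardinalities finite, so the supremum is a
  maximum; being free of \<nu>, it also bounds the outer supremum in \<open>Mloc\<close>.\<close>

lemma
  assumes "\<delta> > 0" "\<eta> > 0"
  shows packing_attained: "\<exists>S. S \<subseteq> cballn n \<nu> \<delta> \<inter> K \<and> finite S \<and> separated n \<eta> S
        \<and> card S = packing n \<eta> (cballn n \<nu> \<delta> \<inter> K)"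
    and card_le_packing: "\<And>S. S \<subseteq> cballn n \<nu> \<delta> \<inter> K \<Longrightarrow> separated n \<eta> S \<Longrightarrow>
        finite S \<and> card S \<le> packing n \<eta> (cballn n \<nu> \<delta> \<inter> K)"
    and packing_bounded: "\<exists>B. \<forall>\<nu>. packing n \<eta> (cballn n \<nu> \<delta> \<inter> K) \<le> B"
proof -
  obtain B where B: "\<And>\<nu> S. S \<subseteq> cballn n \<nu> \<delta> \<Longrightarrow> separated n \<eta> S \<Longrightarrow> finite S \<and> card S \<le> B"
    using separated_in_ball_bounded[OF assms, of n] by blast
  define X where "X \<nu> = {card S | S. S \<subseteq> cballn n \<nu> \<delta> \<inter> K \<and> finite S \<and> separated n \<eta> S}" for \<nu>
  have X: "packing n \<eta> (cballn n \<nu> \<delta> \<inter> K) = Sup (X \<nu>)" for \<nu>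
    by (simp add: packing_def X_def separated_def)
  have le: "x \<le> B" if "x \<in> X \<nu>" for x \<nu>
    using that B unfolding X_def by blast
  have bdd: "bdd_above (X \<nu>)" for \<nu> using le by (auto simp: bdd_above_def)
  have "card {} \<in> X \<nu>" for \<nu> unfolding X_def
    by (rule CollectI, rule exI[of _ "{}"]) (auto simp: separated_def)
  then have ne: "X \<nu> \<noteq> {}" for \<nu> by blast
  have fin: "finite (X \<nu>)" for \<nu> using le by (meson finite_nat_set_iff_bounded_le)
  have in': "Sup (X \<nu>) \<in> X \<nu>" for \<nu>
    using Max_in[OF fin ne] cSup_eq_Max[OF fin ne] by metis
  show "\<exists>S. S \<subseteq> cballn n \<nu> \<delta> \<inter> K \<and> finite S \<and> separated n \<eta> S
        \<and> card S = packing n \<eta> (cballn n \<nu> \<delta> \<inter> K)"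
  proof -
    have "packing n \<eta> (cballn n \<nu> \<delta> \<inter> K) \<in> X \<nu>" unfolding X by (rule in')
    then show ?thesis unfolding X_def mem_Collect_eq by metis
  qed
  show "finite S \<and> card S \<le> packing n \<eta> (cballn n \<nu> \<delta> \<inter> K)"
    if "S \<subseteq> cballn n \<nu> \<delta> \<inter> K" "separated n \<eta> S" for S
  proof -
    have f: "finite S" using that B by blast
    then have "card S \<in> X \<nu>" using that unfolding X_def by blast
    then show ?thesis using f cSup_upper[OF _ bdd] X by metis
  qed
  show "\<exists>B. \<forall>\<nu>. packing n \<eta> (cballn n \<nu> \<delta> \<inter> K) \<le> B"
  proof (intro exI allI)
    show "packing n \<eta> (cballn n \<nu> \<delta> \<inter> K) \<le> B" for \<nu> unfolding X by (rule le[OF in'])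
  qed
qed

lemma bdd_above_packing:
  assumes "\<delta> > 0" "c > 0"
  shows "bdd_above ((\<lambda>\<nu>. real (packing n (\<delta> / c) (cballn n \<nu> \<delta> \<inter> K))) ` K)"
proof -
  obtain B where "\<And>\<nu>. packing n (\<delta> / c) (cballn n \<nu> \<delta> \<inter> K) \<le> B"
    using packing_bounded[of \<delta> "\<delta> / c" n K] assms by (meson divide_pos_pos)
  then have "real (packing n (\<delta> / c) (cballn n \<nu> \<delta> \<inter> K)) \<le> real B" for \<nu>
    by (simp only: of_nat_le_iff)
  then show ?thesis by (intro bdd_aboveI2)
qed

lemma packing_le_Mloc:
  assumes "\<delta> > 0" "c > 0" "\<nu> \<in> K"
  shows "real (packing n (\<delta> / c) (cballn n \<nu> \<delta> \<inter> K)) \<le> Mloc n K \<delta> c"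
proof -
  show ?thesis unfolding Mloc_def by (rule cSUP_upper[OF assms(3) bdd_above_packing[OF assms(1,2)]])
qed

lemma card_le_Mloc:
  assumes "\<delta> > 0" "c > 0" "\<nu> \<in> K" "S \<subseteq> cballn n \<nu> \<delta> \<inter> K" "separated n (\<delta> / c) S"
  shows "finite S" "real (card S) \<le> Mloc n K \<delta> c"
  using card_le_packing[of \<delta> "\<delta> / c" S n \<nu> K] packing_le_Mloc[of \<delta> c \<nu> K n] assms by force+

lemma Mloc_ge_1:
  assumes "\<delta> > 0" "c > 0" "K \<subseteq> Rn n" "K \<noteq> {}"
  shows "1 \<le> Mloc n K \<delta> c"
proof -
  obtain k where k: "k \<in> K" using assms by blast
  show ?thesis
    using card_le_Mloc(2)[OF assms(1,2) k, of "{k}" n] k assms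
    by (auto simp: cballn_def separated_def)
qed

lemma Mloc_nearly_attained:
  assumes "\<delta> > 0" "c > 0" "K \<noteq> {}" "b < Mloc n K \<delta> c"
  obtains \<nu> S where "\<nu> \<in> K" "S \<subseteq> cballn n \<nu> \<delta> \<inter> K" "finite S"
    "separated n (\<delta> / c) S" "b < real (card S)"
proof -
  from assms(4) obtain \<nu> where "\<nu> \<in> K" "b < real (packing n (\<delta> / c) (cballn n \<nu> \<delta> \<inter> K))"
    unfolding Mloc_def less_cSUP_iff[OF assms(3) bdd_above_packing[OF assms(1,2)]] by blast
  then show ?thesis
    using packing_attained[of \<delta> "\<delta> / c" n \<nu> K] that assms by (metis divide_pos_pos)
qed

section \<open>Local entropy of star-shaped unbounded sets\<close>

lemma Mloc_antimono:
  assumes "star_shaped n K" "K \<subseteq> Rn n" "0 < \<delta>'" "\<delta>' \<le> \<delta>" "c > 0"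
  shows "Mloc n K \<delta> c \<le> Mloc n K \<delta>' c"
proof (rule ccontr)
  assume "\<not> ?thesis"
  then have lt: "Mloc n K \<delta>' c < Mloc n K \<delta> c" by simp
  obtain k where k: "k \<in> K" "\<And>x t. x \<in> K \<Longrightarrow> t \<in> {0..1} \<Longrightarrow> vcomb n t k x \<in> K"
    using assms(1) unfolding star_shaped_def by blast
  obtain \<nu> S where S: "\<nu> \<in> K" "S \<subseteq> cballn n \<nu> \<delta> \<inter> K" "finite S"
    "separated n (\<delta> / c) S" "Mloc n K \<delta>' c < real (card S)"
    using Mloc_nearly_attained[OF _ assms(5) _ lt] k(1) assms(3,4) by auto
  \<comment> \<open>Contraction towards the star centre \<open>k\<close> multiplies all distances by
    \<open>t\<close>, so a packing at radius \<delta> around \<nu> becomes one at radius \<delta>'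
    around \<open>f \<nu>\<close>, which again lies in \<open>K\<close>.\<close>
  define t where "t = \<delta>' / \<delta>"
  have t: "t > 0" "t \<le> 1" using assms by (auto simp: t_def)
  have t\<delta>: "t * \<delta> = \<delta>'" using assms by (simp add: t_def)
  define f where "f = vcomb n t k"
  have dist: "edist n (f x) (f y) = t * edist n x y" for x y
    unfolding f_def using t by (simp add: edist_vcomb)
  have inj: "inj_on f S"
  proof (rule inj_onI)
    fix x y assume xy: "x \<in> S" "y \<in> S" "f x = f y"
    then have "t * edist n x y = 0" by (simp add: dist[symmetric])
    then show "x = y" using edist_eq_0_iff[of x n y] t xy S(2) assms(2) by auto
  qed
  have fK: "f x \<in> K" if "x \<in> K" for x unfolding f_def using k(2)[OF that] t by auto
  have "f ` S \<subseteq> cballn n (f \<nu>) \<delta>' \<inter> K"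
  proof
    fix z assume "z \<in> f ` S"
    then obtain x where x: "x \<in> S" "z = f x" by blast
    have "edist n \<nu> x \<le> \<delta>" "x \<in> K" using x S(2) by (auto simp: cballn_def)
    then show "z \<in> cballn n (f \<nu>) \<delta>' \<inter> K"
      using fK[of x] assms(2) t mult_left_mono[of "edist n \<nu> x" \<delta> t]
      by (auto simp: cballn_def x dist t\<delta>)
  qed
  moreover have "separated n (\<delta>' / c) (f ` S)"
    unfolding separated_def
  proof safe
    fix x y assume xy: "x \<in> S" "y \<in> S" "f x \<noteq> f y"
    have "x \<noteq> y" using xy(3) by (rule contrapos_nn) simp
    then have "\<delta> / c < edist n x y" using S(4) xy(1,2) unfolding separated_def by simp
    then have "t * (\<delta> / c) < t * edist n x y" using t(1) by (rule mult_strict_left_mono)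
    then show "\<delta>' / c < edist n (f x) (f y)" by (simp add: dist t\<delta>[symmetric])
  qed
  ultimately have "real (card (f ` S)) \<le> Mloc n K \<delta>' c"
    using card_le_Mloc(2)[OF assms(3,5) fK[OF S(1)]] by blast
  then show False using S(5) card_image[OF inj] by simp
qed

text \<open>Unboundedness gives a point of \<open>K\<close> farther than \<open>a\<close> from the
  star centre. Pulled back along its segment to distance exactly \<open>a\<close>, it keeps the
  whole segment inside \<open>K\<close>.\<close>

lemma star_shaped_unbounded_ray:
  assumes "star_shaped n K" "unbounded_n n K" "K \<subseteq> Rn n" "a > 0"
  obtains k x where "k \<in> K" "edist n k x = a" "x \<in> Rn n"
    "\<And>t. t \<in> {0..1} \<Longrightarrow> vcomb n t k x \<in> K"
proof -
  obtain k where k: "k \<in> K" "\<And>x t. x \<in> K \<Longrightarrow> t \<in> {0..1} \<Longrightarrow> vcomb n t k x \<in> K"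
    using assms(1) unfolding star_shaped_def by blast
  obtain y where y: "y \<in> K" "enorm n y > enorm n k + a"
    using assms(2) unfolding unbounded_n_def by (meson not_le)
  have "enorm n y \<le> edist n y k + enorm n k"
    using edist_triangle[of n y "\<lambda>_. 0" k] by (simp add: edist_def)
  then have d: "edist n k y > a" using y(2) by (simp add: edist_commute)
  define s where "s = a / edist n k y"
  have s: "0 < s" "s \<le> 1" using d assms(4) by (auto simp: s_def field_simps)
  have kR: "k \<in> Rn n" using k assms by blast
  let ?x = "vcomb n s k y"
  show ?thesis
  proof (rule that[of k ?x])
    show "edist n k ?x = a"
      using edist_vcomb_vcomb[of n 0 k y s] s d assms(4) by (simp add: vcomb_0[OF kR] s_def)
    show "vcomb n t k ?x \<in> K" if "t \<in> {0..1}" for t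
    proof -
      have "vcomb n t k ?x = vcomb n (t * s) k y"
        by (auto simp: vcomb_def fun_eq_iff restrict_def algebra_simps)
      moreover have "t * s \<in> {0..1}" using that s by (auto intro: mult_le_one)
      ultimately show ?thesis using k(2)[OF y(1)] by metis
    qed
  qed (use k in auto)
qed

text \<open>On a segment of length \<delta>, m + 1 equally spaced points are \<delta>/m apart, which
  exceeds \<delta>/c because c > m.\<close>

lemma Mloc_ge_of_unbounded:
  assumes "star_shaped n K" "unbounded_n n K" "K \<subseteq> Rn n" "\<delta> > 0" "c > real m" "m > 0"
  shows "real (m + 1) \<le> Mloc n K \<delta> c"
proof -
  obtain k x where kx: "k \<in> K" "edist n k x = \<delta>" "x \<in> Rn n"
    "\<And>t. t \<in> {0..1} \<Longrightarrow> vcomb n t k x \<in> K"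
    using star_shaped_unbounded_ray[OF assms(1-4)] by blast
  define f where "f i = vcomb n (real i / real m) k x" for i
  have dist: "edist n (f i) (f j) = \<bar>real i - real j\<bar> / real m * \<delta>" for i j
    unfolding f_def using kx(2) assms(6)
    by (simp add: edist_vcomb_vcomb diff_divide_distrib[symmetric])
  have inj: "inj_on f {..m}"
  proof (rule inj_onI)
    fix i j assume "f i = f j"
    then have "edist n (f i) (f j) = 0" by simp
    then show "i = j" unfolding dist using assms(4,6) by simp
  qed
  have f0: "f 0 = k" unfolding f_def using kx assms(3) by (simp add: vcomb_0 subset_iff)
  have "f ` {..m} \<subseteq> cballn n k \<delta> \<inter> K"
  proof safe
    fix i assume i: "i \<le> m"
    show "f i \<in> K" unfolding f_def using kx(4) i assms(6) by simp
    moreover have "real i / real m * \<delta> \<le> 1 * \<delta>"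
      using i assms by (intro mult_right_mono) auto
    then have "edist n k (f i) \<le> \<delta>" using dist[of 0 i] f0 by simp
    ultimately show "f i \<in> cballn n k \<delta>" using assms(3) by (auto simp: cballn_def)
  qed
  moreover have "separated n (\<delta> / c) (f ` {..m})"
    unfolding separated_def
  proof safe
    fix i j assume "f i \<noteq> f j"
    then have "1 \<le> \<bar>real i - real j\<bar>" by (cases "i = j") (auto simp: abs_if)
    then have "\<delta> / real m \<le> edist n (f i) (f j)"
      unfolding dist using assms(4,6) by (simp add: field_simps)
    moreover have "\<delta> / c < \<delta> / real m"
      using assms(4-6) by (intro divide_strict_left_mono) auto
    ultimately show "\<delta> / c < edist n (f i) (f j)" by simp
  qed
  ultimately have "real (card (f ` {..m})) \<le> Mloc n K \<delta> c"
    using assms by (intro card_le_Mloc(2)[OF _ _ kx(1)]) auto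
  then show ?thesis by (simp add: card_image[OF inj])
qed

section \<open>Counting separated points by repeated coverings\<close>

lemma Mloc_cover:
  assumes "\<delta> > 0" "c > 0" "\<nu> \<in> K" "K \<subseteq> Rn n"
  obtains P where "finite P" "P \<subseteq> K" "real (card P) \<le> Mloc n K \<delta> c"
    "\<And>x. x \<in> cballn n \<nu> \<delta> \<inter> K \<Longrightarrow> \<exists>p\<in>P. edist n p x \<le> \<delta> / c"
proof -
  obtain P where P: "P \<subseteq> cballn n \<nu> \<delta> \<inter> K" "finite P" "separated n (\<delta> / c) P"
    "card P = packing n (\<delta> / c) (cballn n \<nu> \<delta> \<inter> K)"
    using packing_attained[of \<delta> "\<delta> / c" n \<nu> K] assms by auto
  show ?thesis
  proof (rule that[of P])
    show "real (card P) \<le> Mloc n K \<delta> c" using packing_le_Mloc[OF assms(1-3)] P by simp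
    show "\<exists>p\<in>P. edist n p x \<le> \<delta> / c" if x: "x \<in> cballn n \<nu> \<delta> \<inter> K" for x
    \<comment> \<open>A point far from all of \<open>P\<close> could be added to it, against the
      maximal cardinality: a largest packing is also a net.\<close>
    proof (rule ccontr)
      assume "\<not> ?thesis"
      then have far: "\<And>p. p \<in> P \<Longrightarrow> edist n p x > \<delta> / c" by force
      have "x \<notin> P"
      proof
        assume "x \<in> P"
        from far[OF this] have "\<delta> / c < 0" by simp
        then show False using divide_pos_pos[OF assms(1,2)] by linarith
      qed
      have "separated n (\<delta> / c) (insert x P)"
        using P(3) far by (rule separated_insert)
      then have "card (insert x P) \<le> card P"
        using card_le_packing[of \<delta> "\<delta> / c" "insert x P" n \<nu> K] P x assms by auto
      then show False using \<open>x \<notin> P\<close> P(2) by simp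
    qed
  qed (use P in auto)
qed

text \<open>Each doubling of the radius costs one factor. A ball of radius \<open>2 ^ j * r\<close>
  is covered by at most \<open>Mloc\<close> balls of radius \<open>2 ^ j * r / c\<close>, no more
  than half as large since c \<ge> 2, with centres in \<open>K\<close>, so the induction hypothesis
  applies to each. At radius \<open>r / 2\<close> at most one point of \<open>G\<close> is
  left.\<close>

lemma card_separated_le_prod_Mloc:
  assumes "c \<ge> 2" "K \<subseteq> Rn n" "r > 0" "separated n r G" "G \<subseteq> K" "\<nu> \<in> K"
  shows "finite (G \<inter> cballn n \<nu> (2 ^ j * r / 2))
    \<and> real (card (G \<inter> cballn n \<nu> (2 ^ j * r / 2))) \<le> (\<Prod>i<j. Mloc n K (2 ^ i * r) c)"
  using assms(6)
proof (induction j arbitrary: \<nu>)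
  case 0
  have "x = y" if "x \<in> G \<inter> cballn n \<nu> (r / 2)" "y \<in> G \<inter> cballn n \<nu> (r / 2)" for x y
  proof (rule ccontr)
    assume "x \<noteq> y"
    then have "r < edist n x y" using that assms(4) unfolding separated_def by blast
    moreover have "edist n x y \<le> edist n \<nu> x + edist n \<nu> y"
      using edist_triangle[of n x y \<nu>] by (simp add: edist_commute)
    ultimately show False using that by (auto simp: cballn_def)
  qed
  then have "finite (G \<inter> cballn n \<nu> (r / 2)) \<and> card (G \<inter> cballn n \<nu> (r / 2)) \<le> 1"
    by (metis card_le_Suc0_iff_eq finite.emptyI finite.insertI One_nat_def is_singletonI'
        is_singleton_def)
  then show ?case by simp
next
  case (Suc j)
  let ?\<delta> = "2 ^ j * r"
  have \<delta>: "?\<delta> > 0" using assms by simp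
  obtain P where P: "finite P" "P \<subseteq> K" "real (card P) \<le> Mloc n K ?\<delta> c"
    "\<And>x. x \<in> cballn n \<nu> ?\<delta> \<inter> K \<Longrightarrow> \<exists>p\<in>P. edist n p x \<le> ?\<delta> / c"
    using Mloc_cover[OF \<delta> _ Suc.prems assms(2), of c] assms(1) by auto
  define F where "F p = G \<inter> cballn n p (?\<delta> / 2)" for p
  have sub: "G \<inter> cballn n \<nu> (2 ^ Suc j * r / 2) \<subseteq> (\<Union>p\<in>P. F p)"
  proof
    fix x assume x: "x \<in> G \<inter> cballn n \<nu> (2 ^ Suc j * r / 2)"
    then obtain p where p: "p \<in> P" "edist n p x \<le> ?\<delta> / c"
      using P(4)[of x] assms(5) by auto
    have "?\<delta> / c \<le> ?\<delta> / 2" using assms(1,3) by (intro divide_left_mono) auto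
    with p(2) have "edist n p x \<le> ?\<delta> / 2" by linarith
    then show "x \<in> (\<Union>p\<in>P. F p)" using p(1) x assms(2,5) by (auto simp: F_def cballn_def)
  qed
  have IH: "finite (F p)" "real (card (F p)) \<le> (\<Prod>i<j. Mloc n K (2 ^ i * r) c)" if "p \<in> P" for p
    using Suc.IH[of p] that P(2) unfolding F_def by auto
  have nn: "0 \<le> (\<Prod>i<j. Mloc n K (2 ^ i * r) c)"
  proof (rule prod_nonneg)
    fix i
    show "0 \<le> Mloc n K (2 ^ i * r) c"
      using Mloc_ge_1[of "2 ^ i * r" c K n] assms by fastforce
  qed
  have fin: "finite (\<Union>p\<in>P. F p)" using P(1) IH by blast
  have "real (card (G \<inter> cballn n \<nu> (2 ^ Suc j * r / 2))) \<le> real (card (\<Union>p\<in>P. F p))"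
    using card_mono[OF fin sub] by simp
  also have "\<dots> \<le> (\<Sum>p\<in>P. real (card (F p)))"
    using card_UN_le[OF P(1), of F] by (metis of_nat_le_iff of_nat_sum)
  also have "\<dots> \<le> (\<Sum>p\<in>P. \<Prod>i<j. Mloc n K (2 ^ i * r) c)" by (rule sum_mono) (use IH in auto)
  also have "\<dots> \<le> Mloc n K ?\<delta> c * (\<Prod>i<j. Mloc n K (2 ^ i * r) c)"
    using mult_right_mono[OF P(3) nn] by simp
  finally show ?case using finite_subset[OF sub fin] by (simp add: mult.commute)
qed

lemma maximal_separated_exists:
  obtains G where "G \<subseteq> K" "separated n r G" "\<And>x. x \<in> K \<Longrightarrow> x \<notin> G \<Longrightarrow> \<exists>g\<in>G. edist n g x \<le> r"
proof -
  let ?A = "{G. G \<subseteq> K \<and> separated n r G}"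
  have "\<exists>G\<in>?A. \<forall>X\<in>?A. G \<subseteq> X \<longrightarrow> X = G"
  proof (rule subset_Zorn')
    fix C assume "subset.chain ?A C"
    then have C: "C \<subseteq> ?A" "\<And>X Y. X \<in> C \<Longrightarrow> Y \<in> C \<Longrightarrow> X \<subseteq> Y \<or> Y \<subseteq> X"
      by (auto simp: subset_chain_def)
    have "separated n r (\<Union>C)"
      unfolding separated_def
    proof safe
      fix x y X Y assume *: "x \<in> X" "X \<in> C" "y \<in> Y" "Y \<in> C" "x \<noteq> y"
      then obtain Z where "Z \<in> C" "x \<in> Z" "y \<in> Z" using C(2)[of X Y] by blast
      then show "r < edist n x y" using C(1) *(5) unfolding separated_def by blast
    qed
    then show "\<Union>C \<in> ?A" using C(1) by blast
  qed
  then obtain G where G: "G \<subseteq> K" "separated n r G"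
    "\<And>X. X \<subseteq> K \<Longrightarrow> separated n r X \<Longrightarrow> G \<subseteq> X \<Longrightarrow> X = G" by auto
  have "\<exists>g\<in>G. edist n g x \<le> r" if x: "x \<in> K" "x \<notin> G" for x
  proof (rule ccontr)
    assume "\<not> ?thesis"
    then have far: "\<And>p. p \<in> G \<Longrightarrow> edist n p x > r" by (simp add: not_le)
    have "separated n r (insert x G)"
      using G(2) far by (rule separated_insert)
    then show False using G(3)[of "insert x G"] x G(1) by blast
  qed
  with G show ?thesis using that by blast
qed

text \<open>A separated subset of an unbounded \<open>K\<close> may be infinite; countability lets
  the estimator enumerate its candidates measurably.\<close>

lemma countable_separated:
  assumes "separated n r G" "G \<subseteq> Rn n" "r > 0"
  shows "countable G"
proof (cases "G = {}")
  case False
  then obtain g where g: "g \<in> G" by blast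
  have "G = (\<Union>m::nat. G \<inter> cballn n g (real m + 1))"
  proof safe
    fix x assume "x \<in> G"
    moreover obtain m where "edist n g x \<le> real m" using real_arch_simple by blast
    ultimately show "x \<in> (\<Union>m::nat. G \<inter> cballn n g (real m + 1))"
      using assms(2) by (auto simp: cballn_def intro!: exI[of _ m])
  qed
  moreover have "finite (G \<inter> cballn n g (real m + 1))" for m
    using separated_in_ball_bounded[of "real m + 1" r n] assms(3)
      separated_subset[OF assms(1), of "G \<inter> cballn n g (real m + 1)"]
    by (metis Int_lower1 Int_lower2 add_nonneg_pos of_nat_0_le_iff zero_less_one)
  ultimately show ?thesis using countable_UN[of UNIV "\<lambda>m::nat. G \<inter> cballn n g (real m + 1)"]
    by (metis countable_finite countableI_type)
qed simp

section \<open>Robust pairwise tests\<close>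

text \<open>The factor 65537 is \<open>1 + 256\<^sup>2\<close>: it bounds \<open>(\<sigma>\<^sup>2 + d\<^sup>2) / \<sigma>\<^sup>2\<close> in the clipped regime \<open>d \<le> 256 \<sigma>\<close>.\<close>

definition test_rate :: real where
  "test_rate = 1 / (512 * 65537)"

lemma test_rate_pos: "0 < test_rate" by (simp add: test_rate_def)

text \<open>The argument is an inner product with a vector of length \<open>d\<close>: its drift is
  of order d^2 and its second moment at most of order d^2 (\<sigma>^2 + d^2). The divisor is, up to
  the factor 8, the quotient of these two, the usual scale of a quadratic Chernoff bound.
  Boundedness limits the influence of a corrupted point.\<close>

definition score :: "real \<Rightarrow> real \<Rightarrow> real \<Rightarrow> real" where
  "score \<sigma> d y = (if d \<le> 256 * \<sigma> then max (- 1) (min 1 (y / (8 * (\<sigma>\<^sup>2 + d\<^sup>2)))) else sgn y)"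

text \<open>Each sample is projected on \<open>h - g\<close> and measured from the midpoint, so
  negative values favour \<open>g\<close>. A value of zero counts as a defeat for both
  candidates.\<close>

definition test_stat :: "nat \<Rightarrow> nat \<Rightarrow> real \<Rightarrow> (nat \<Rightarrow> real) \<Rightarrow> (nat \<Rightarrow> real) \<Rightarrow> (nat \<Rightarrow> nat \<Rightarrow> real) \<Rightarrow> real" where
  "test_stat n N \<sigma> g h x =
     (\<Sum>i<N. score \<sigma> (edist n g h) (\<Sum>k<n. (x i k - (g k + h k) / 2) * (h k - g k)))"

lemma score_minus: "score \<sigma> d (- y) = - score \<sigma> d y"
  by (auto simp: score_def sgn_minus max_def min_def)

lemma abs_score_le_1: "\<bar>score \<sigma> d y\<bar> \<le> 1"
  by (auto simp: score_def sgn_real_def)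

lemma score_measurable [measurable]: "score \<sigma> d \<in> borel_measurable borel"
  unfolding score_def[abs_def] by measurable

lemma test_stat_swap: "test_stat n N \<sigma> h g x = - test_stat n N \<sigma> g h x"
proof -
  have "(\<Sum>k<n. (x i k - (h k + g k) / 2) * (g k - h k))
      = - (\<Sum>k<n. (x i k - (g k + h k) / 2) * (h k - g k))" for i
    unfolding sum_negf[symmetric] by (intro sum.cong) (auto simp: field_simps)
  then show ?thesis
    by (simp add: test_stat_def score_minus edist_commute[of n h g] sum_negf)
qed

section \<open>Measurability, noise moments and exponential tails\<close>

lemma space_RnM: "space (RnM n) = Rn n"
  by (simp add: RnM_def Rn_def space_PiM)

lemma space_SampM: "space (SampM n N) = PiE {..<N} (\<lambda>_. Rn n)"
  by (simp add: SampM_def space_PiM space_RnM)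

lemma SampM_component_measurable:
  assumes "i < N" "k < n"
  shows "(\<lambda>x. x i k) \<in> borel_measurable (SampM n N)"
proof -
  have "(\<lambda>x. x i) \<in> measurable (SampM n N) (RnM n)"
    unfolding SampM_def using assms by (intro measurable_component_singleton) auto
  moreover have "(\<lambda>y. y k) \<in> borel_measurable (RnM n)"
    unfolding RnM_def using assms by (intro measurable_component_singleton) auto
  ultimately show ?thesis by (rule measurable_compose)
qed

lemma test_stat_measurable: "test_stat n N \<sigma> g h \<in> borel_measurable (SampM n N)"
  unfolding test_stat_def[abs_def]
  by (intro borel_measurable_sum measurable_compose[OF _ score_measurable] borel_measurable_times
      borel_measurable_diff SampM_component_measurable) auto

lemma
  assumes "D \<in> noise_dists n s2"
  shows noise_prob_space: "prob_space D" and noise_sets: "sets D = sets (RnM n)"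
    and noise_component_measurable: "\<And>k. k < n \<Longrightarrow> (\<lambda>x. x k) \<in> borel_measurable D"
proof -
  show 1: "prob_space D" "sets D = sets (RnM n)" using assms by (auto simp: noise_dists_def)
  have "(\<lambda>y. y k) \<in> borel_measurable (RnM n)" if "k < n" for k
    unfolding RnM_def using that by (intro measurable_component_singleton) auto
  then show "\<And>k. k < n \<Longrightarrow> (\<lambda>x. x k) \<in> borel_measurable D"
    using measurable_cong_sets[OF 1(2) refl] by blast
qed

lemma noise_linear_form:
  assumes D: "D \<in> noise_dists n s2"
  defines "Z \<equiv> \<lambda>v (x :: nat \<Rightarrow> real). \<Sum>k<n. x k * v k"
  shows "integrable D (Z v)" "(\<integral>x. Z v x \<partial>D) = 0"
    "integrable D (\<lambda>x. (Z v x)\<^sup>2)" "(\<integral>x. (Z v x)\<^sup>2 \<partial>D) \<le> s2 * (\<Sum>k<n. (v k)\<^sup>2)"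
proof -
  have i1: "integrable D (\<lambda>x. x i)" "(\<integral>x. x i \<partial>D) = 0" "integrable D (\<lambda>x. (x i)\<^sup>2)" if "i < n" for i
    using D that by (auto simp: noise_dists_def)
  note [measurable] = noise_component_measurable[OF D]
  have i2: "integrable D (\<lambda>x. x i * x j)" if "i < n" "j < n" for i j
  proof (rule Bochner_Integration.integrable_bound)
    show "integrable D (\<lambda>x. (x i)\<^sup>2 + (x j)\<^sup>2)" using i1 that by auto
    show "(\<lambda>x. x i * x j) \<in> borel_measurable D" using that by measurable
    have "\<bar>a * b\<bar> \<le> \<bar>a\<^sup>2 + b\<^sup>2\<bar>" for a b :: real
    proof -
      have "0 \<le> (\<bar>a\<bar> - \<bar>b\<bar>)\<^sup>2" by simp
      then have "2 * \<bar>a * b\<bar> \<le> a\<^sup>2 + b\<^sup>2" by (simp add: power2_diff abs_mult)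
      then show ?thesis by linarith
    qed
    then show "AE x in D. norm (x i * x j) \<le> norm ((x i)\<^sup>2 + (x j)\<^sup>2)" by simp
  qed
  show "integrable D (Z v)" unfolding Z_def using i1 by auto
  show "(\<integral>x. Z v x \<partial>D) = 0" unfolding Z_def using i1 by (subst Bochner_Integration.integral_sum) auto
  have sq: "(Z v x)\<^sup>2 = (\<Sum>i<n. \<Sum>j<n. v i * v j * (x i * x j))" for x
    unfolding Z_def power2_eq_square sum_product by (simp add: algebra_simps)
  show "integrable D (\<lambda>x. (Z v x)\<^sup>2)" unfolding sq using i2
    by (intro Bochner_Integration.integrable_sum integrable_mult_right) auto
  have "(\<integral>x. (Z v x)\<^sup>2 \<partial>D) = (\<Sum>i<n. \<Sum>j<n. v i * v j * (\<integral>x. x i * x j \<partial>D))"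
    unfolding sq using i2
    by (subst Bochner_Integration.integral_sum)
      (auto intro!: Bochner_Integration.integrable_sum sum.cong)
  \<comment> \<open>The covariance condition ranges only over extensional vectors, hence the
    restriction of \<open>v\<close>.\<close>
  also have "\<dots> = (\<Sum>i<n. \<Sum>j<n. restrict v {..<n} i * restrict v {..<n} j * (\<integral>x. x i * x j \<partial>D))"
    by (intro sum.cong) auto
  also have "\<dots> \<le> s2 * (\<Sum>i<n. (restrict v {..<n} i)\<^sup>2)"
  proof -
    have "restrict v {..<n} \<in> Rn n" by (auto simp: Rn_def)
    then show ?thesis using D unfolding noise_dists_def by blast
  qed
  finally show "(\<integral>x. (Z v x)\<^sup>2 \<partial>D) \<le> s2 * (\<Sum>k<n. (v k)\<^sup>2)" by simp
qed

text \<open>With two moments known, quadratics are what can be integrated, so each exponential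
  moment is first dominated by one. Nonnegativity permits the passage from
  \<open>nn_integral\<close> to the Bochner integral, and the linear term vanishes because the noise
  is centred.\<close>

lemma noise_quadratic_nn_integral:
  assumes D: "D \<in> noise_dists n s2" and nn: "\<And>z. 0 \<le> A + B * z + Q * z\<^sup>2" and Q: "0 \<le> Q"
  shows "(\<integral>\<^sup>+x. ennreal (A + B * (\<Sum>k<n. x k * v k) + Q * (\<Sum>k<n. x k * v k)\<^sup>2) \<partial>D)
    \<le> ennreal (A + Q * (s2 * (\<Sum>k<n. (v k)\<^sup>2)))"
proof -
  interpret prob_space D by (rule noise_prob_space[OF D])
  note L = noise_linear_form[OF D, of v]
  have "(\<integral>\<^sup>+x. ennreal (A + B * (\<Sum>k<n. x k * v k) + Q * (\<Sum>k<n. x k * v k)\<^sup>2) \<partial>D)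
    = ennreal (\<integral>x. A + B * (\<Sum>k<n. x k * v k) + Q * (\<Sum>k<n. x k * v k)\<^sup>2 \<partial>D)"
    using L nn by (intro nn_integral_eq_integral) auto
  also have "(\<integral>x. A + B * (\<Sum>k<n. x k * v k) + Q * (\<Sum>k<n. x k * v k)\<^sup>2 \<partial>D)
     = A + Q * (\<integral>x. (\<Sum>k<n. x k * v k)\<^sup>2 \<partial>D)"
    using L by (simp add: prob_space)
  also have "ennreal \<dots> \<le> ennreal (A + Q * (s2 * (\<Sum>k<n. (v k)\<^sup>2)))"
    using mult_left_mono[OF L(4) Q] by (intro ennreal_leI) simp
  finally show ?thesis .
qed

text \<open>Exponential Markov inequality: the indicator is dominated by a product, which integrates
  to a power by independence. The slack \<open>b\<close> later absorbs the total effect of the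
  corrupted points.\<close>

lemma chernoff_iid:
  assumes "prob_space D" and f [measurable]: "f \<in> borel_measurable D"
    and le: "(\<integral>\<^sup>+x. ennreal (exp (f x)) \<partial>D) \<le> ennreal q" and "0 \<le> q"
  shows "(\<integral>\<^sup>+\<xi>. indicator {\<xi>. - b \<le> (\<Sum>i<N. f (\<xi> i))} \<xi> \<partial>(PiM {..<N} (\<lambda>_. D)))
    \<le> ennreal (exp b * q ^ N)"
proof -
  interpret D: prob_space D by fact
  interpret P: product_sigma_finite "\<lambda>_::nat. D" by standard
  have "(\<integral>\<^sup>+\<xi>. indicator {\<xi>. - b \<le> (\<Sum>i<N. f (\<xi> i))} \<xi> \<partial>(PiM {..<N} (\<lambda>_. D)))
    \<le> (\<integral>\<^sup>+\<xi>. ennreal (exp b) * (\<Prod>i<N. ennreal (exp (f (\<xi> i)))) \<partial>(PiM {..<N} (\<lambda>_. D)))"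
  proof (rule nn_integral_mono)
    fix \<xi>
    have "ennreal (exp b) * (\<Prod>i<N. ennreal (exp (f (\<xi> i)))) = ennreal (exp (b + (\<Sum>i<N. f (\<xi> i))))"
      by (simp add: prod_ennreal exp_sum exp_add ennreal_mult prod_nonneg)
    moreover have "1 \<le> ennreal (exp (b + (\<Sum>i<N. f (\<xi> i))))" if "- b \<le> (\<Sum>i<N. f (\<xi> i))"
      using that by simp
    ultimately show "indicator {\<xi>. - b \<le> (\<Sum>i<N. f (\<xi> i))} \<xi>
        \<le> ennreal (exp b) * (\<Prod>i<N. ennreal (exp (f (\<xi> i))))"
      by (auto simp: indicator_def)
  qed
  also have "\<dots> = ennreal (exp b) * (\<integral>\<^sup>+\<xi>. (\<Prod>i<N. ennreal (exp (f (\<xi> i)))) \<partial>(PiM {..<N} (\<lambda>_. D)))"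
    by (rule nn_integral_cmult) measurable
  also have "(\<integral>\<^sup>+\<xi>. (\<Prod>i<N. ennreal (exp (f (\<xi> i)))) \<partial>(PiM {..<N} (\<lambda>_. D)))
     = (\<integral>\<^sup>+x. ennreal (exp (f x)) \<partial>D) ^ N"
    by (subst P.product_nn_integral_prod) auto
  also have "ennreal (exp b) * \<dots> \<le> ennreal (exp b) * ennreal q ^ N"
    by (intro mult_left_mono power_mono le) auto
  also have "\<dots> = ennreal (exp b * q ^ N)"
    using assms(4) by (simp add: ennreal_power ennreal_mult)
  finally show ?thesis .
qed

text \<open>Clipping makes a quadratic majorant possible for all real \<open>w\<close>. For w
  between -1 and 0 it follows from exp w (1 - w) \<le> 1 and (1 + w + w^2)(1 - w) = 1 - w^3 \<ge>
  1.\<close>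

lemma exp_clip_le: "exp (max (- 1) (min 1 w)) \<le> 1 + w + w\<^sup>2" for w :: real
proof -
  consider "w > 1" | "w < - 1" | "\<bar>w\<bar> \<le> 1" by linarith
  then show ?thesis
  proof cases
    case 1
    have "1 \<le> w\<^sup>2" using 1 by (intro one_le_power) simp
    moreover have "max (- 1) (min 1 w) = 1" using 1 by simp
    ultimately show ?thesis using 1 exp_le by linarith
  next
    case 2
    then have "0 \<le> w * (w + 1)" by (intro mult_nonpos_nonpos) auto
    then have "0 \<le> w + w\<^sup>2" by (simp add: power2_eq_square algebra_simps)
    moreover have "exp (- 1) \<le> (1::real)" by simp
    ultimately have "exp (- 1) \<le> 1 + w + w\<^sup>2" by linarith
    moreover have "max (- 1) (min 1 w) = - 1" using 2 by simp
    ultimately show ?thesis by (simp only:)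
  next
    case 3
    show ?thesis
    proof (cases "w \<ge> 0")
      case True
      then show ?thesis using exp_bound[of w] 3 by simp
    next
      case False
      have "exp w * (1 - w) \<le> 1"
        using exp_ge_add_one_self[of "- w"] by (simp add: exp_minus field_simps)
      moreover have "1 \<le> (1 + w + w\<^sup>2) * (1 - w)"
      proof -
        have "(1 + w + w\<^sup>2) * (1 - w) = 1 + w\<^sup>2 * (- w)" by (simp add: algebra_simps power2_eq_square)
        then show ?thesis using False by (simp add: mult_nonneg_nonpos)
      qed
      ultimately have "exp w * (1 - w) \<le> (1 + w + w\<^sup>2) * (1 - w)" by linarith
      then have "exp w \<le> 1 + w + w\<^sup>2" using False by (simp add: mult_le_cancel_right)
      then show ?thesis using 3 by simp
    qed
  qed
qed

lemma corrupted_test_stat: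
  assumes "\<And>i. i < N \<Longrightarrow> x' i \<noteq> x i \<Longrightarrow> i \<in> J" "finite J" "real (card J) \<le> b"
  shows "test_stat n N \<sigma> g h x' \<le> test_stat n N \<sigma> g h x + 2 * b"
proof -
  let ?f = "\<lambda>x i. score \<sigma> (edist n g h) (\<Sum>k<n. (x i k - (g k + h k) / 2) * (h k - g k))"
  have "test_stat n N \<sigma> g h x' \<le> (\<Sum>i<N. ?f x i + (if i \<in> J then 2 else 0))"
    unfolding test_stat_def
  proof (rule sum_mono)
    fix i assume "i \<in> {..<N}"
    then show "?f x' i \<le> ?f x i + (if i \<in> J then 2 else 0)"
      using assms(1)[of i] abs_score_le_1[of \<sigma> "edist n g h" "\<Sum>k<n. (x i k - (g k + h k) / 2) * (h k - g k)"]
        abs_score_le_1[of \<sigma> "edist n g h" "\<Sum>k<n. (x' i k - (g k + h k) / 2) * (h k - g k)"]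
      by (cases "x' i = x i") (auto simp: abs_le_iff)
  qed
  also have "\<dots> = test_stat n N \<sigma> g h x + 2 * real (card ({..<N} \<inter> J))"
    by (simp add: test_stat_def sum.distrib sum.If_cases)
  also have "card ({..<N} \<inter> J) \<le> card J" using assms(2) by (intro card_mono) auto
  then have "2 * real (card ({..<N} \<inter> J)) \<le> 2 * b" using assms(3) by linarith
  finally show ?thesis by simp
qed

text \<open>Below distance \<open>256 \<sigma>\<close> the score is clipped, with exponential moments controlled by
  \<open>exp_clip_le\<close>; above it the score is a sign, and Chebyshev's inequality makes a single sign wrong with
  probability \<open>O(\<sigma>\<^sup>2/d\<^sup>2)\<close>, which gives polynomial decay in \<open>d\<close>.\<close>

lemma score_exp_moment:
  assumes D: "D \<in> noise_dists n (\<sigma>\<^sup>2)" and \<sigma>: "\<sigma> > 0"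
    and d: "d > 0" "(\<Sum>k<n. (v k)\<^sup>2) = d\<^sup>2"
    and m: "- (3/4) * d\<^sup>2 \<le> m" "m \<le> - (1/4) * d\<^sup>2"
    and \<epsilon>: "0 \<le> \<epsilon>" "\<epsilon> \<le> 1/4" "\<epsilon> * \<sigma>\<^sup>2 \<le> 2 * test_rate * d\<^sup>2"
  obtains \<theta> q where "0 \<le> \<theta>" "0 \<le> q"
    "(\<integral>\<^sup>+x. ennreal (exp (\<theta> * score \<sigma> d ((\<Sum>k<n. x k * v k) + m))) \<partial>D) \<le> ennreal q"
    "exp (2 * \<theta> * \<epsilon>) * q \<le> (1 + 4 * d\<^sup>2 / \<sigma>\<^sup>2) powr (- test_rate)"
proof (cases "d \<le> 256 * \<sigma>")
  case True
  define w where "w = 8 * (\<sigma>\<^sup>2 + d\<^sup>2)"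
  have w: "w > 0" using d \<sigma> by (simp add: w_def add_pos_pos)
  have sum65537: "\<sigma>\<^sup>2 + d\<^sup>2 \<le> 65537 * \<sigma>\<^sup>2"
    using power_mono[OF True, of 2] d by (simp add: power_mult_distrib)
  \<comment> \<open>The drift contributes at most -2 d^2/(8 w) and the second moment at most d^2/(8
    w); \<open>q\<close> bounds one plus their sum, with \<theta> = 1.\<close>
  define q where "q = exp (- (d\<^sup>2 / (8 * w)))"
  have "(\<integral>\<^sup>+x. ennreal (exp (1 * score \<sigma> d ((\<Sum>k<n. x k * v k) + m))) \<partial>D)
     \<le> (\<integral>\<^sup>+x. ennreal ((1 + m / w + m\<^sup>2 / w\<^sup>2) + (1 / w + 2 * m / w\<^sup>2) * (\<Sum>k<n. x k * v k)
          + (1 / w\<^sup>2) * (\<Sum>k<n. x k * v k)\<^sup>2) \<partial>D)"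
  proof (intro nn_integral_mono ennreal_leI)
    fix x :: "nat \<Rightarrow> real"
    let ?z = "\<Sum>k<n. x k * v k"
    have "exp (1 * score \<sigma> d (?z + m)) \<le> 1 + (?z + m) / w + ((?z + m) / w)\<^sup>2"
      using exp_clip_le[of "(?z + m) / w"] True by (simp add: score_def w_def)
    also have "\<dots> = (1 + m / w + m\<^sup>2 / w\<^sup>2) + (1 / w + 2 * m / w\<^sup>2) * ?z + (1 / w\<^sup>2) * ?z\<^sup>2"
      using w by (simp add: field_simps power2_eq_square)
    finally show "exp (1 * score \<sigma> d (?z + m)) \<le> \<dots>" .
  qed
  also have "\<dots> \<le> ennreal ((1 + m / w + m\<^sup>2 / w\<^sup>2) + (1 / w\<^sup>2) * (\<sigma>\<^sup>2 * d\<^sup>2))"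
    unfolding d(2)[symmetric]
  proof (rule noise_quadratic_nn_integral[OF D])
    fix z
    have "(1 + m / w + m\<^sup>2 / w\<^sup>2) + (1 / w + 2 * m / w\<^sup>2) * z + (1 / w\<^sup>2) * z\<^sup>2
       = 1 + (z + m) / w + ((z + m) / w)\<^sup>2"
      using w by (simp add: field_simps power2_eq_square)
    also have "\<dots> \<ge> 0" using exp_clip_le[of "(z + m) / w"] by (rule order_trans[rotated]) simp
    finally show "0 \<le> (1 + m / w + m\<^sup>2 / w\<^sup>2) + (1 / w + 2 * m / w\<^sup>2) * z + (1 / w\<^sup>2) * z\<^sup>2" .
  qed simp
  also have "\<dots> \<le> ennreal q"
  proof (rule ennreal_leI)
    have "m\<^sup>2 \<le> (d\<^sup>2)\<^sup>2"
      using m power_mono[of "- m" "d\<^sup>2" 2] by (simp add: power2_eq_square)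
    then have "m\<^sup>2 + \<sigma>\<^sup>2 * d\<^sup>2 \<le> d\<^sup>2 * (\<sigma>\<^sup>2 + d\<^sup>2)" by (simp add: power2_eq_square algebra_simps)
    also have "\<dots> = d\<^sup>2 * w / 8" by (simp add: w_def)
    finally have "(m\<^sup>2 + \<sigma>\<^sup>2 * d\<^sup>2) / w\<^sup>2 \<le> (d\<^sup>2 * w / 8) / w\<^sup>2" by (rule divide_right_mono) simp
    also have "\<dots> = d\<^sup>2 / (8 * w)" using w by (simp add: power2_eq_square)
    finally have 1: "(m\<^sup>2 + \<sigma>\<^sup>2 * d\<^sup>2) / w\<^sup>2 \<le> d\<^sup>2 / (8 * w)" .
    have "m / w \<le> (- (1/4) * d\<^sup>2) / w" using m w by (intro divide_right_mono) auto
    also have "\<dots> = - 2 * (d\<^sup>2 / (8 * w))" by simp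
    finally have 2: "m / w \<le> - 2 * (d\<^sup>2 / (8 * w))" .
    have "(1 + m / w + m\<^sup>2 / w\<^sup>2) + (1 / w\<^sup>2) * (\<sigma>\<^sup>2 * d\<^sup>2) = 1 + m / w + (m\<^sup>2 + \<sigma>\<^sup>2 * d\<^sup>2) / w\<^sup>2"
      by (simp add: add_divide_distrib)
    also have "\<dots> \<le> 1 + - (d\<^sup>2 / (8 * w))" using 1 2 by linarith
    also have "\<dots> \<le> q" unfolding q_def by (rule exp_ge_add_one_self)
    finally show "(1 + m / w + m\<^sup>2 / w\<^sup>2) + (1 / w\<^sup>2) * (\<sigma>\<^sup>2 * d\<^sup>2) \<le> q" .
  qed
  finally have E: "(\<integral>\<^sup>+x. ennreal (exp (1 * score \<sigma> d ((\<Sum>k<n. x k * v k) + m))) \<partial>D) \<le> ennreal q" .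
  \<comment> \<open>Eight units of \<open>test_rate * (d\<^sup>2 / \<sigma>\<^sup>2)\<close> are
    available: four pay for the corruption, by the bound on \<epsilon>, and four for the logarithm
    of the target power.\<close>
  have "8 * test_rate * (d\<^sup>2 / \<sigma>\<^sup>2) = d\<^sup>2 / (64 * (65537 * \<sigma>\<^sup>2))"
    by (simp add: test_rate_def)
  also have "\<dots> \<le> d\<^sup>2 / (8 * w)"
    unfolding w_def using sum65537 \<sigma> d by (intro divide_left_mono) (auto intro!: mult_pos_pos add_pos_pos)
  finally have 3: "8 * test_rate * (d\<^sup>2 / \<sigma>\<^sup>2) \<le> d\<^sup>2 / (8 * w)" .
  have 4: "\<epsilon> \<le> 2 * test_rate * (d\<^sup>2 / \<sigma>\<^sup>2)" using \<epsilon>(3) \<sigma> by (simp add: field_simps)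
  have "ln (1 + 4 * d\<^sup>2 / \<sigma>\<^sup>2) \<le> 4 * d\<^sup>2 / \<sigma>\<^sup>2" using \<sigma> by (intro ln_add_one_self_le_self) simp
  then have 5: "test_rate * ln (1 + 4 * d\<^sup>2 / \<sigma>\<^sup>2) \<le> 4 * test_rate * (d\<^sup>2 / \<sigma>\<^sup>2)"
    using mult_left_mono[of "ln (1 + 4 * d\<^sup>2 / \<sigma>\<^sup>2)" "4 * d\<^sup>2 / \<sigma>\<^sup>2" test_rate] test_rate_pos
    by (simp add: mult_ac)
  have pos: "1 + 4 * d\<^sup>2 / \<sigma>\<^sup>2 > 0" by (intro add_pos_nonneg) auto
  have "exp (2 * 1 * \<epsilon>) * q = exp (2 * \<epsilon> - d\<^sup>2 / (8 * w))"
    by (simp add: q_def flip: exp_add)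
  also have "\<dots> \<le> exp (- test_rate * ln (1 + 4 * d\<^sup>2 / \<sigma>\<^sup>2))"
    using 3 4 5 by simp
  also have "\<dots> = (1 + 4 * d\<^sup>2 / \<sigma>\<^sup>2) powr (- test_rate)"
    using pos by (simp add: powr_def)
  finally show ?thesis using that[of 1 q] E by (simp add: q_def)
next
  case False
  define a where "a = d / \<sigma>"
  have a: "a > 256" using False \<sigma> by (simp add: a_def field_simps)
  \<comment> \<open>This choice minimises
    \<open>exp (- \<theta>) + exp \<theta> * 16 / a\<^sup>2\<close>; both terms become 4/a.\<close>
  define \<theta> where "\<theta> = ln (a / 4)"
  have \<theta>: "\<theta> \<ge> 0" "exp \<theta> = a / 4" using a by (auto simp: \<theta>_def)
  have "(\<integral>\<^sup>+x. ennreal (exp (\<theta> * score \<sigma> d ((\<Sum>k<n. x k * v k) + m))) \<partial>D)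
     \<le> (\<integral>\<^sup>+x. ennreal (exp (- \<theta>) + 0 * (\<Sum>k<n. x k * v k)
          + (exp \<theta> * 16 / d ^ 4) * (\<Sum>k<n. x k * v k)\<^sup>2) \<partial>D)"
  proof (intro nn_integral_mono ennreal_leI)
    fix x :: "nat \<Rightarrow> real"
    let ?z = "\<Sum>k<n. x k * v k"
    show "exp (\<theta> * score \<sigma> d (?z + m)) \<le> exp (- \<theta>) + 0 * ?z + (exp \<theta> * 16 / d ^ 4) * ?z\<^sup>2"
    proof (cases "?z + m < 0")
      case True
      have "0 \<le> (exp \<theta> * 16 / d ^ 4) * ?z\<^sup>2" by simp
      then show ?thesis using True False by (simp add: score_def)
    next
      case c: False
      then have "d\<^sup>2 / 4 \<le> ?z" using m by linarith
      then have "(d\<^sup>2 / 4)\<^sup>2 \<le> ?z\<^sup>2" by (intro power_mono) auto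
      then have "1 \<le> 16 / d ^ 4 * ?z\<^sup>2" using d by (simp add: power_divide field_simps flip: power_mult)
      then have "exp \<theta> * 1 \<le> exp \<theta> * (16 / d ^ 4 * ?z\<^sup>2)" by (intro mult_left_mono) auto
      then have "exp \<theta> \<le> exp \<theta> * 16 / d ^ 4 * ?z\<^sup>2" by simp
      moreover have "exp (\<theta> * score \<sigma> d (?z + m)) \<le> exp \<theta>"
        using \<theta>(1) abs_score_le_1[of \<sigma> d "?z + m"] by (simp add: mult_left_le abs_le_iff)
      ultimately have "exp (\<theta> * score \<sigma> d (?z + m)) \<le> exp \<theta> * 16 / d ^ 4 * ?z\<^sup>2" by linarith
      then show ?thesis using exp_ge_zero[of "- \<theta>"] by linarith
    qed
  qed
  also have "\<dots> \<le> ennreal (exp (- \<theta>) + (exp \<theta> * 16 / d ^ 4) * (\<sigma>\<^sup>2 * d\<^sup>2))"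
    unfolding d(2)[symmetric] by (rule noise_quadratic_nn_integral[OF D]) simp_all
  also have "exp (- \<theta>) + (exp \<theta> * 16 / d ^ 4) * (\<sigma>\<^sup>2 * d\<^sup>2) = 8 / a"
    unfolding exp_minus \<theta>(2) a_def using d(1) \<sigma> by (simp add: power2_eq_square power4_eq_xxxx)
  finally have E: "(\<integral>\<^sup>+x. ennreal (exp (\<theta> * score \<sigma> d ((\<Sum>k<n. x k * v k) + m))) \<partial>D) \<le> ennreal (8 / a)" .
  have a2: "4 * d\<^sup>2 / \<sigma>\<^sup>2 = 4 * a\<^sup>2" by (simp add: a_def power_divide)
  have "1 + 4 * a\<^sup>2 \<le> a ^ 4"
  proof -
    have "3\<^sup>2 \<le> a\<^sup>2" using a by (intro power_mono) auto
    then have "9 * a\<^sup>2 \<le> a\<^sup>2 * a\<^sup>2" by (intro mult_right_mono) auto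
    moreover have "a\<^sup>2 * a\<^sup>2 = a ^ 4" by (simp add: power4_eq_xxxx power2_eq_square)
    ultimately show ?thesis using \<open>3\<^sup>2 \<le> a\<^sup>2\<close> by simp
  qed
  moreover have pos: "1 + 4 * a\<^sup>2 > 0" by (intro add_pos_nonneg) auto
  ultimately have "ln (1 + 4 * a\<^sup>2) \<le> ln (a ^ 4)" by (subst ln_le_cancel_iff) (use a in auto)
  also have "\<dots> = 4 * ln a" using a by (simp add: ln_realpow)
  finally have "test_rate * ln (1 + 4 * a\<^sup>2) \<le> (1 / 16) * (4 * ln a)"
    by (intro mult_mono) (auto simp: test_rate_def)
  then have 1: "test_rate * ln (1 + 4 * a\<^sup>2) \<le> ln a / 4" by simp
  \<comment> \<open>The threshold 256 is 4 ^ 4. With \<epsilon> \<le> 1/4 the exponent is at most ln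
    4 - (ln a)/2, and ln a \<ge> 4 ln 4 turns this into -(ln a)/4, as the target needs.\<close>
  have "ln (4 ^ 4) \<le> ln a" using a by (subst ln_le_cancel_iff) auto
  moreover have "ln ((4::real) ^ 4) = 4 * ln 4" by (subst ln_realpow) auto
  ultimately have 2: "4 * ln 4 \<le> ln a" by linarith
  have 3: "\<theta> = ln a - ln 4" using a by (simp add: \<theta>_def ln_div)
  have "ln (8 / a) = ln 8 - ln a" using a by (simp add: ln_div)
  also have "ln 8 = (3/2) * ln (4::real)"
  proof -
    have "ln ((2::real) ^ 3) = 3 * ln 2" "ln ((2::real) ^ 2) = 2 * ln 2"
      by (subst ln_realpow; simp)+
    then show ?thesis by simp
  qed
  finally have "ln (8 / a) = (3/2) * ln 4 - ln a" .
  moreover have "8 / a = exp (ln (8 / a))" using a by simp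
  ultimately have 4: "8 / a = exp ((3/2) * ln 4 - ln a)" by simp
  have 5: "2 * \<theta> * \<epsilon> \<le> \<theta> / 2" using \<theta>(1) \<epsilon>(2) mult_left_mono[of \<epsilon> "1/4" "2 * \<theta>"] by simp
  have "exp (2 * \<theta> * \<epsilon>) * (8 / a) = exp (2 * \<theta> * \<epsilon> + ((3/2) * ln 4 - ln a))"
    unfolding 4 by (rule exp_add[symmetric])
  also have "\<dots> \<le> exp (- test_rate * ln (1 + 4 * a\<^sup>2))"
    using 1 2 3 5 by simp
  also have "\<dots> = (1 + 4 * d\<^sup>2 / \<sigma>\<^sup>2) powr (- test_rate)"
    unfolding a2 using pos by (simp add: powr_def)
  finally show ?thesis using that[of \<theta> "8 / a"] E \<theta> a by simp
qed

lemma shift_sample_in_space: "shift_sample n N \<mu> \<xi> \<in> space (SampM n N)"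
  by (auto simp: shift_sample_def space_SampM Rn_def vadd_def)

text \<open>The projected mean, seen from the midpoint, is -d^2/2 plus an inner product of size at
  most d^2/4, so it stays negative of order d^2 for every \<mu> within d/4 of \<open>g\<close>.
  Corruption costs a factor exp (2 \<theta> \<epsilon>) per sample, already included in the
  one-sample bound.\<close>

lemma test_failure:
  assumes D: "D \<in> noise_dists n (\<sigma>\<^sup>2)" and \<sigma>: "\<sigma> > 0" and C: "C \<in> adversaries n N \<epsilon>"
    and \<epsilon>: "0 \<le> \<epsilon>" "\<epsilon> \<le> 1/4" "\<epsilon> * \<sigma>\<^sup>2 \<le> 2 * test_rate * d\<^sup>2"
    and d: "d = edist n g h" "d > 0" "edist n \<mu> g \<le> d / 4"
  shows "(\<integral>\<^sup>+\<xi>. indicator {\<xi>. 0 \<le> test_stat n N \<sigma> g h (C (shift_sample n N \<mu> \<xi>))} \<xi> \<partial>(PiM {..<N} (\<lambda>_. D)))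
    \<le> ennreal ((1 + 4 * d\<^sup>2 / \<sigma>\<^sup>2) powr (- test_rate * real N))"
proof -
  define v where "v k = h k - g k" for k
  define m where "m = (\<Sum>k<n. (\<mu> k - (g k + h k) / 2) * v k)"
  have v: "(\<Sum>k<n. (v k)\<^sup>2) = d\<^sup>2"
    using edist_power2[of n h g] d(1) by (simp add: v_def edist_commute)
  have m_eq: "m = (\<Sum>k<n. (\<mu> k - g k) * (h k - g k)) - d\<^sup>2 / 2"
    unfolding v[symmetric] m_def v_def sum_divide_distrib sum_subtractf[symmetric]
    by (intro sum.cong) (auto simp: field_simps power2_eq_square)
  have "\<bar>\<Sum>k<n. (\<mu> k - g k) * (h k - g k)\<bar> \<le> edist n \<mu> g * edist n h g" by (rule sum_mult_le_edist)
  also have "\<dots> \<le> d / 4 * d"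
    using d by (intro mult_mono) (auto simp: edist_commute)
  finally have m: "- (3/4) * d\<^sup>2 \<le> m" "m \<le> - (1/4) * d\<^sup>2"
    unfolding m_eq by (auto simp: abs_le_iff power2_eq_square)
  obtain \<theta> q where q: "0 \<le> \<theta>" "0 \<le> q"
    "(\<integral>\<^sup>+x. ennreal (exp (\<theta> * score \<sigma> d ((\<Sum>k<n. x k * v k) + m))) \<partial>D) \<le> ennreal q"
    "exp (2 * \<theta> * \<epsilon>) * q \<le> (1 + 4 * d\<^sup>2 / \<sigma>\<^sup>2) powr (- test_rate)"
    using score_exp_moment[OF D \<sigma> d(2) v m \<epsilon>] by blast
  let ?f = "\<lambda>x. \<theta> * score \<sigma> d ((\<Sum>k<n. x k * v k) + m)"
  have f: "?f \<in> borel_measurable D"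
    by (intro borel_measurable_times borel_measurable_const measurable_compose[OF _ score_measurable]
        borel_measurable_add borel_measurable_sum noise_component_measurable[OF D]) auto
  have "(\<integral>\<^sup>+\<xi>. indicator {\<xi>. 0 \<le> test_stat n N \<sigma> g h (C (shift_sample n N \<mu> \<xi>))} \<xi> \<partial>(PiM {..<N} (\<lambda>_. D)))
     \<le> (\<integral>\<^sup>+\<xi>. indicator {\<xi>. - (2 * \<theta> * \<epsilon> * real N) \<le> (\<Sum>i<N. ?f (\<xi> i))} \<xi> \<partial>(PiM {..<N} (\<lambda>_. D)))"
  proof (rule nn_integral_mono)
    fix \<xi> :: "nat \<Rightarrow> nat \<Rightarrow> real"
    let ?X = "shift_sample n N \<mu> \<xi>"
    have "?X \<in> space (SampM n N)" by (rule shift_sample_in_space)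
    then have card: "real (card {i\<in>{..<N}. C ?X i \<noteq> ?X i}) \<le> \<epsilon> * real N"
      using C by (auto simp: adversaries_def)
    have "(\<Sum>k<n. (?X i k - (g k + h k) / 2) * (h k - g k)) = (\<Sum>k<n. \<xi> i k * v k) + m" if "i < N" for i
      using that unfolding m_def v_def sum.distrib[symmetric]
      by (intro sum.cong) (auto simp: shift_sample_def vadd_def algebra_simps)
    then have "\<theta> * test_stat n N \<sigma> g h ?X = (\<Sum>i<N. ?f (\<xi> i))"
      unfolding test_stat_def d(1)[symmetric] sum_distrib_left by (intro sum.cong) auto
    moreover have "test_stat n N \<sigma> g h (C ?X) \<le> test_stat n N \<sigma> g h ?X + 2 * (\<epsilon> * real N)"
      using card by (intro corrupted_test_stat) auto
    then have "\<theta> * test_stat n N \<sigma> g h (C ?X) \<le> \<theta> * (test_stat n N \<sigma> g h ?X + 2 * (\<epsilon> * real N))"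
      using q(1) by (rule mult_left_mono)
    ultimately have "0 \<le> test_stat n N \<sigma> g h (C ?X) \<Longrightarrow> - (2 * \<theta> * \<epsilon> * real N) \<le> (\<Sum>i<N. ?f (\<xi> i))"
      using mult_nonneg_nonneg[OF q(1), of "test_stat n N \<sigma> g h (C ?X)"] by (simp add: algebra_simps)
    then show "indicator {\<xi>. 0 \<le> test_stat n N \<sigma> g h (C (shift_sample n N \<mu> \<xi>))} \<xi>
        \<le> (indicator {\<xi>. - (2 * \<theta> * \<epsilon> * real N) \<le> (\<Sum>i<N. ?f (\<xi> i))} \<xi> :: ennreal)"
      by (auto simp: indicator_def)
  qed
  also have "\<dots> \<le> ennreal (exp (2 * \<theta> * \<epsilon> * real N) * q ^ N)"
    by (rule chernoff_iid[OF noise_prob_space[OF D] f q(3,2)])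
  also have "exp (2 * \<theta> * \<epsilon> * real N) * q ^ N = (exp (2 * \<theta> * \<epsilon>) * q) ^ N"
    by (simp only: exp_of_nat2_mult power_mult_distrib)
  also have "ennreal \<dots> \<le> ennreal (((1 + 4 * d\<^sup>2 / \<sigma>\<^sup>2) powr (- test_rate)) ^ N)"
    using q by (intro ennreal_leI power_mono) auto
  also have "((1 + 4 * d\<^sup>2 / \<sigma>\<^sup>2) powr (- test_rate)) ^ N = (1 + 4 * d\<^sup>2 / \<sigma>\<^sup>2) powr (- test_rate * real N)"
  proof -
    have "1 + 4 * d\<^sup>2 / \<sigma>\<^sup>2 > 0" by (intro add_pos_nonneg) auto
    then have "(1 + 4 * d\<^sup>2 / \<sigma>\<^sup>2) powr (- test_rate) > 0" by simp
    from powr_realpow[OF this, of N] show ?thesis by (simp add: powr_powr)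
  qed
  finally show ?thesis .
qed

section \<open>The tournament estimator\<close>

text \<open>Weighted arithmetic-geometric mean of 1 + p x and 1, with weights 1/p and 1 - 1/p. It is
  needed when r^2/\<sigma>^2 is as small as 1/N: an exponent of order N makes up for the small
  base.\<close>

lemma bernoulli_powr:
  fixes x p :: real
  assumes "0 \<le> x" "1 \<le> p"
  shows "1 + p * x \<le> (1 + x) powr p"
proof -
  have pos: "1 + p * x > 0" using assms by (intro add_pos_nonneg) auto
  have "(1 + p * x) powr (1 / p) * 1 powr (1 - 1 / p) \<le> (1 / p) * (1 + p * x) + (1 - 1 / p) * 1"
    using assms pos by (intro Youngs_inequality_0) auto
  also have "\<dots> = 1 + x" using assms by (simp add: field_simps)
  finally have "(1 + p * x) powr (1 / p) \<le> 1 + x" by simp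
  then have "((1 + p * x) powr (1 / p)) powr p \<le> (1 + x) powr p"
    using assms by (intro powr_mono2) auto
  then show ?thesis using assms pos by (simp add: powr_powr)
qed

text \<open>At x = 4^i t the right-hand sides telescope over i, which is the reason for the 4 inside
  the second logarithm. The constant 3 is 2 * 4/3 rounded up.\<close>

lemma min_le_ln_diff:
  fixes x :: real
  assumes "0 \<le> x"
  shows "min 1 x \<le> 3 * (ln (1 + x) - ln (1 + x / 4))"
proof -
  have pos: "1 + x > 0" "1 + x / 4 > 0" using assms by auto
  have "ln ((1 + x / 4) / (1 + x)) \<le> (1 + x / 4) / (1 + x) - 1"
    using pos by (intro ln_le_minus_one) auto
  also have "\<dots> = - (3 / 4) * (x / (1 + x))" using pos by (simp add: field_simps)
  finally have "(3 / 4) * (x / (1 + x)) \<le> ln (1 + x) - ln (1 + x / 4)"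
    using pos by (simp add: ln_div)
  moreover have "min 1 x \<le> 2 * (x / (1 + x))"
  proof (cases "x \<le> 1")
    case True
    have "x * (1 + x) \<le> x * 2" using True assms by (intro mult_left_mono) auto
    then show ?thesis using True pos by (simp add: pos_le_divide_eq mult.commute)
  next
    case False
    then show ?thesis using pos by (simp add: pos_le_divide_eq)
  qed
  moreover have "(3 / 4) * u \<le> l \<Longrightarrow> m \<le> 2 * u \<Longrightarrow> 0 \<le> u \<Longrightarrow> m \<le> 3 * l" for u l m :: real by linarith
  moreover have "0 \<le> x / (1 + x)" using assms by simp
  ultimately show ?thesis by blast
qed

section \<open>The estimator and its measurability\<close>

definition good_at :: "nat \<Rightarrow> nat \<Rightarrow> real \<Rightarrow> (nat \<Rightarrow> real) set \<Rightarrow> real \<Rightarrow> nat \<Rightarrow> (nat \<Rightarrow> real)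
    \<Rightarrow> (nat \<Rightarrow> nat \<Rightarrow> real) \<Rightarrow> bool" where
  "good_at n N \<sigma> G r J g x \<longleftrightarrow>
     (\<forall>h\<in>G. 2 ^ J * r \<le> edist n g h \<longrightarrow> test_stat n N \<sigma> g h x < 0)"

text \<open>Both selections are \<open>LEAST\<close> over naturals, through an enumeration of
  \<open>G\<close>, to keep the map measurable. If no radius admits a good candidate,
  \<open>LEAST\<close> still returns some index, and for nonempty \<open>G\<close> the value is a
  point of \<open>G\<close> all the same.\<close>

definition tournament :: "nat \<Rightarrow> nat \<Rightarrow> real \<Rightarrow> (nat \<Rightarrow> real) set \<Rightarrow> real
    \<Rightarrow> (nat \<Rightarrow> nat \<Rightarrow> real) \<Rightarrow> (nat \<Rightarrow> real)" where
  "tournament n N \<sigma> G r x = (let J = LEAST J. \<exists>k. good_at n N \<sigma> G r J (from_nat_into G k) x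
     in from_nat_into G (LEAST k. good_at n N \<sigma> G r J (from_nat_into G k) x))"

lemma good_at_measurable:
  assumes "countable G" "G \<noteq> {}"
  shows "Measurable.pred (SampM n N) (good_at n N \<sigma> G r J g)"
proof -
  note [measurable] = test_stat_measurable
  have "good_at n N \<sigma> G r J g = (\<lambda>x. \<forall>k. 2 ^ J * r \<le> edist n g (from_nat_into G k) \<longrightarrow>
      test_stat n N \<sigma> g (from_nat_into G k) x < 0)"
    unfolding good_at_def fun_eq_iff
    using range_from_nat_into[OF assms(2,1)] by (metis rangeI rangeE)
  then show ?thesis by simp
qed

lemma tournament_measurable:
  assumes "countable G" "G \<noteq> {}" "G \<subseteq> Rn n"
  shows "tournament n N \<sigma> G r \<in> estimators n N"
proof -
  note [measurable] = good_at_measurable[OF assms(1,2)]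
  have 1: "(\<lambda>x. LEAST J. \<exists>k. good_at n N \<sigma> G r J (from_nat_into G k) x)
      \<in> measurable (SampM n N) (count_space UNIV)" (is "?J \<in> _") by measurable
  have 2: "(\<lambda>x. LEAST k. good_at n N \<sigma> G r J (from_nat_into G k) x)
      \<in> measurable (SampM n N) (count_space UNIV)" (is "?k J \<in> _") for J by measurable
  have 3: "(\<lambda>x. ?k (?J x) x) \<in> measurable (SampM n N) (count_space UNIV)"
    by (rule measurable_compose_countable[OF 2 1])
  have "from_nat_into G \<in> measurable (count_space UNIV) (RnM n)"
    using from_nat_into[OF assms(2)] assms(3) by (auto simp: space_RnM)
  from measurable_compose[OF 3 this] show ?thesis
    unfolding estimators_def tournament_def[abs_def] Let_def .
qed

section \<open>Losses of a candidate near the mean, shell by shell\<close>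

definition shell_loss :: "nat \<Rightarrow> nat \<Rightarrow> real \<Rightarrow> (nat \<Rightarrow> real) set \<Rightarrow> real \<Rightarrow> (nat \<Rightarrow> real) \<Rightarrow> nat
    \<Rightarrow> (nat \<Rightarrow> nat \<Rightarrow> real) \<Rightarrow> bool" where
  "shell_loss n N \<sigma> G r g j x \<longleftrightarrow> (\<exists>h\<in>G. 2 ^ j * r \<le> edist n g h \<and> edist n g h < 2 ^ Suc j * r
     \<and> 0 \<le> test_stat n N \<sigma> g h x)"

lemma power2_power_eq: "((2::real) ^ j)\<^sup>2 = 4 ^ j"
  by (simp add: power2_eq_square flip: power_mult_distrib)

lemma dyadic_bracket:
  assumes "r > 0" "2 ^ m * r \<le> d"
  obtains j where "m \<le> j" "2 ^ j * r \<le> d" "d < 2 ^ Suc j * (r :: real)"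
proof -
  obtain k where k: "d / r < 2 ^ k" using real_arch_pow[of 2 "d / r"] by auto
  define P where "P j \<longleftrightarrow> d < 2 ^ Suc j * r \<and> m \<le> j" for j
  have "d < 2 ^ Suc (max k m) * r"
  proof -
    have "d < 2 ^ k * r" using k assms by (simp add: field_simps)
    also have "\<dots> \<le> 2 ^ Suc (max k m) * r" using assms
      by (intro mult_right_mono power_increasing) auto
    finally show ?thesis .
  qed
  then have ex: "P (max k m)" by (simp add: P_def)
  define j where "j = (LEAST j. P j)"
  have Pj: "P j" unfolding j_def using ex by (rule LeastI)
  have "2 ^ j * r \<le> d"
  proof (cases "j = m")
    case False
    then obtain i where i: "j = Suc i" "m \<le> i" using Pj unfolding P_def by (cases j) auto
    then have "\<not> P i" using not_less_Least[of i P] by (simp add: j_def)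
    then show ?thesis using i by (simp add: P_def)
  qed (use assms in simp)
  then show ?thesis using that Pj by (auto simp: P_def)
qed

text \<open>If \<open>g\<close> were good at radius index j, the selected index would be at most j.
  The winner would then beat \<open>g\<close> and \<open>g\<close> the winner, against the
  antisymmetry of \<open>test_stat\<close>. So \<open>g\<close> loses to some rival at least that
  far away.\<close>

lemma tournament_far_imp_shell_loss:
  assumes G: "countable G" "g \<in> G" and r: "r > 0"
    and d: "2 ^ j * r \<le> edist n (tournament n N \<sigma> G r x) g"
  obtains i where "j \<le> i" "shell_loss n N \<sigma> G r g i x"
proof -
  define \<L> where "\<L> = (LEAST J. \<exists>k. good_at n N \<sigma> G r J (from_nat_into G k) x)"
  let ?t = "tournament n N \<sigma> G r x"
  have t: "?t = from_nat_into G (LEAST k. good_at n N \<sigma> G r \<L> (from_nat_into G k) x)"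
    by (simp add: tournament_def \<L>_def Let_def)
  have tG: "?t \<in> G" unfolding t using G by (intro from_nat_into) auto
  have "\<not> good_at n N \<sigma> G r j g x"
  proof
    assume gj: "good_at n N \<sigma> G r j g x"
    obtain k where k: "from_nat_into G k = g" using from_nat_into_surj[OF G] by blast
    have ex: "\<exists>k. good_at n N \<sigma> G r j (from_nat_into G k) x" using gj k by metis
    then have "\<exists>k. good_at n N \<sigma> G r \<L> (from_nat_into G k) x"
      unfolding \<L>_def by (rule LeastI)
    then have "good_at n N \<sigma> G r \<L> ?t x" unfolding t by (rule LeastI_ex)
    moreover have "\<L> \<le> j" unfolding \<L>_def using ex by (rule Least_le)
    then have "2 ^ \<L> * r \<le> 2 ^ j * r" using r by (intro mult_right_mono power_increasing) auto
    ultimately have "test_stat n N \<sigma> ?t g x < 0"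
      using d G(2) unfolding good_at_def by force
    moreover have "test_stat n N \<sigma> g ?t x < 0"
      using gj d tG unfolding good_at_def by (simp add: edist_commute)
    ultimately show False using test_stat_swap[of n N \<sigma> g ?t x] by simp
  qed
  then obtain h where h: "h \<in> G" "2 ^ j * r \<le> edist n g h" "0 \<le> test_stat n N \<sigma> g h x"
    unfolding good_at_def by (auto simp: not_less)
  obtain i where "j \<le> i" "2 ^ i * r \<le> edist n g h" "edist n g h < 2 ^ Suc i * r"
    using dyadic_bracket[OF r h(2)] by blast
  then show ?thesis using that h unfolding shell_loss_def by blast
qed

text \<open>Shells are counted from index 2, that is from distance 4 r: there a mean within
  \<open>r\<close> of \<open>g\<close> is within a quarter of the distance, as the tests require.
  Summing over all shells replaces the unknown shell in which \<open>g\<close> loses.\<close>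

lemma tournament_loss_le:
  assumes G: "countable G" "g \<in> G" and r: "r > 0"
  shows "ennreal ((edist n (tournament n N \<sigma> G r x) g)\<^sup>2) \<le> ennreal (16 * r\<^sup>2)
     + (\<Sum>j. ennreal (4 ^ (j + 3) * r\<^sup>2) * indicator {x. shell_loss n N \<sigma> G r g (j + 2) x} x)"
    (is "ennreal (?d\<^sup>2) \<le> _ + (\<Sum>j. ?f j)")
proof (cases "?d < 4 * r")
  case True
  then have "?d\<^sup>2 \<le> (4 * r)\<^sup>2" by (intro power_mono) auto
  then have "ennreal (?d\<^sup>2) \<le> ennreal (16 * r\<^sup>2)" by (intro ennreal_leI) (simp add: power_mult_distrib)
  then show ?thesis by (rule order_trans) simp
next
  case False
  then have "2 ^ 2 * r \<le> ?d" by simp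
  from dyadic_bracket[OF r this] obtain j where j: "2 \<le> j" "2 ^ j * r \<le> ?d" "?d < 2 ^ Suc j * r" .
  from tournament_far_imp_shell_loss[OF G r j(2)]
  obtain i where i: "j \<le> i" "shell_loss n N \<sigma> G r g i x" .
  define k where "k = i - 2"
  have k: "i = k + 2" using i j by (simp add: k_def)
  have "?d \<le> 2 ^ Suc i * r"
    using j(3) i r mult_right_mono[of "2 ^ Suc j" "2 ^ Suc i" r] power_increasing[of "Suc j" "Suc i" "2::real"]
    by linarith
  then have "?d\<^sup>2 \<le> (2 ^ Suc i * r)\<^sup>2" by (intro power_mono) auto
  also have "\<dots> = 4 ^ (k + 3) * r\<^sup>2"
    by (simp add: k power_mult_distrib power_add power2_power_eq)
  finally have "ennreal (?d\<^sup>2) \<le> ennreal (4 ^ (k + 3) * r\<^sup>2)" by (rule ennreal_leI)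
  also have "\<dots> = ?f k" using i k by simp
  also have "\<dots> = (\<Sum>j\<in>{k}. ?f j)" by (simp only: sum.insert finite.emptyI empty_iff sum.empty not_False_eq_True add_0_right)
  also have "\<dots> \<le> (\<Sum>j. ?f j)" by (intro sum_le_suminf) auto
  also have "\<dots> \<le> ennreal (16 * r\<^sup>2) + (\<Sum>j. ?f j)" by simp
  finally show ?thesis .
qed

lemma shift_sample_measurable:
  assumes "sets D = sets (RnM n)"
  shows "shift_sample n N \<mu> \<in> measurable (PiM {..<N} (\<lambda>_. D)) (SampM n N)"
proof -
  have vadd: "vadd n \<mu> \<in> measurable D (RnM n)"
  proof -
    have "(\<lambda>y. y k) \<in> borel_measurable D" if "k < n" for k
      unfolding measurable_cong_sets[OF assms refl]
      unfolding RnM_def using that by (intro measurable_component_singleton) auto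
    then show ?thesis unfolding RnM_def vadd_def[abs_def]
      by (intro measurable_restrict borel_measurable_add) auto
  qed
  show ?thesis unfolding SampM_def shift_sample_def[abs_def]
    by (intro measurable_restrict measurable_compose[OF _ vadd] measurable_component_singleton) auto
qed

lemma shell_loss_sets:
  assumes "countable G" 
  shows "{x \<in> space (SampM n N). shell_loss n N \<sigma> G r g j x} \<in> sets (SampM n N)"
proof -
  note [measurable] = test_stat_measurable
  have "{x \<in> space (SampM n N). shell_loss n N \<sigma> G r g j x}
     = (\<Union>h\<in>{h\<in>G. 2 ^ j * r \<le> edist n g h \<and> edist n g h < 2 ^ Suc j * r}.
          {x \<in> space (SampM n N). 0 \<le> test_stat n N \<sigma> g h x})"
    unfolding shell_loss_def by auto
  also have "\<dots> \<in> sets (SampM n N)"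
    using assms by (intro sets.countable_UN'' countable_Collect) auto
  finally show ?thesis .
qed

text \<open>The entropy bounds grow geometrically until 4^i t reaches 1 and are constant afterwards;
  majorising the minimum by a difference of logarithms treats both regimes at once.\<close>

lemma entropy_telescope:
  fixes t :: real
  assumes "\<And>i. ln (M i) \<le> L * min 1 (4 ^ i * t)" "\<And>i. 1 \<le> M i" "0 \<le> t" "0 \<le> L"
  shows "(\<Prod>i<m. M i) \<le> (1 + 4 ^ m * t / 4) powr (3 * L)"
proof (induction m)
  case (Suc m)
  have pos: "0 < 1 + 4 ^ m * t / 4" "0 < 1 + 4 ^ m * t" "M m > 0"
    using assms(2)[of m] assms(3) by (auto intro!: add_pos_nonneg)
  have "L * min 1 (4 ^ m * t) \<le> L * (3 * (ln (1 + 4 ^ m * t) - ln (1 + 4 ^ m * t / 4)))"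
    using min_le_ln_diff[of "4 ^ m * t"] assms by (intro mult_left_mono) auto
  with assms(1)[of m] have "ln (M m) \<le> (3 * L) * (ln (1 + 4 ^ m * t) - ln (1 + 4 ^ m * t / 4))"
    by (simp add: mult_ac)
  then have "exp (ln (M m)) \<le> exp ((3 * L) * (ln (1 + 4 ^ m * t) - ln (1 + 4 ^ m * t / 4)))" by simp
  then have "M m \<le> (1 + 4 ^ m * t) powr (3 * L) / (1 + 4 ^ m * t / 4) powr (3 * L)"
    using pos by (simp add: powr_def exp_diff right_diff_distrib)
  then have "(\<Prod>i<m. M i) * M m \<le> (1 + 4 ^ m * t / 4) powr (3 * L) *
      ((1 + 4 ^ m * t) powr (3 * L) / (1 + 4 ^ m * t / 4) powr (3 * L))"
    using Suc.IH pos by (intro mult_mono) auto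
  then show ?case using pos by simp
next
  case 0
  have "1 \<le> (1 + t / 4) powr (3 * L)" using assms by (intro ge_one_powr_ge_zero) auto
  then show ?case by simp
qed

text \<open>Union bound over one shell. The entropy constant \<open>test_rate / 6\<close> becomes
  \<open>test_rate / 2\<close> through the factor 3 of the telescoping, so the number of rivals uses
  up half of the decay exponent of a single test.\<close>

lemma shell_loss_probability:
  assumes D: "D \<in> noise_dists n (\<sigma>\<^sup>2)" and \<sigma>: "\<sigma> > 0" and C: "C \<in> adversaries n N \<epsilon>"
    and K: "K \<subseteq> Rn n" and c: "c \<ge> 2" and G: "G \<subseteq> K" "separated n r G" "g \<in> G" and r: "r > 0"
    and \<mu>: "edist n \<mu> g \<le> r" and j: "j \<ge> 2"
    and \<epsilon>: "0 \<le> \<epsilon>" "\<epsilon> \<le> 1/4" "\<epsilon> * \<sigma>\<^sup>2 \<le> 2 * test_rate * r\<^sup>2"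
    and ent: "\<And>i. ln (Mloc n K (2 ^ i * r) c) \<le> test_rate / 6 * real N * min 1 (4 ^ i * (r\<^sup>2 / \<sigma>\<^sup>2))"
  shows "(\<integral>\<^sup>+\<xi>. indicator {x. shell_loss n N \<sigma> G r g j x} (C (shift_sample n N \<mu> \<xi>)) \<partial>(PiM {..<N} (\<lambda>_. D)))
    \<le> ennreal ((1 + 4 * (4 ^ j * (r\<^sup>2 / \<sigma>\<^sup>2))) powr (- (test_rate / 2) * real N))"
proof -
  \<comment> \<open>The shell lies in the ball of radius \<open>2 ^ (j + 2) * r / 2\<close>, which
    takes j + 2 covering steps and yields 4 ^ (j + 2) / 4 = 4 * 4 ^ j. The factor 4 in the failure
    bound of the tests matches this base.\<close>
  define y where "y = 1 + 4 * (4 ^ j * (r\<^sup>2 / \<sigma>\<^sup>2))"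
  have y: "y \<ge> 1" by (simp add: y_def)
  define S where "S = {h\<in>G. 2 ^ j * r \<le> edist n g h \<and> edist n g h < 2 ^ Suc j * r}"
  let ?P = "PiM {..<N} (\<lambda>_. D)"
  have sub: "S \<subseteq> G \<inter> cballn n g (2 ^ (j + 2) * r / 2)"
  proof
    fix h assume "h \<in> S"
    then have "h \<in> G" "edist n g h \<le> 2 ^ (j + 2) * r / 2" by (auto simp: S_def mult.commute)
    then show "h \<in> G \<inter> cballn n g (2 ^ (j + 2) * r / 2)" using G K by (auto simp: cballn_def)
  qed
  have gK: "g \<in> K" using G by blast
  note cnt = card_separated_le_prod_Mloc[OF c K r G(2,1) gK, of "j + 2"]
  have fin: "finite S" using finite_subset[OF sub] cnt by blast
  have "real (card S) \<le> real (card (G \<inter> cballn n g (2 ^ (j + 2) * r / 2)))"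
    using card_mono[OF _ sub] cnt by simp
  also have "\<dots> \<le> (\<Prod>i<j + 2. Mloc n K (2 ^ i * r) c)" using cnt by blast
  also have "\<dots> \<le> (1 + 4 ^ (j + 2) * (r\<^sup>2 / \<sigma>\<^sup>2) / 4) powr (3 * (test_rate / 6 * real N))"
    using ent test_rate_pos gK K c r by (intro entropy_telescope Mloc_ge_1) auto
  also have "\<dots> = y powr (test_rate / 2 * real N)" by (simp add: y_def mult_ac)
  finally have card: "real (card S) \<le> y powr (test_rate / 2 * real N)" .
  have meas: "(\<lambda>\<xi>. C (shift_sample n N \<mu> \<xi>)) \<in> measurable ?P (SampM n N)"
    using measurable_compose[OF shift_sample_measurable[OF noise_sets[OF D]]] C
    by (auto simp: adversaries_def)
  have tm: "(\<lambda>\<xi>. test_stat n N \<sigma> g h (C (shift_sample n N \<mu> \<xi>))) \<in> borel_measurable ?P" for h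
    by (rule measurable_compose[OF meas test_stat_measurable])
  note [measurable] = tm
  have "(\<integral>\<^sup>+\<xi>. indicator {x. shell_loss n N \<sigma> G r g j x} (C (shift_sample n N \<mu> \<xi>)) \<partial>?P)
    \<le> (\<integral>\<^sup>+\<xi>. (\<Sum>h\<in>S. indicator {\<xi>. 0 \<le> test_stat n N \<sigma> g h (C (shift_sample n N \<mu> \<xi>))} \<xi>) \<partial>?P)"
  proof (rule nn_integral_mono)
    fix \<xi>
    show "(indicator {x. shell_loss n N \<sigma> G r g j x} (C (shift_sample n N \<mu> \<xi>)) :: ennreal)
      \<le> (\<Sum>h\<in>S. indicator {\<xi>. 0 \<le> test_stat n N \<sigma> g h (C (shift_sample n N \<mu> \<xi>))} \<xi>)"
    proof (cases "shell_loss n N \<sigma> G r g j (C (shift_sample n N \<mu> \<xi>))")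
      case True
      then obtain h where h: "h \<in> S" "0 \<le> test_stat n N \<sigma> g h (C (shift_sample n N \<mu> \<xi>))"
        unfolding shell_loss_def S_def by blast
      then have "1 \<le> (\<Sum>h\<in>{h}. indicator {\<xi>. 0 \<le> test_stat n N \<sigma> g h (C (shift_sample n N \<mu> \<xi>))} \<xi> :: ennreal)"
        by simp
      also have "\<dots> \<le> (\<Sum>h\<in>S. indicator {\<xi>. 0 \<le> test_stat n N \<sigma> g h (C (shift_sample n N \<mu> \<xi>))} \<xi>)"
        using h fin by (intro sum_mono2) auto
      finally show ?thesis using True by simp
    qed simp
  qed
  also have "\<dots> = (\<Sum>h\<in>S. \<integral>\<^sup>+\<xi>. indicator {\<xi>. 0 \<le> test_stat n N \<sigma> g h (C (shift_sample n N \<mu> \<xi>))} \<xi> \<partial>?P)"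
    by (rule nn_integral_sum) measurable
  also have "\<dots> \<le> (\<Sum>h\<in>S. ennreal (y powr (- test_rate * real N)))"
  proof (rule sum_mono)
    fix h assume h: "h \<in> S"
    define d where "d = edist n g h"
    have d: "2 ^ j * r \<le> d" using h by (simp add: S_def d_def)
    have "(2::real) ^ 2 \<le> 2 ^ j" using j by (intro power_increasing) auto
    then have "4 * r \<le> 2 ^ j * r" using r by (intro mult_right_mono) auto
    with d have d4: "4 * r \<le> d" by linarith
    have "r\<^sup>2 \<le> d\<^sup>2" using d4 r by (intro power_mono) auto
    then have \<epsilon>d: "\<epsilon> * \<sigma>\<^sup>2 \<le> 2 * test_rate * d\<^sup>2"
      using \<epsilon>(3) mult_left_mono[of "r\<^sup>2" "d\<^sup>2" "2 * test_rate"] test_rate_pos by linarith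
    have "(2 ^ j * r)\<^sup>2 \<le> d\<^sup>2" using d r by (intro power_mono) auto
    then have "4 ^ j * r\<^sup>2 \<le> d\<^sup>2" by (simp add: power_mult_distrib power2_power_eq)
    then have "y \<le> 1 + 4 * d\<^sup>2 / \<sigma>\<^sup>2"
      unfolding y_def using \<sigma> by (simp add: divide_right_mono)
    then have "(1 + 4 * d\<^sup>2 / \<sigma>\<^sup>2) powr (- test_rate * real N) \<le> y powr (- test_rate * real N)"
      using y test_rate_pos by (intro powr_mono2') auto
    moreover have "(\<integral>\<^sup>+\<xi>. indicator {\<xi>. 0 \<le> test_stat n N \<sigma> g h (C (shift_sample n N \<mu> \<xi>))} \<xi> \<partial>?P)
      \<le> ennreal ((1 + 4 * d\<^sup>2 / \<sigma>\<^sup>2) powr (- test_rate * real N))"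
      using d4 r \<mu> by (intro test_failure[OF D \<sigma> C \<epsilon>(1,2) \<epsilon>d d_def]) auto
    ultimately show "(\<integral>\<^sup>+\<xi>. indicator {\<xi>. 0 \<le> test_stat n N \<sigma> g h (C (shift_sample n N \<mu> \<xi>))} \<xi> \<partial>?P)
      \<le> ennreal (y powr (- test_rate * real N))"
      by (meson ennreal_leI order_trans)
  qed
  also have "\<dots> = ennreal (real (card S) * y powr (- test_rate * real N))"
    by (simp add: ennreal_mult ennreal_of_nat_eq_real_of_nat)
  also have "\<dots> \<le> ennreal (y powr (test_rate / 2 * real N) * y powr (- test_rate * real N))"
    using card by (intro ennreal_leI mult_right_mono) auto
  also have "y powr (test_rate / 2 * real N) * y powr (- test_rate * real N) = y powr (- (test_rate / 2) * real N)"
    by (simp flip: powr_add)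
  finally show ?thesis unfolding y_def .
qed

lemma four_power_sq: "((4::real) ^ j)\<^sup>2 = 16 ^ j"
  by (simp add: power2_eq_square flip: power_mult_distrib)

lemma minimax_risk_upper:
  assumes \<sigma>: "\<sigma> > 0" and K: "K \<subseteq> Rn n" "K \<noteq> {}" and c: "c \<ge> 2" and r: "r > 0"
    and \<epsilon>: "0 \<le> \<epsilon>" "\<epsilon> \<le> 1/4" "\<epsilon> * \<sigma>\<^sup>2 \<le> 2 * test_rate * r\<^sup>2"
    and N: "4 \<le> test_rate * real N" "1 \<le> test_rate * real N * (r\<^sup>2 / \<sigma>\<^sup>2)"
    and ent: "\<And>i. ln (Mloc n K (2 ^ i * r) c) \<le> test_rate / 6 * real N * min 1 (4 ^ i * (r\<^sup>2 / \<sigma>\<^sup>2))"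
  shows "minimax_risk n N \<sigma> \<epsilon> K \<le> ennreal (46 * r\<^sup>2)"
proof -
  obtain G where G: "G \<subseteq> K" "separated n r G" "\<And>x. x \<in> K \<Longrightarrow> x \<notin> G \<Longrightarrow> \<exists>g\<in>G. edist n g x \<le> r"
    using maximal_separated_exists by blast
  have Gne: "G \<noteq> {}" using G K by blast
  have GR: "G \<subseteq> Rn n" using G K by blast
  have Gc: "countable G" by (rule countable_separated[OF G(2) GR r])
  let ?t = "tournament n N \<sigma> G r"
  have risk: "risk n N ?t \<mu> D C \<le> ennreal (46 * r\<^sup>2)"
    if \<mu>: "\<mu> \<in> K" and D: "D \<in> noise_dists n (\<sigma>\<^sup>2)" and C: "C \<in> adversaries n N \<epsilon>" for \<mu> D C
  proof -
    obtain g where g: "g \<in> G" "edist n \<mu> g \<le> r"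
    proof (cases "\<mu> \<in> G")
      case True
      then show ?thesis using that[of \<mu>] r by simp
    next
      case False
      then show ?thesis using that G(3)[OF \<mu>] by (auto simp: edist_commute)
    qed
    interpret D: prob_space D by (rule noise_prob_space[OF D])
    let ?P = "PiM {..<N} (\<lambda>_. D)"
    interpret P: prob_space ?P by (rule prob_space_PiM) (rule D.prob_space_axioms)
    have meas: "(\<lambda>\<xi>. C (shift_sample n N \<mu> \<xi>)) \<in> measurable ?P (SampM n N)"
      using measurable_compose[OF shift_sample_measurable[OF noise_sets[OF D]]] C
      by (auto simp: adversaries_def)
    define I :: "nat \<Rightarrow> (nat \<Rightarrow> nat \<Rightarrow> real) \<Rightarrow> ennreal" where
      "I j \<xi> = indicator {x. shell_loss n N \<sigma> G r g (j + 2) x} (C (shift_sample n N \<mu> \<xi>))" for j \<xi>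
    have Im [measurable]: "I j \<in> borel_measurable ?P" for j
    proof -
      have "(\<lambda>\<xi>. indicator {x \<in> space (SampM n N). shell_loss n N \<sigma> G r g (j + 2) x} (C (shift_sample n N \<mu> \<xi>)) :: ennreal)
        \<in> borel_measurable ?P"
        by (rule measurable_compose[OF meas borel_measurable_indicator[OF shell_loss_sets[OF Gc]]])
      then show ?thesis
        by (rule measurable_cong[THEN iffD1, rotated])
          (use measurable_space[OF meas] in \<open>auto simp: I_def indicator_def\<close>)
    qed
    \<comment> \<open>The weight 4 ^ (j + 3) of a shell must be beaten. Half of the exponent, at
      least 1 by the first bound on \<open>N\<close>, gives 4 ^ (j + 2) by Bernoulli's inequality;
      squaring restores the full exponent and gives 16 ^ (j + 2).\<close>
    have Ib: "(\<integral>\<^sup>+\<xi>. I j \<xi> \<partial>?P) \<le> ennreal (1 / 16 ^ (j + 2))" for j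
    proof -
      let ?a = "4 ^ (j + 2) * (r\<^sup>2 / \<sigma>\<^sup>2)" and ?p = "test_rate / 4 * real N"
      have a: "0 \<le> ?a" by simp
      have "4 ^ (j + 2) * 1 \<le> 4 ^ (j + 2) * (test_rate * real N * (r\<^sup>2 / \<sigma>\<^sup>2))"
        by (rule mult_left_mono[OF N(2)]) simp
      also have "\<dots> = ?p * (4 * ?a)" by simp
      also have "\<dots> \<le> 1 + ?p * (4 * ?a)" by linarith
      also have "\<dots> \<le> (1 + 4 * ?a) powr ?p"
        using N(1) a by (intro bernoulli_powr) auto
      finally have "4 ^ (j + 2) \<le> (1 + 4 * ?a) powr ?p" by simp
      then have "(4 ^ (j + 2))\<^sup>2 \<le> ((1 + 4 * ?a) powr ?p)\<^sup>2" by (intro power_mono) auto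
      also have "((1 + 4 * ?a) powr ?p)\<^sup>2 = (1 + 4 * ?a) powr (test_rate / 2 * real N)"
        by (simp add: power2_eq_square flip: powr_add)
      finally have "16 ^ (j + 2) \<le> (1 + 4 * ?a) powr (test_rate / 2 * real N)"
        unfolding four_power_sq .
      then have "1 / (1 + 4 * ?a) powr (test_rate / 2 * real N) \<le> 1 / 16 ^ (j + 2)"
        by (intro frac_le) auto
      then have le: "(1 + 4 * ?a) powr (- (test_rate / 2) * real N) \<le> 1 / 16 ^ (j + 2)"
        by (simp add: powr_minus_divide)
      have "(\<integral>\<^sup>+\<xi>. I j \<xi> \<partial>?P) \<le> ennreal ((1 + 4 * ?a) powr (- (test_rate / 2) * real N))"
        unfolding I_def
        by (rule shell_loss_probability[OF D \<sigma> C K(1) c G(1,2) g(1) r g(2) _ \<epsilon> ent]) simp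
      also have "\<dots> \<le> ennreal (1 / 16 ^ (j + 2))" using le by (rule ennreal_leI)
      finally show ?thesis .
    qed
    have "risk n N ?t \<mu> D C
      \<le> (\<integral>\<^sup>+\<xi>. ennreal (34 * r\<^sup>2) + 2 * (\<Sum>j. ennreal (4 ^ (j + 3) * r\<^sup>2) * I j \<xi>) \<partial>?P)"
      unfolding risk_def
    proof (rule nn_integral_mono)
      fix \<xi>
      let ?x = "C (shift_sample n N \<mu> \<xi>)"
      have "edist n (?t ?x) \<mu> \<le> edist n (?t ?x) g + r"
        using edist_triangle[of n "?t ?x" \<mu> g] g(2) by (simp add: edist_commute)
      then have "(edist n (?t ?x) \<mu>)\<^sup>2 \<le> (edist n (?t ?x) g + r)\<^sup>2" by (intro power_mono) auto
      also have "\<dots> \<le> 2 * (edist n (?t ?x) g)\<^sup>2 + 2 * r\<^sup>2"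
        using zero_le_power2[of "edist n (?t ?x) g - r"] unfolding power2_diff power2_sum by linarith
      finally have "ennreal ((edist n (?t ?x) \<mu>)\<^sup>2) \<le> ennreal (2 * (edist n (?t ?x) g)\<^sup>2 + 2 * r\<^sup>2)"
        by (rule ennreal_leI)
      also have "\<dots> = 2 * ennreal ((edist n (?t ?x) g)\<^sup>2) + ennreal (2 * r\<^sup>2)"
        using ennreal_mult[of 2 "(edist n (?t ?x) g)\<^sup>2"] by simp
      also have "\<dots> \<le> 2 * (ennreal (16 * r\<^sup>2) + (\<Sum>j. ennreal (4 ^ (j + 3) * r\<^sup>2) * I j \<xi>)) + ennreal (2 * r\<^sup>2)"
        unfolding I_def by (intro add_right_mono mult_left_mono tournament_loss_le Gc g r) auto
      also have "\<dots> = (ennreal (32 * r\<^sup>2) + ennreal (2 * r\<^sup>2)) + 2 * (\<Sum>j. ennreal (4 ^ (j + 3) * r\<^sup>2) * I j \<xi>)"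
      proof -
        have "2 * ennreal (16 * r\<^sup>2) = ennreal (32 * r\<^sup>2)"
          using ennreal_mult[of 2 "16 * r\<^sup>2"] by simp
        then show ?thesis by (simp only: distrib_left add_ac)
      qed
      also have "ennreal (32 * r\<^sup>2) + ennreal (2 * r\<^sup>2) = ennreal (34 * r\<^sup>2)"
        by (subst ennreal_plus[symmetric]) auto
      finally show "ennreal ((edist n (?t ?x) \<mu>)\<^sup>2)
        \<le> ennreal (34 * r\<^sup>2) + 2 * (\<Sum>j. ennreal (4 ^ (j + 3) * r\<^sup>2) * I j \<xi>)" .
    qed
    also have "\<dots> = ennreal (34 * r\<^sup>2) + 2 * (\<Sum>j. ennreal (4 ^ (j + 3) * r\<^sup>2) * (\<integral>\<^sup>+\<xi>. I j \<xi> \<partial>?P))"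
      by (simp add: nn_integral_add nn_integral_cmult nn_integral_suminf P.emeasure_space_1)
    also have "\<dots> \<le> ennreal (34 * r\<^sup>2) + 2 * (\<Sum>j. ennreal (4 ^ (j + 3) * r\<^sup>2) * ennreal (1 / 16 ^ (j + 2)))"
      by (intro add_left_mono mult_left_mono suminf_le Ib) auto
    also have "(\<Sum>j. ennreal (4 ^ (j + 3) * r\<^sup>2) * ennreal (1 / 16 ^ (j + 2)))
       = (\<Sum>j. ennreal (r\<^sup>2 / 4 * (1 / 4) ^ j))"
    proof (rule suminf_cong)
      fix j
      have "(16::real) ^ j = 4 ^ j * 4 ^ j" by (simp flip: power_mult_distrib)
      then have "4 ^ (j + 3) * r\<^sup>2 * (1 / 16 ^ (j + 2)) = r\<^sup>2 / 4 * (1 / 4) ^ j"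
        by (simp add: power_add power_divide)
      then show "ennreal (4 ^ (j + 3) * r\<^sup>2) * ennreal (1 / 16 ^ (j + 2)) = ennreal (r\<^sup>2 / 4 * (1 / 4) ^ j)"
        by (subst ennreal_mult[symmetric]) auto
    qed
    also have "\<dots> = ennreal (\<Sum>j. r\<^sup>2 / 4 * (1 / 4) ^ j)"
      by (intro suminf_ennreal2 summable_mult summable_geometric) auto
    also have "(\<Sum>j. r\<^sup>2 / 4 * (1 / 4) ^ j) = r\<^sup>2 / 3"
      by (subst suminf_mult) (auto simp: suminf_geometric summable_geometric)
    also have "ennreal (34 * r\<^sup>2) + 2 * ennreal (r\<^sup>2 / 3) = ennreal (34 * r\<^sup>2 + 2 * (r\<^sup>2 / 3))"
      using ennreal_mult[of 2 "r\<^sup>2 / 3"] ennreal_plus[of "34 * r\<^sup>2" "2 * (r\<^sup>2 / 3)"] by simp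
    also have "\<dots> \<le> ennreal (46 * r\<^sup>2)" by (rule ennreal_leI) (use r in simp)
    finally show ?thesis .
  qed
  have "minimax_risk n N \<sigma> \<epsilon> K \<le> (SUP \<mu>\<in>K. SUP D\<in>noise_dists n (\<sigma>\<^sup>2). SUP C\<in>adversaries n N \<epsilon>. risk n N ?t \<mu> D C)"
    unfolding minimax_risk_def by (rule INF_lower[OF tournament_measurable[OF Gc Gne GR]])
  also have "\<dots> \<le> ennreal (46 * r\<^sup>2)" by (intro SUP_least risk)
  finally show ?thesis .
qed

section \<open>Lower bounds\<close>

lemma PiM_density:
  fixes M :: "'i \<Rightarrow> 'a measure"
  assumes I: "finite I" and M: "\<And>i. prob_space (M i)"
    and f [measurable]: "\<And>i. i \<in> I \<Longrightarrow> f i \<in> borel_measurable (M i)"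
    and D: "\<And>i. i \<in> I \<Longrightarrow> prob_space (density (M i) (f i))"
  shows "PiM I (\<lambda>i. density (M i) (f i)) = density (PiM I M) (\<lambda>x. \<Prod>i\<in>I. f i (x i))"
proof -
  \<comment> \<open>Sigma-finiteness of a product family is required at every index, while the
    densities are known to be probabilities only on \<open>I\<close>; elsewhere the family is
    patched.\<close>
  define D' where "D' i = (if i \<in> I then density (M i) (f i) else M i)" for i
  have prob: "prob_space (D' i)" for i using M D by (simp add: D'_def)
  interpret D': product_sigma_finite D'
    using prob by (simp add: prob_space_imp_sigma_finite product_sigma_finite_def)
  interpret M: product_sigma_finite M
    using M by (simp add: prob_space_imp_sigma_finite product_sigma_finite_def)
  have "density (PiM I M) (\<lambda>x. \<Prod>i\<in>I. f i (x i)) = PiM I D'"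
  proof (rule D'.PiM_eqI[OF I])
    have "sets (PiM I D') = sets (PiM I M)" by (intro sets_PiM_cong) (auto simp: D'_def)
    then show "sets (density (PiM I M) (\<lambda>x. \<Prod>i\<in>I. f i (x i))) = sets (PiM I D')" by simp
    fix A assume A: "\<And>i. i \<in> I \<Longrightarrow> A i \<in> sets (D' i)"
    then have A' [measurable]: "\<And>i. i \<in> I \<Longrightarrow> A i \<in> sets (M i)" by (force simp: D'_def)
    have P: "Pi\<^sub>E I A \<in> sets (PiM I M)" using I A' by (rule sets_PiM_I_finite)
    have m: "(\<lambda>x. \<Prod>i\<in>I. f i (x i)) \<in> borel_measurable (PiM I M)" by measurable
    have "emeasure (density (PiM I M) (\<lambda>x. \<Prod>i\<in>I. f i (x i))) (Pi\<^sub>E I A)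
      = (\<integral>\<^sup>+x. (\<Prod>i\<in>I. f i (x i)) * indicator (Pi\<^sub>E I A) x \<partial>PiM I M)"
      by (rule emeasure_density[OF m P])
    also have "\<dots> = (\<integral>\<^sup>+x. (\<Prod>i\<in>I. f i (x i) * indicator (A i) (x i)) \<partial>PiM I M)"
    proof (rule nn_integral_cong)
      fix x assume x: "x \<in> space (PiM I M)"
      have "indicator (Pi\<^sub>E I A) x = (\<Prod>i\<in>I. indicator (A i) (x i) :: ennreal)"
      proof (cases "x \<in> Pi\<^sub>E I A")
        case False
        then obtain i where "i \<in> I" "x i \<notin> A i" using x by (auto simp: space_PiM PiE_iff)
        then show ?thesis using False I by (simp add: prod_zero_iff) (metis indicator_simps(2))
      qed (auto simp: PiE_iff)
      then show "(\<Prod>i\<in>I. f i (x i)) * indicator (Pi\<^sub>E I A) x = (\<Prod>i\<in>I. f i (x i) * indicator (A i) (x i))"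
        by (simp add: prod.distrib)
    qed
    also have "\<dots> = (\<Prod>i\<in>I. \<integral>\<^sup>+x. f i x * indicator (A i) x \<partial>M i)"
      by (rule M.product_nn_integral_prod[OF I]) measurable
    also have "\<dots> = (\<Prod>i\<in>I. emeasure (D' i) (A i))"
      by (intro prod.cong) (auto simp: D'_def emeasure_density)
    finally show "emeasure (density (PiM I M) (\<lambda>x. \<Prod>i\<in>I. f i (x i))) (Pi\<^sub>E I A)
      = (\<Prod>i\<in>I. emeasure (D' i) (A i))" .
  qed
  moreover have "PiM I D' = PiM I (\<lambda>i. density (M i) (f i))"
    by (intro PiM_cong) (auto simp: D'_def)
  ultimately show ?thesis by simp
qed

lemma distr_PiM_pointwise:
  fixes M :: "'i \<Rightarrow> 'a measure" and M' :: "'i \<Rightarrow> 'b measure"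
  assumes I: "finite I" and M: "\<And>i. prob_space (M i)"
    and f [measurable]: "\<And>i. f i \<in> measurable (M i) (M' i)"
  shows "distr (PiM I M) (PiM I M') (\<lambda>x. \<lambda>i\<in>I. f i (x i)) = PiM I (\<lambda>i. distr (M i) (M' i) (f i))"
proof -
  have prob: "prob_space (distr (M i) (M' i) (f i))" for i
    using M f by (rule prob_space.prob_space_distr)
  interpret D': product_sigma_finite "\<lambda>i. distr (M i) (M' i) (f i)"
    using prob by (simp add: prob_space_imp_sigma_finite product_sigma_finite_def)
  interpret M: product_sigma_finite M
    using M by (simp add: prob_space_imp_sigma_finite product_sigma_finite_def)
  show ?thesis
  proof (rule D'.PiM_eqI[OF I])
    show "sets (distr (PiM I M) (PiM I M') (\<lambda>x. \<lambda>i\<in>I. f i (x i)))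
      = sets (PiM I (\<lambda>i. distr (M i) (M' i) (f i)))"
      by (simp cong: sets_PiM_cong)
    fix A assume "\<And>i. i \<in> I \<Longrightarrow> A i \<in> sets (distr (M i) (M' i) (f i))"
    then have A [measurable]: "\<And>i. i \<in> I \<Longrightarrow> A i \<in> sets (M' i)" by simp
    have P: "Pi\<^sub>E I A \<in> sets (PiM I M')" using I A by (rule sets_PiM_I_finite)
    have m: "(\<lambda>x. \<lambda>i\<in>I. f i (x i)) \<in> measurable (PiM I M) (PiM I M')" by measurable
    have "emeasure (distr (PiM I M) (PiM I M') (\<lambda>x. \<lambda>i\<in>I. f i (x i))) (Pi\<^sub>E I A)
      = emeasure (PiM I M) ((\<lambda>x. \<lambda>i\<in>I. f i (x i)) -` Pi\<^sub>E I A \<inter> space (PiM I M))"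
      by (rule emeasure_distr[OF m P])
    also have "(\<lambda>x. \<lambda>i\<in>I. f i (x i)) -` Pi\<^sub>E I A \<inter> space (PiM I M)
      = Pi\<^sub>E I (\<lambda>i. f i -` A i \<inter> space (M i))"
      by (auto simp: space_PiM PiE_iff)
    also have "emeasure (PiM I M) \<dots> = (\<Prod>i\<in>I. emeasure (M i) (f i -` A i \<inter> space (M i)))"
      by (intro M.emeasure_PiM I) measurable
    also have "\<dots> = (\<Prod>i\<in>I. emeasure (distr (M i) (M' i) (f i)) (A i))"
      by (intro prod.cong) (auto simp: emeasure_distr)
    finally show "emeasure (distr (PiM I M) (PiM I M') (\<lambda>x. \<lambda>i\<in>I. f i (x i))) (Pi\<^sub>E I A)
      = (\<Prod>i\<in>I. emeasure (distr (M i) (M' i) (f i)) (A i))" .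
  qed
qed

text \<open>Independent centred coordinates have a diagonal covariance matrix, so the matrix
  inequality reduces to the individual variances.\<close>

lemma product_measure_in_noise_dists:
  fixes M :: "nat \<Rightarrow> real measure"
  assumes prob: "\<And>i. prob_space (M i)" and sets: "\<And>i. sets (M i) = sets borel"
    and int: "\<And>i. i < n \<Longrightarrow> integrable (M i) (\<lambda>x. x)" "\<And>i. i < n \<Longrightarrow> (\<integral>x. x \<partial>M i) = 0"
    and int2: "\<And>i. i < n \<Longrightarrow> integrable (M i) (\<lambda>x. x\<^sup>2)" "\<And>i. i < n \<Longrightarrow> (\<integral>x. x\<^sup>2 \<partial>M i) \<le> s2"
  shows "PiM {..<n} M \<in> noise_dists n s2"
proof -
  let ?P = "PiM {..<n} M"
  interpret M: product_sigma_finite M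
    using prob by (simp add: prob_space_imp_sigma_finite product_sigma_finite_def)
  have M1: "measure (M i) (space (M i)) = 1" for i using prob by (simp add: prob_space.prob_space)
  have comp: "(\<lambda>\<omega>. \<omega> i) \<in> measurable ?P (M i)" if "i < n" for i
    using that by (intro measurable_component_singleton) auto
  have transfer: "integrable ?P (\<lambda>x. f (x i)) \<longleftrightarrow> integrable (M i) f"
      "(\<integral>x. f (x i) \<partial>?P) = (\<integral>x. f x \<partial>M i)"
    if "i < n" "f \<in> borel_measurable borel" for i and f :: "real \<Rightarrow> real"
  proof -
    have f: "f \<in> borel_measurable (M i)" using that(2) measurable_cong_sets[OF sets refl] by blast
    have eq: "distr ?P (M i) (\<lambda>\<omega>. \<omega> i) = M i"
      using that(1) prob by (intro distr_PiM_component) auto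
    show "integrable ?P (\<lambda>x. f (x i)) \<longleftrightarrow> integrable (M i) f"
      using integrable_distr_eq[OF comp[OF that(1)] f] unfolding eq by simp
    show "(\<integral>x. f (x i) \<partial>?P) = (\<integral>x. f x \<partial>M i)"
      using integral_distr[OF comp[OF that(1)] f] unfolding eq by simp
  qed
  have cov: "(\<integral>x. x i * x j \<partial>?P) = 0" if ij: "i < n" "j < n" "i \<noteq> j" for i j
  proof -
    define f :: "nat \<Rightarrow> real \<Rightarrow> real" where "f k = (if k = i \<or> k = j then (\<lambda>x. x) else (\<lambda>x. 1))" for k
    have fi: "integrable (M k) (f k)" if "k < n" for k
      using int(1)[OF that] prob[of k] unfolding f_def by (auto intro: finite_measure.integrable_const simp: prob_space_def)
    have "(\<integral>x. (\<Prod>k<n. f k (x k)) \<partial>?P) = (\<Prod>k<n. \<integral>x. f k x \<partial>M k)"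
      by (rule M.product_integral_prod) (auto intro: fi)
    moreover have "(\<Prod>k<n. \<integral>x. f k x \<partial>M k) = 0"
      by (rule prod_zero) (use ij int(2)[OF ij(1)] in \<open>auto simp: f_def intro!: bexI[of _ i]\<close>)
    moreover have "(\<Prod>k<n. f k (x k)) = x i * x j" for x
    proof -
      have "(\<Prod>k<n. f k (x k)) = (\<Prod>k\<in>{i, j}. f k (x k))"
        by (rule prod.mono_neutral_right) (use ij in \<open>auto simp: f_def\<close>)
      then show ?thesis using ij by (simp add: f_def)
    qed
    ultimately show ?thesis by simp
  qed
  have "(\<Sum>i<n. \<Sum>j<n. v i * v j * (\<integral>x. x i * x j \<partial>?P)) \<le> s2 * (\<Sum>i<n. (v i)\<^sup>2)" for v
  proof -
    have "(\<Sum>i<n. \<Sum>j<n. v i * v j * (\<integral>x. x i * x j \<partial>?P)) = (\<Sum>i<n. (v i)\<^sup>2 * (\<integral>x. (x i)\<^sup>2 \<partial>?P))"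
    proof (rule sum.cong)
      fix i assume i: "i \<in> {..<n}"
      have "(\<Sum>j<n. v i * v j * (\<integral>x. x i * x j \<partial>?P)) = (\<Sum>j\<in>{i}. v i * v j * (\<integral>x. x i * x j \<partial>?P))"
        by (rule sum.mono_neutral_right) (use i cov in auto)
      then show "(\<Sum>j<n. v i * v j * (\<integral>x. x i * x j \<partial>?P)) = (v i)\<^sup>2 * (\<integral>x. (x i)\<^sup>2 \<partial>?P)"
        by (simp add: power2_eq_square)
    qed simp
    also have "\<dots> \<le> (\<Sum>i<n. (v i)\<^sup>2 * s2)"
      by (intro sum_mono mult_left_mono) (auto simp: transfer(2)[where f = "\<lambda>x. x\<^sup>2"] int2)
    also have "\<dots> = s2 * (\<Sum>i<n. (v i)\<^sup>2)" by (simp add: sum_distrib_left mult.commute)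
    finally show ?thesis .
  qed
  moreover have "prob_space ?P" by (rule prob_space_PiM) (rule prob)
  moreover have "sets ?P = sets (RnM n)" unfolding RnM_def by (intro sets_PiM_cong) (auto simp: sets)
  ultimately show ?thesis
    unfolding noise_dists_def
    by (auto simp: transfer[where f = "\<lambda>x. x"] transfer[where f = "\<lambda>x. x\<^sup>2"] int int2)
qed

section \<open>Two-point laws and their tilts\<close>

definition two_point :: "real \<Rightarrow> real \<Rightarrow> real \<Rightarrow> real measure" where
  "two_point \<sigma> a t = distr (bernoulli_pmf ((1 + t / \<sigma>) / 2)) borel (\<lambda>b. a + (if b then \<sigma> else - \<sigma>))"

lemma two_point_prob_space: "prob_space (two_point \<sigma> a t)"
  unfolding two_point_def by (rule prob_space.prob_space_distr) (auto intro: prob_space_measure_pmf)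

lemma sets_two_point [simp]: "sets (two_point \<sigma> a t) = sets borel"
  by (simp add: two_point_def)

lemma two_point_weight:
  fixes t :: real
  assumes "\<sigma> > 0" "\<bar>t\<bar> \<le> \<sigma>"
  shows "0 \<le> (1 + t / \<sigma>) / 2" "(1 + t / \<sigma>) / 2 \<le> 1"
  using assms by (auto simp: field_simps)

lemma nn_integral_two_point:
  assumes "\<sigma> > 0" "\<bar>t\<bar> \<le> \<sigma>" "f \<in> borel_measurable borel"
  shows "(\<integral>\<^sup>+y. f y \<partial>two_point \<sigma> a t)
    = f (a + \<sigma>) * ennreal ((1 + t / \<sigma>) / 2) + f (a - \<sigma>) * ennreal ((1 - t / \<sigma>) / 2)"
proof -
  have "(\<integral>\<^sup>+y. f y \<partial>two_point \<sigma> a t)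
    = (\<integral>\<^sup>+b. f (a + (if b then \<sigma> else - \<sigma>)) \<partial>bernoulli_pmf ((1 + t / \<sigma>) / 2))"
    unfolding two_point_def using assms(3) by (intro nn_integral_distr) auto
  also have "\<dots> = f (a + \<sigma>) * ennreal ((1 + t / \<sigma>) / 2) + f (a - \<sigma>) * ennreal (1 - (1 + t / \<sigma>) / 2)"
    using two_point_weight[OF assms(1,2)] by (subst nn_integral_bernoulli_pmf) auto
  also have "1 - (1 + t / \<sigma>) / 2 = (1 - t / \<sigma>) / 2" by (simp add: field_simps)
  finally show ?thesis .
qed

text \<open>The atoms do not move with \<open>t\<close>, only their weights do, and the mean is a +
  t. The likelihood ratio against t = 0 is therefore affine, with values 1 + t/\<sigma> and 1 -
  t/\<sigma> at the two atoms.\<close>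

lemma two_point_eq_density:
  assumes "\<sigma> > 0" "\<bar>t\<bar> \<le> \<sigma>"
  shows "two_point \<sigma> a t = density (two_point \<sigma> a 0) (\<lambda>y. ennreal (1 + t * (y - a) / \<sigma>\<^sup>2))"
proof (rule measure_eqI)
  fix A assume "A \<in> sets (two_point \<sigma> a t)"
  then have A [measurable]: "A \<in> sets borel" by simp
  have t: "0 \<le> 1 + t / \<sigma>" "0 \<le> 1 - t / \<sigma>" using assms by (auto simp: field_simps)
  have w: "t * \<sigma> / \<sigma>\<^sup>2 = t / \<sigma>" using assms by (simp add: power2_eq_square)
  have half: "ennreal x * i * ennreal ((1 + 0 / \<sigma>) / 2) = i * ennreal (x / 2)"
    "ennreal x * i * ennreal ((1 - 0 / \<sigma>) / 2) = i * ennreal (x / 2)" if "0 \<le> x" for x and i :: ennreal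
  proof -
    have "ennreal (x / 2) = ennreal x * ennreal (1 / 2)"
      using that by (subst ennreal_mult[symmetric]) auto
    then show "ennreal x * i * ennreal ((1 + 0 / \<sigma>) / 2) = i * ennreal (x / 2)"
      "ennreal x * i * ennreal ((1 - 0 / \<sigma>) / 2) = i * ennreal (x / 2)"
      by (simp_all only: div_0 add_0_right diff_0_right mult_ac)
  qed
  have pm: "1 + t * (a + \<sigma> - a) / \<sigma>\<^sup>2 = 1 + t / \<sigma>" "1 + t * (a - \<sigma> - a) / \<sigma>\<^sup>2 = 1 - t / \<sigma>"
    using w by simp_all
  have "emeasure (two_point \<sigma> a t) A = (\<integral>\<^sup>+y. indicator A y \<partial>two_point \<sigma> a t)" by simp
  also have "\<dots> = indicator A (a + \<sigma>) * ennreal ((1 + t / \<sigma>) / 2) + indicator A (a - \<sigma>) * ennreal ((1 - t / \<sigma>) / 2)"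
    by (rule nn_integral_two_point[OF assms]) measurable
  also have "\<dots> = (\<integral>\<^sup>+y. ennreal (1 + t * (y - a) / \<sigma>\<^sup>2) * indicator A y \<partial>two_point \<sigma> a 0)"
  proof (subst nn_integral_two_point)
    show "(\<lambda>y. ennreal (1 + t * (y - a) / \<sigma>\<^sup>2) * indicator A y) \<in> borel_measurable borel" by measurable
  qed (use assms t in \<open>simp_all only: pm half abs_zero less_imp_le\<close>)
  also have "\<dots> = emeasure (density (two_point \<sigma> a 0) (\<lambda>y. ennreal (1 + t * (y - a) / \<sigma>\<^sup>2))) A"
    by (subst emeasure_density) (auto simp: measurable_cong_sets[OF sets_two_point refl])
  finally show "emeasure (two_point \<sigma> a t) A = \<dots>" .
qed simp

text \<open>The exact value 1 + t^2/\<sigma>^2 is one plus the chi-square divergence. The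
  exponential form is preferred because exponents add up over coordinates and samples.\<close>

lemma two_point_likelihood_square:
  assumes "\<sigma> > 0" "\<bar>t\<bar> \<le> \<sigma>"
  shows "(\<integral>\<^sup>+y. (ennreal (1 + t * (y - a) / \<sigma>\<^sup>2))\<^sup>2 \<partial>two_point \<sigma> a 0) \<le> ennreal (exp (t\<^sup>2 / \<sigma>\<^sup>2))"
proof -
  have t: "0 \<le> 1 + t / \<sigma>" "0 \<le> 1 - t / \<sigma>" using assms by (auto simp: field_simps)
  have w: "t * \<sigma> / \<sigma>\<^sup>2 = t / \<sigma>" using assms by (simp add: power2_eq_square)
  have "(\<integral>\<^sup>+y. (ennreal (1 + t * (y - a) / \<sigma>\<^sup>2))\<^sup>2 \<partial>two_point \<sigma> a 0)
    = (ennreal (1 + t / \<sigma>))\<^sup>2 * ennreal (1/2) + (ennreal (1 - t / \<sigma>))\<^sup>2 * ennreal (1/2)"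
    using assms w by (subst nn_integral_two_point) auto
  also have "\<dots> = ennreal ((1 + t / \<sigma>)\<^sup>2 * (1/2) + (1 - t / \<sigma>)\<^sup>2 * (1/2))"
  proof -
    have "ennreal (u\<^sup>2 * (1/2)) = (ennreal u)\<^sup>2 * ennreal (1/2)" if "0 \<le> u" for u
      using that by (subst ennreal_mult) (auto simp: ennreal_power)
    then show ?thesis using t by (subst ennreal_plus) auto
  qed
  also have "(1 + t / \<sigma>)\<^sup>2 * (1/2) + (1 - t / \<sigma>)\<^sup>2 * (1/2) = 1 + t\<^sup>2 / \<sigma>\<^sup>2"
  proof -
    have "(1 + u)\<^sup>2 * (1/2) + (1 - u)\<^sup>2 * (1/2) = 1 + u\<^sup>2" for u :: real
      by (simp add: field_simps power2_eq_square)
    then show ?thesis by (simp add: power_divide)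
  qed
  also have "ennreal \<dots> \<le> ennreal (exp (t\<^sup>2 / \<sigma>\<^sup>2))" by (intro ennreal_leI exp_ge_add_one_self)
  finally show ?thesis .
qed

lemma integral_two_point:
  fixes f :: "real \<Rightarrow> real"
  assumes "\<sigma> > 0" "\<bar>t\<bar> \<le> \<sigma>" and f: "f \<in> borel_measurable borel"
  shows "integrable (two_point \<sigma> a t) f"
    "(\<integral>y. f y \<partial>two_point \<sigma> a t) = f (a + \<sigma>) * ((1 + t / \<sigma>) / 2) + f (a - \<sigma>) * ((1 - t / \<sigma>) / 2)"
proof -
  show "integrable (two_point \<sigma> a t) f"
    unfolding two_point_def using f by (subst integrable_distr_eq) (auto intro: integrable_measure_pmf_finite)
  have "(\<integral>y. f y \<partial>two_point \<sigma> a t)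
    = (\<integral>b. f (a + (if b then \<sigma> else - \<sigma>)) \<partial>bernoulli_pmf ((1 + t / \<sigma>) / 2))"
    unfolding two_point_def using f by (intro integral_distr) auto
  also have "\<dots> = f (a + \<sigma>) * ((1 + t / \<sigma>) / 2) + f (a - \<sigma>) * (1 - (1 + t / \<sigma>) / 2)"
    using two_point_weight[OF assms(1,2)] by (subst integral_bernoulli_pmf) auto
  also have "1 - (1 + t / \<sigma>) / 2 = (1 - t / \<sigma>) / 2" by (simp add: field_simps)
  finally show "(\<integral>y. f y \<partial>two_point \<sigma> a t) = f (a + \<sigma>) * ((1 + t / \<sigma>) / 2) + f (a - \<sigma>) * ((1 - t / \<sigma>) / 2)" .
qed

text \<open>Uniform noise on the vertices of a cube of side \<open>2 \<sigma>\<close>, tilted coordinatewise: the vertices stay fixed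
  at \<open>\<nu> \<plusminus> \<sigma>\<close> while the mean moves to \<open>\<nu> + \<theta>\<close>.\<close>

definition cube_law :: "nat \<Rightarrow> real \<Rightarrow> (nat \<Rightarrow> real) \<Rightarrow> (nat \<Rightarrow> real) \<Rightarrow> (nat \<Rightarrow> real) measure" where
  "cube_law n \<sigma> \<nu> \<theta> = PiM {..<n} (\<lambda>k. two_point \<sigma> (\<nu> k) (\<theta> k))"

text \<open>The centre -\<theta> compensates the tilt, and adding the mean \<nu> + \<theta> brings
  the vertices back around \<nu>. Tilting lowers the variance of coordinate k to \<sigma>^2 -
  \<theta>_k^2, so the covariance bound persists.\<close>

lemma cube_noise:
  assumes "\<sigma> > 0" "\<And>k. k < n \<Longrightarrow> \<bar>\<theta> k\<bar> \<le> \<sigma>"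
  shows "cube_law n \<sigma> (\<lambda>k. - \<theta> k) \<theta> \<in> noise_dists n (\<sigma>\<^sup>2)"
  unfolding cube_law_def
proof (rule product_measure_in_noise_dists)
  fix i assume i: "i < n"
  note I = integral_two_point[OF assms(1) assms(2)[OF i]]
  show "integrable (two_point \<sigma> (- \<theta> i) (\<theta> i)) (\<lambda>x. x)"
    "integrable (two_point \<sigma> (- \<theta> i) (\<theta> i)) power2" by (auto intro!: I)
  show "(\<integral>x. x \<partial>two_point \<sigma> (- \<theta> i) (\<theta> i)) = 0"
    using assms(1) by (subst I(2)) (auto simp: field_simps)
  have "(\<integral>x. x\<^sup>2 \<partial>two_point \<sigma> (- \<theta> i) (\<theta> i)) = \<sigma>\<^sup>2 - (\<theta> i)\<^sup>2"
    using assms(1) by (subst I(2)) (auto simp: field_simps power2_eq_square)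
  then show "(\<integral>x. x\<^sup>2 \<partial>two_point \<sigma> (- \<theta> i) (\<theta> i)) \<le> \<sigma>\<^sup>2" by simp
qed (auto intro: two_point_prob_space)

lemma prob_space_cube_law: "prob_space (cube_law n \<sigma> \<nu> \<theta>)"
  unfolding cube_law_def by (rule prob_space_PiM) (rule two_point_prob_space)

lemma sets_cube_law: "sets (cube_law n \<sigma> \<nu> \<theta>) = sets (RnM n)"
  unfolding cube_law_def RnM_def by (rule sets_PiM_cong) auto

lemma distr_two_point_shift: "distr (two_point \<sigma> a t) borel (\<lambda>y. b + y) = two_point \<sigma> (b + a) t"
  unfolding two_point_def by (subst distr_distr) (auto simp: comp_def add_ac)

lemma distr_cube_law_shift:
  assumes "\<And>k. k < n \<Longrightarrow> \<nu> k = \<mu> k + a k"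
  shows "distr (cube_law n \<sigma> a \<theta>) (RnM n) (vadd n \<mu>) = cube_law n \<sigma> \<nu> \<theta>"
proof -
  have "distr (PiM {..<n} (\<lambda>k. two_point \<sigma> (a k) (\<theta> k))) (PiM {..<n} (\<lambda>_. borel)) (\<lambda>x. \<lambda>k\<in>{..<n}. \<mu> k + x k)
    = PiM {..<n} (\<lambda>k. distr (two_point \<sigma> (a k) (\<theta> k)) borel (\<lambda>y. \<mu> k + y))"
    by (rule distr_PiM_pointwise)
      (auto intro: two_point_prob_space simp: measurable_cong_sets[OF sets_two_point refl])
  also have "\<dots> = cube_law n \<sigma> \<nu> \<theta>"
    unfolding cube_law_def using assms by (intro PiM_cong) (auto simp: distr_two_point_shift)
  finally show ?thesis by (simp add: cube_law_def RnM_def vadd_def[abs_def])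
qed

lemma distr_shift_sample_cube:
  assumes "\<And>k. k < n \<Longrightarrow> \<nu> k = \<mu> k + a k"
  shows "distr (PiM {..<N} (\<lambda>_. cube_law n \<sigma> a \<theta>)) (SampM n N) (shift_sample n N \<mu>)
    = PiM {..<N} (\<lambda>_. cube_law n \<sigma> \<nu> \<theta>)"
proof -
  have "vadd n \<mu> \<in> measurable (cube_law n \<sigma> a \<theta>) (RnM n)"
    unfolding measurable_cong_sets[OF sets_cube_law refl] RnM_def vadd_def[abs_def]
    by (intro measurable_restrict borel_measurable_add measurable_component_singleton) auto
  then have "distr (PiM {..<N} (\<lambda>_. cube_law n \<sigma> a \<theta>)) (PiM {..<N} (\<lambda>_. RnM n)) (\<lambda>x. \<lambda>i\<in>{..<N}. vadd n \<mu> (x i))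
    = PiM {..<N} (\<lambda>_. distr (cube_law n \<sigma> a \<theta>) (RnM n) (vadd n \<mu>))"
    by (intro distr_PiM_pointwise) (auto intro: prob_space_cube_law)
  then show ?thesis
    by (simp add: distr_cube_law_shift[OF assms] SampM_def shift_sample_def[abs_def])
qed

lemma sq_AM_GM_ennreal:
  fixes x :: ennreal and i :: ennreal and s :: real
  assumes "s > 0" "i = 0 \<or> i = 1"
  shows "x * i \<le> ennreal (s / 2) * x\<^sup>2 + ennreal (1 / (2 * s)) * i"
proof (cases "i = 0")
  case False
  then have i: "i = 1" using assms by blast
  show ?thesis
  proof (cases x)
    case (real r)
    have "r \<le> s / 2 * r\<^sup>2 + 1 / (2 * s)"
    proof -
      have "0 \<le> (s * r - 1)\<^sup>2 / (2 * s)" using assms by simp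
      also have "\<dots> = s / 2 * r\<^sup>2 + 1 / (2 * s) - r"
        using assms by (simp add: power2_diff field_simps power2_eq_square)
      finally show ?thesis by simp
    qed
    then have "ennreal r \<le> ennreal (s / 2 * r\<^sup>2 + 1 / (2 * s))" by (rule ennreal_leI)
    also have "\<dots> = ennreal (s / 2) * (ennreal r)\<^sup>2 + ennreal (1 / (2 * s))"
      using assms real ennreal_mult[of "s / 2" "r\<^sup>2"] ennreal_plus[of "s / 2 * r\<^sup>2" "1 / (2 * s)"]
      by (simp add: ennreal_power)
    finally show ?thesis using real i by simp
  next
    case top
    then show ?thesis using assms i by (simp add: ennreal_mult_top power2_eq_square)
  qed
qed simp

text \<open>The likelihood ratio \<open>L\<close> enters through \<open>L \<le> s L\<^sup>2 / 2 + 1 / (2 s)\<close> on \<open>A\<close>; the free parameter \<open>s\<close>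
  replaces an appeal to the Cauchy-Schwarz inequality.\<close>

lemma cube_sample_change_of_measure:
  assumes \<sigma>: "\<sigma> > 0" and \<theta>: "\<And>k. k < n \<Longrightarrow> \<bar>\<theta> k\<bar> \<le> \<sigma>" and s: "s > 0"
    and A: "A \<in> sets (SampM n N)"
  shows "emeasure (PiM {..<N} (\<lambda>_. cube_law n \<sigma> \<nu> \<theta>)) A
    \<le> ennreal (s / 2 * exp (real N * (\<Sum>k<n. (\<theta> k)\<^sup>2) / \<sigma>\<^sup>2))
      + ennreal (1 / (2 * s)) * emeasure (PiM {..<N} (\<lambda>_. cube_law n \<sigma> \<nu> (\<lambda>_. 0))) A"
proof -
  define w where "w k y = ennreal (1 + \<theta> k * (y - \<nu> k) / \<sigma>\<^sup>2)" for k y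
  define W where "W x = (\<Prod>k<n. w k (x k))" for x
  let ?R = "cube_law n \<sigma> \<nu> (\<lambda>_. 0)"
  let ?Q = "PiM {..<N} (\<lambda>_. ?R)"
  have wm: "w k \<in> borel_measurable (two_point \<sigma> a t)" for k a t
    unfolding w_def measurable_cong_sets[OF sets_two_point refl] by measurable
  note [measurable] = wm
  have Wm: "W \<in> borel_measurable ?R"
    unfolding W_def cube_law_def by measurable
  note [measurable] = Wm
  have dens: "cube_law n \<sigma> \<nu> \<theta> = density ?R W"
  proof -
    have "cube_law n \<sigma> \<nu> \<theta> = PiM {..<n} (\<lambda>k. density (two_point \<sigma> (\<nu> k) 0) (w k))"
      unfolding cube_law_def w_def using two_point_eq_density[OF \<sigma> \<theta>] by (intro PiM_cong) auto
    also have "\<dots> = density (PiM {..<n} (\<lambda>k. two_point \<sigma> (\<nu> k) 0)) (\<lambda>x. \<Prod>k<n. w k (x k))"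
    proof (rule PiM_density)
      fix k assume "k \<in> {..<n}"
      then have "density (two_point \<sigma> (\<nu> k) 0) (w k) = two_point \<sigma> (\<nu> k) (\<theta> k)"
        unfolding w_def using two_point_eq_density[OF \<sigma> \<theta>] by simp
      then show "prob_space (density (two_point \<sigma> (\<nu> k) 0) (w k))"
        using two_point_prob_space by metis
    qed (auto intro: two_point_prob_space wm)
    finally show ?thesis by (simp add: cube_law_def W_def[abs_def])
  qed
  have densN: "PiM {..<N} (\<lambda>_. cube_law n \<sigma> \<nu> \<theta>) = density ?Q (\<lambda>x. \<Prod>i<N. W (x i))"
    unfolding dens
    by (rule PiM_density) (auto intro: prob_space_cube_law Wm simp flip: dens)
  have A' [measurable]: "A \<in> sets ?Q"
    using A unfolding SampM_def by (simp add: sets_cube_law cong: sets_PiM_cong)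
  interpret R: prob_space ?R by (rule prob_space_cube_law)
  interpret PR: product_sigma_finite "\<lambda>_::nat. ?R" by standard
  interpret PT: product_sigma_finite "\<lambda>k. two_point \<sigma> (\<nu> k) 0"
    using two_point_prob_space by (simp add: prob_space_imp_sigma_finite product_sigma_finite_def)
  \<comment> \<open>Second moments tensorise, here over coordinates and next over samples; only the
    squared Euclidean length of \<theta> enters.\<close>
  have W2: "(\<integral>\<^sup>+x. (W x)\<^sup>2 \<partial>?R) \<le> ennreal (exp ((\<Sum>k<n. (\<theta> k)\<^sup>2) / \<sigma>\<^sup>2))"
  proof -
    have "(\<integral>\<^sup>+x. (W x)\<^sup>2 \<partial>?R) = (\<integral>\<^sup>+x. (\<Prod>k<n. (w k (x k))\<^sup>2) \<partial>PiM {..<n} (\<lambda>k. two_point \<sigma> (\<nu> k) 0))"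
      by (simp add: W_def cube_law_def prod_power_distrib)
    also have "\<dots> = (\<Prod>k<n. \<integral>\<^sup>+y. (w k y)\<^sup>2 \<partial>two_point \<sigma> (\<nu> k) 0)"
      by (rule PT.product_nn_integral_prod) (auto intro!: borel_measurable_power_ennreal wm)
    also have "\<dots> \<le> (\<Prod>k<n. ennreal (exp ((\<theta> k)\<^sup>2 / \<sigma>\<^sup>2)))"
      unfolding w_def by (rule prod_mono_ennreal) (auto intro: two_point_likelihood_square[OF \<sigma>] \<theta>)
    also have "\<dots> = ennreal (exp ((\<Sum>k<n. (\<theta> k)\<^sup>2) / \<sigma>\<^sup>2))"
      by (simp add: prod_ennreal exp_sum[symmetric] sum_divide_distrib)
    finally show ?thesis .
  qed
  have L2: "(\<integral>\<^sup>+x. (\<Prod>i<N. W (x i))\<^sup>2 \<partial>?Q) \<le> ennreal (exp (real N * (\<Sum>k<n. (\<theta> k)\<^sup>2) / \<sigma>\<^sup>2))"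
  proof -
    have "(\<integral>\<^sup>+x. (\<Prod>i<N. W (x i))\<^sup>2 \<partial>?Q) = (\<integral>\<^sup>+x. (W x)\<^sup>2 \<partial>?R) ^ N"
      unfolding prod_power_distrib by (subst PR.product_nn_integral_prod) auto
    also have "\<dots> \<le> ennreal (exp ((\<Sum>k<n. (\<theta> k)\<^sup>2) / \<sigma>\<^sup>2)) ^ N" by (intro power_mono W2) simp
    also have "\<dots> = ennreal (exp (real N * (\<Sum>k<n. (\<theta> k)\<^sup>2) / \<sigma>\<^sup>2))"
      by (simp add: ennreal_power exp_of_nat_mult[symmetric])
    finally show ?thesis .
  qed
  have Lm: "(\<lambda>x. \<Prod>i<N. W (x i)) \<in> borel_measurable ?Q" by measurable
  note [measurable] = Lm
  have "emeasure (PiM {..<N} (\<lambda>_. cube_law n \<sigma> \<nu> \<theta>)) A = (\<integral>\<^sup>+x. (\<Prod>i<N. W (x i)) * indicator A x \<partial>?Q)"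
    unfolding densN by (rule emeasure_density[OF Lm A'])
  also have "\<dots> \<le> (\<integral>\<^sup>+x. ennreal (s / 2) * (\<Prod>i<N. W (x i))\<^sup>2 + ennreal (1 / (2 * s)) * indicator A x \<partial>?Q)"
    by (intro nn_integral_mono sq_AM_GM_ennreal s) (auto simp: indicator_def)
  also have "\<dots> = ennreal (s / 2) * (\<integral>\<^sup>+x. (\<Prod>i<N. W (x i))\<^sup>2 \<partial>?Q) + ennreal (1 / (2 * s)) * emeasure ?Q A"
    by (subst nn_integral_add) (auto simp: nn_integral_cmult)
  also have "\<dots> \<le> ennreal (s / 2) * ennreal (exp (real N * (\<Sum>k<n. (\<theta> k)\<^sup>2) / \<sigma>\<^sup>2)) + ennreal (1 / (2 * s)) * emeasure ?Q A"
    by (intro add_right_mono mult_left_mono L2) simp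
  also have "\<dots> = ennreal (s / 2 * exp (real N * (\<Sum>k<n. (\<theta> k)\<^sup>2) / \<sigma>\<^sup>2)) + ennreal (1 / (2 * s)) * emeasure ?Q A"
    using s by (subst ennreal_mult) auto
  finally show ?thesis .
qed

section \<open>Lower bound from a local packing\<close>

lemma minimax_risk_ge:
  assumes "\<And>est. est \<in> estimators n N \<Longrightarrow> \<exists>\<mu>\<in>K. \<exists>D\<in>noise_dists n (\<sigma>\<^sup>2). \<exists>C\<in>adversaries n N \<epsilon>.
    b \<le> risk n N est \<mu> D C"
  shows "b \<le> minimax_risk n N \<sigma> \<epsilon> K"
  unfolding minimax_risk_def
proof (rule INF_greatest)
  fix est assume "est \<in> estimators n N"
  then obtain \<mu> D C where "\<mu> \<in> K" "D \<in> noise_dists n (\<sigma>\<^sup>2)" "C \<in> adversaries n N \<epsilon>"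
    "b \<le> risk n N est \<mu> D C" using assms by blast
  then show "b \<le> (SUP \<mu>\<in>K. SUP D\<in>noise_dists n (\<sigma>\<^sup>2). SUP C\<in>adversaries n N \<epsilon>. risk n N est \<mu> D C)"
    by (meson SUP_upper2)
qed

lemma id_in_adversaries: "0 \<le> \<epsilon> \<Longrightarrow> (\<lambda>x. x) \<in> adversaries n N \<epsilon>"
  by (simp add: adversaries_def)

lemma edist_measurable: "(\<lambda>z. edist n z \<mu>) \<in> borel_measurable (RnM n)"
proof -
  have "(\<lambda>z. z i) \<in> borel_measurable (RnM n)" if "i < n" for i
    unfolding RnM_def using that by (intro measurable_component_singleton) auto
  then show ?thesis unfolding edist_def enorm_def
    by (intro measurable_compose[OF _ borel_measurable_sqrt] borel_measurable_sum
        borel_measurable_power borel_measurable_diff) auto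
qed

text \<open>The events of estimating within \<eta>/2 of a packing point are disjoint, so under the
  untilted law their probabilities sum to at most one. The change of measure then keeps them from
  all having probability above 1/2 under their own laws. At a point where this fails the loss is at
  least \<open>\<eta>\<^sup>2 / 4\<close> with probability at least 1/2, even if the adversary does
  nothing.\<close>

lemma minimax_risk_lower_packing:
  assumes \<sigma>: "\<sigma> > 0" and \<epsilon>: "0 \<le> \<epsilon>" and S: "finite S" "S \<subseteq> cballn n \<nu> \<delta> \<inter> K" "separated n \<eta> S"
    and m: "16 \<le> card S" and \<eta>: "\<eta> > 0" and \<delta>: "0 \<le> \<delta>" "\<delta> \<le> \<sigma>"
    and le: "real N * \<delta>\<^sup>2 / \<sigma>\<^sup>2 \<le> ln (real (card S)) / 4"
  shows "ennreal (\<eta>\<^sup>2 / 8) \<le> minimax_risk n N \<sigma> \<epsilon> K"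
proof (rule minimax_risk_ge)
  fix est assume est: "est \<in> estimators n N"
  then have em: "est \<in> measurable (SampM n N) (RnM n)" by (simp add: estimators_def)
  have dm: "(\<lambda>y. edist n (est y) \<mu>) \<in> borel_measurable (SampM n N)" for \<mu>
    by (rule measurable_compose[OF em edist_measurable])
  define A where "A \<mu> = {y \<in> space (SampM n N). edist n (est y) \<mu> < \<eta> / 2}" for \<mu>
  have A: "A \<mu> \<in> sets (SampM n N)" for \<mu>
    unfolding A_def using dm[of \<mu>] by measurable
  define P where "P \<theta> = PiM {..<N} (\<lambda>_. cube_law n \<sigma> \<nu> \<theta>)" for \<theta>
  have Pp: "prob_space (P \<theta>)" for \<theta> unfolding P_def by (rule prob_space_PiM) (rule prob_space_cube_law)
  have Ps: "sets (P \<theta>) = sets (SampM n N)" for \<theta>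
    unfolding P_def SampM_def by (intro sets_PiM_cong) (auto simp: sets_cube_law)
  define \<theta> where "\<theta> \<mu> k = \<mu> k - \<nu> k" for \<mu> k
  define Q where "Q = P (\<lambda>_. 0)"
  interpret Q: prob_space Q unfolding Q_def by (rule Pp)
  \<comment> \<open>For \<open>q\<close> the fourth root of \<open>card S\<close>, the entropy
    condition bounds the second moment of the likelihood ratio by \<open>q\<close>, and s = 1/q^2
    makes the first term 1/(2 q) \<le> 1/4. Summation would give q^4 \<le> 2 q^2, impossible for q
    \<ge> 2; hence the requirement of 16 points.\<close>
  define q where "q = real (card S) powr (1/4)"
  have q2: "2 \<le> q"
  proof -
    have "(2::real) = 16 powr (1/4)" using powr_powr[of 2 4 "1/4"] by simp
    also have "\<dots> \<le> q" unfolding q_def using m by (intro powr_mono2) auto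
    finally show ?thesis .
  qed
  have q4: "q ^ 4 = real (card S)"
    using m unfolding q_def by (subst powr_realpow[symmetric]) (auto simp: powr_powr)
  have "\<exists>\<mu>\<in>S. measure (P (\<theta> \<mu>)) (A \<mu>) \<le> 1/2"
  proof (rule ccontr)
    assume "\<not> ?thesis"
    then have big: "1/2 \<le> measure (P (\<theta> \<mu>)) (A \<mu>)" if "\<mu> \<in> S" for \<mu> using that by force
    have bound: "measure (P (\<theta> \<mu>)) (A \<mu>) \<le> 1/4 + q\<^sup>2 / 2 * measure Q (A \<mu>)" if \<mu>: "\<mu> \<in> S" for \<mu>
    proof -
      interpret P: prob_space "P (\<theta> \<mu>)" by (rule Pp)
      have d: "edist n \<mu> \<nu> \<le> \<delta>" using \<mu> S by (auto simp: cballn_def edist_commute)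
      have "\<bar>\<theta> \<mu> k\<bar> \<le> \<sigma>" if "k < n" for k
        using abs_component_le_edist[OF that, of \<mu> \<nu>] d \<delta> by (simp add: \<theta>_def)
      then have "emeasure (P (\<theta> \<mu>)) (A \<mu>) \<le> ennreal ((1 / q\<^sup>2) / 2 * exp (real N * (\<Sum>k<n. (\<theta> \<mu> k)\<^sup>2) / \<sigma>\<^sup>2))
        + ennreal (1 / (2 * (1 / q\<^sup>2))) * emeasure Q (A \<mu>)"
        unfolding P_def Q_def using q2 by (intro cube_sample_change_of_measure \<sigma> A) auto
      also have "\<dots> = ennreal ((1 / q\<^sup>2) / 2 * exp (real N * (\<Sum>k<n. (\<theta> \<mu> k)\<^sup>2) / \<sigma>\<^sup>2) + q\<^sup>2 / 2 * measure Q (A \<mu>))"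
      proof -
        have "ennreal (q\<^sup>2 / 2 * measure Q (A \<mu>)) = ennreal (1 / (2 * (1 / q\<^sup>2))) * emeasure Q (A \<mu>)"
          unfolding Q.emeasure_eq_measure by (subst ennreal_mult) auto
        then show ?thesis by (subst ennreal_plus) auto
      qed
      finally have "measure (P (\<theta> \<mu>)) (A \<mu>)
        \<le> (1 / q\<^sup>2) / 2 * exp (real N * (\<Sum>k<n. (\<theta> \<mu> k)\<^sup>2) / \<sigma>\<^sup>2) + q\<^sup>2 / 2 * measure Q (A \<mu>)"
        unfolding P.emeasure_eq_measure by (subst (asm) ennreal_le_iff) auto
      moreover have "exp (real N * (\<Sum>k<n. (\<theta> \<mu> k)\<^sup>2) / \<sigma>\<^sup>2) \<le> q"
      proof -
        have "(\<Sum>k<n. (\<theta> \<mu> k)\<^sup>2) \<le> \<delta>\<^sup>2"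
          using power_mono[OF d, of 2] by (simp add: edist_power2 \<theta>_def)
        then have "real N * (\<Sum>k<n. (\<theta> \<mu> k)\<^sup>2) / \<sigma>\<^sup>2 \<le> real N * \<delta>\<^sup>2 / \<sigma>\<^sup>2"
          by (intro divide_right_mono mult_left_mono) auto
        also have "\<dots> \<le> ln (real (card S)) / 4" by (rule le)
        finally show ?thesis using m by (simp add: q_def powr_def)
      qed
      then have "(1 / q\<^sup>2) / 2 * exp (real N * (\<Sum>k<n. (\<theta> \<mu> k)\<^sup>2) / \<sigma>\<^sup>2) \<le> (1 / q\<^sup>2) / 2 * q"
        by (intro mult_left_mono) auto
      moreover have "(1 / q\<^sup>2) / 2 * q \<le> 1/4"
        using q2 by (simp add: power2_eq_square)
      ultimately show ?thesis by linarith
    qed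
    have "(\<Sum>\<mu>\<in>S. measure Q (A \<mu>)) = measure Q (\<Union>\<mu>\<in>S. A \<mu>)"
    proof (rule Q.finite_measure_finite_Union[symmetric])
      show "A ` S \<subseteq> sets Q" using A by (auto simp: Q_def Ps)
      show "disjoint_family_on A S"
      unfolding disjoint_family_on_def
      proof (intro ballI impI, rule ccontr)
        fix \<mu> \<mu>' assume *: "\<mu> \<in> S" "\<mu>' \<in> S" "\<mu> \<noteq> \<mu>'" "A \<mu> \<inter> A \<mu>' \<noteq> {}"
        then obtain y where "edist n (est y) \<mu> < \<eta> / 2" "edist n (est y) \<mu>' < \<eta> / 2"
          unfolding A_def by blast
        then have "edist n \<mu> \<mu>' < \<eta>"
          using edist_triangle[of n \<mu> \<mu>' "est y"] by (simp add: edist_commute)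
        then show False using S(3) * unfolding separated_def by force
      qed
    qed (rule S(1))
    then have sumQ: "(\<Sum>\<mu>\<in>S. measure Q (A \<mu>)) \<le> 1" by simp
    have "real (card S) * (1/2) \<le> (\<Sum>\<mu>\<in>S. measure (P (\<theta> \<mu>)) (A \<mu>))"
      using sum_mono[of S "\<lambda>_. 1/2" "\<lambda>\<mu>. measure (P (\<theta> \<mu>)) (A \<mu>)"] big by simp
    also have "\<dots> \<le> (\<Sum>\<mu>\<in>S. 1/4 + q\<^sup>2 / 2 * measure Q (A \<mu>))" by (intro sum_mono bound)
    also have "\<dots> = real (card S) * (1/4) + q\<^sup>2 / 2 * (\<Sum>\<mu>\<in>S. measure Q (A \<mu>))"
      by (simp add: sum.distrib sum_distrib_left)
    also have "\<dots> \<le> real (card S) * (1/4) + q\<^sup>2 / 2 * 1"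
      using sumQ by (intro add_left_mono mult_left_mono) auto
    finally have "real (card S) \<le> 2 * q\<^sup>2" by simp
    moreover have "4 * q\<^sup>2 \<le> q\<^sup>2 * q\<^sup>2"
      using power_mono[OF q2, of 2] by (intro mult_right_mono) auto
    moreover have "q\<^sup>2 * q\<^sup>2 = real (card S)" using q4 by (simp flip: power_add)
    moreover have "0 < q\<^sup>2" using q2 by simp
    ultimately show False by linarith
  qed
  then obtain \<mu> where \<mu>: "\<mu> \<in> S" "measure (P (\<theta> \<mu>)) (A \<mu>) \<le> 1/2" by blast
  interpret P: prob_space "P (\<theta> \<mu>)" by (rule Pp)
  let ?D = "cube_law n \<sigma> (\<lambda>k. - \<theta> \<mu> k) (\<theta> \<mu>)"
  have d: "edist n \<mu> \<nu> \<le> \<delta>" using \<mu> S by (auto simp: cballn_def edist_commute)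
  have D: "?D \<in> noise_dists n (\<sigma>\<^sup>2)"
  proof (rule cube_noise[OF \<sigma>])
    show "\<bar>\<theta> \<mu> k\<bar> \<le> \<sigma>" if "k < n" for k
      using abs_component_le_edist[OF that, of \<mu> \<nu>] d \<delta> by (simp add: \<theta>_def)
  qed
  have law: "distr (PiM {..<N} (\<lambda>_. ?D)) (SampM n N) (shift_sample n N \<mu>) = P (\<theta> \<mu>)"
    unfolding P_def by (rule distr_shift_sample_cube) (simp add: \<theta>_def)
  have Ac: "space (P (\<theta> \<mu>)) - A \<mu> \<in> sets (P (\<theta> \<mu>))" by (rule sets.compl_sets) (simp add: Ps A)
  have "ennreal (\<eta>\<^sup>2 / 8) = ennreal (\<eta>\<^sup>2 / 4 * (1/2))" by simp
  also have "\<dots> \<le> ennreal (\<eta>\<^sup>2 / 4 * measure (P (\<theta> \<mu>)) (space (P (\<theta> \<mu>)) - A \<mu>))"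
    using \<mu>(2) A[of \<mu>] by (intro ennreal_leI mult_left_mono) (auto simp: P.prob_compl Ps)
  also have "\<dots> = ennreal (\<eta>\<^sup>2 / 4) * emeasure (P (\<theta> \<mu>)) (space (P (\<theta> \<mu>)) - A \<mu>)"
    unfolding P.emeasure_eq_measure by (subst ennreal_mult) auto
  also have "\<dots> = (\<integral>\<^sup>+y. ennreal (\<eta>\<^sup>2 / 4) * indicator (space (P (\<theta> \<mu>)) - A \<mu>) y \<partial>P (\<theta> \<mu>))"
    by (rule nn_integral_cmult_indicator[OF Ac, symmetric])
  also have "\<dots> \<le> (\<integral>\<^sup>+y. ennreal ((edist n (est y) \<mu>)\<^sup>2) \<partial>P (\<theta> \<mu>))"
  proof (rule nn_integral_mono)
    fix y assume "y \<in> space (P (\<theta> \<mu>))"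
    then have y: "y \<in> space (SampM n N)" using sets_eq_imp_space_eq[OF Ps] by blast
    show "ennreal (\<eta>\<^sup>2 / 4) * indicator (space (P (\<theta> \<mu>)) - A \<mu>) y \<le> ennreal ((edist n (est y) \<mu>)\<^sup>2)"
    proof (cases "y \<in> A \<mu>")
      case False
      then have "\<eta> / 2 \<le> edist n (est y) \<mu>" using y by (auto simp: A_def)
      then have "(\<eta> / 2)\<^sup>2 \<le> (edist n (est y) \<mu>)\<^sup>2" using \<eta> by (intro power_mono) auto
      then have "ennreal (\<eta>\<^sup>2 / 4) \<le> ennreal ((edist n (est y) \<mu>)\<^sup>2)"
        by (intro ennreal_leI) (simp add: power_divide)
      then show ?thesis by (auto simp: indicator_def)
    qed simp
  qed
  also have "\<dots> = risk n N est \<mu> ?D (\<lambda>x. x)"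
    unfolding law[symmetric] risk_def
    by (intro nn_integral_distr shift_sample_measurable sets_cube_law)
      (use dm[of \<mu>] in measurable)
  finally have "ennreal (\<eta>\<^sup>2 / 8) \<le> risk n N est \<mu> ?D (\<lambda>x. x)" .
  then show "\<exists>\<mu>\<in>K. \<exists>D\<in>noise_dists n (\<sigma>\<^sup>2). \<exists>C\<in>adversaries n N \<epsilon>. ennreal (\<eta>\<^sup>2 / 8) \<le> risk n N est \<mu> D C"
    using \<mu>(1) S(2) D id_in_adversaries[OF \<epsilon>] by blast
qed

section \<open>Lower bound from hidden outliers\<close>

lemma singleton_sets_RnM: "z \<in> Rn n \<Longrightarrow> {z} \<in> sets (RnM n)"
proof -
  assume z: "z \<in> Rn n"
  have "PiE {..<n} (\<lambda>i. {z i}) \<in> sets (RnM n)"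
    unfolding RnM_def by (rule sets_PiM_I_finite) auto
  moreover have "PiE {..<n} (\<lambda>i. {z i}) = {z}"
    using z unfolding Rn_def by (intro PiE_singleton) (simp add: PiE_def)
  ultimately show ?thesis by simp
qed

text \<open>The data equal \<open>k\<close> except for rare outliers placed so that the mean becomes \<open>x\<close>.\<close>

definition outlier_noise :: "nat \<Rightarrow> real \<Rightarrow> (nat \<Rightarrow> real) \<Rightarrow> (nat \<Rightarrow> real) \<Rightarrow> (nat \<Rightarrow> real) measure" where
  "outlier_noise n p k x = distr (bernoulli_pmf p) (RnM n)
     (\<lambda>b. \<lambda>i\<in>{..<n}. if b then (x i - k i) * (1 / p - 1) else k i - x i)"

text \<open>The covariance has rank one: it is \<open>(1 - p) / p\<close> times the outer square of
  k - x. Cauchy-Schwarz bounds its quadratic form, and the distance condition cancels the division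
  by \<open>p\<close>.\<close>

lemma outlier_noise_in_noise_dists:
  assumes p: "0 < p" "p < 1" and d: "(edist n k x)\<^sup>2 \<le> \<sigma>\<^sup>2 * p"
  shows "outlier_noise n p k x \<in> noise_dists n (\<sigma>\<^sup>2)"
proof -
  let ?f = "\<lambda>b. \<lambda>i\<in>{..<n}. if b then (x i - k i) * (1 / p - 1) else k i - x i"
  let ?D = "outlier_noise n p k x"
  have f: "?f \<in> measurable (bernoulli_pmf p) (RnM n)" by (auto simp: space_RnM Rn_def)
  have cm: "(\<lambda>y. y i) \<in> borel_measurable (RnM n)" if "i < n" for i
    unfolding RnM_def using that by (intro measurable_component_singleton) auto
  have I: "integrable ?D g" "(\<integral>y. g y \<partial>?D) = g (?f True) * p + g (?f False) * (1 - p)"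
    if g: "g \<in> borel_measurable (RnM n)" for g :: "_ \<Rightarrow> real"
  proof -
    show "integrable ?D g"
      unfolding outlier_noise_def integrable_distr_eq[OF f g] by (rule integrable_measure_pmf_finite) simp
    have "(\<integral>y. g y \<partial>?D) = (\<integral>b. g (?f b) \<partial>bernoulli_pmf p)"
      unfolding outlier_noise_def by (rule integral_distr[OF f g])
    then show "(\<integral>y. g y \<partial>?D) = g (?f True) * p + g (?f False) * (1 - p)"
      using p by (subst (asm) integral_bernoulli_pmf) auto
  qed
  have mean: "(\<integral>y. y i \<partial>?D) = 0" if "i < n" for i
    using that p by (subst I(2)[OF cm[OF that]]) (simp add: field_simps)
  have cov: "(\<integral>y. y i * y j \<partial>?D) = (k i - x i) * (k j - x j) * ((1 - p) / p)" if "i < n" "j < n" for i j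
  proof -
    have "(\<integral>y. y i * y j \<partial>?D) = ?f True i * ?f True j * p + ?f False i * ?f False j * (1 - p)"
      using that by (intro I(2) borel_measurable_times cm)
    also have "\<dots> = (k i - x i) * (k j - x j) * ((1 / p - 1)\<^sup>2 * p + (1 - p))"
      using that by (simp add: power2_eq_square algebra_simps)
    also have "(1 / p - 1)\<^sup>2 * p + (1 - p) = (1 - p) / p"
      using p by (simp add: field_simps power2_eq_square)
    finally show ?thesis .
  qed
  have quad: "(\<Sum>i<n. \<Sum>j<n. v i * v j * (\<integral>y. y i * y j \<partial>?D)) \<le> \<sigma>\<^sup>2 * (\<Sum>i<n. (v i)\<^sup>2)" for v
  proof -
    have "(\<Sum>i<n. \<Sum>j<n. v i * v j * (\<integral>y. y i * y j \<partial>?D)) = ((1 - p) / p) * (\<Sum>i<n. (k i - x i) * (v i - 0))\<^sup>2"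
      unfolding power2_eq_square sum_product unfolding sum_distrib_left
      by (intro sum.cong) (auto simp: cov)
    also have "\<dots> \<le> ((1 - p) / p) * (edist n k x * edist n v (\<lambda>_. 0))\<^sup>2"
      using sum_mult_le_edist[where n = n and x = k and y = x and z = v and w = "\<lambda>_. 0"] p
      by (intro mult_left_mono) (auto simp: abs_le_square_iff[symmetric])
    also have "\<dots> = ((1 - p) * (\<Sum>i<n. (v i)\<^sup>2) / p) * (edist n k x)\<^sup>2"
      by (simp add: power_mult_distrib edist_power2[of n v])
    also have "\<dots> \<le> ((1 - p) * (\<Sum>i<n. (v i)\<^sup>2) / p) * (\<sigma>\<^sup>2 * p)"
      using p by (intro mult_left_mono d) (auto intro!: divide_nonneg_pos mult_nonneg_nonneg sum_nonneg)
    also have "\<dots> = (1 - p) * (\<sigma>\<^sup>2 * (\<Sum>i<n. (v i)\<^sup>2))" using p by simp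
    also have "\<dots> \<le> \<sigma>\<^sup>2 * (\<Sum>i<n. (v i)\<^sup>2)"
      using p by (intro mult_left_le_one_le) (auto intro!: mult_nonneg_nonneg sum_nonneg)
    finally show ?thesis .
  qed
  have "prob_space ?D" unfolding outlier_noise_def
    by (rule prob_space.prob_space_distr[OF prob_space_measure_pmf f])
  moreover have "sets ?D = sets (RnM n)" by (simp add: outlier_noise_def)
  ultimately show ?thesis unfolding noise_dists_def
    using quad mean by (auto intro!: I cm borel_measurable_power)
qed

text \<open>With outlier probability \<epsilon>/2 the expected number of outliers is at most half of
  the budget, so by Markov's inequality the adversary can hide all of them with probability at least
  1/2. On that event the estimator sees a constant sample and its loss is deterministic.\<close>

lemma outlier_removal_risk:
  assumes N: "N \<ge> 1" and \<epsilon>: "0 < \<epsilon>" "\<epsilon> < 1" and kx: "k \<in> Rn n" "x \<in> Rn n"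
    and d: "(edist n k x)\<^sup>2 \<le> \<sigma>\<^sup>2 * (\<epsilon> / 2)"
  obtains D C where "D \<in> noise_dists n (\<sigma>\<^sup>2)" "C \<in> adversaries n N \<epsilon>"
    "ennreal ((edist n (est (\<lambda>i\<in>{..<N}. k)) x)\<^sup>2 / 2) \<le> risk n N est x D C"
proof -
  define D where "D = outlier_noise n (\<epsilon> / 2) k x"
  have D: "D \<in> noise_dists n (\<sigma>\<^sup>2)"
    unfolding D_def using \<epsilon> d by (intro outlier_noise_in_noise_dists) auto
  define cnt :: "(nat \<Rightarrow> nat \<Rightarrow> real) \<Rightarrow> real" where "cnt y = (\<Sum>i<N. 1 - indicator {k} (y i))" for y
  \<comment> \<open>If the outliers exceed the budget, the data are left alone, which keeps the map
    admissible on every sample.\<close>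
  define C where "C y = (if cnt y \<le> \<epsilon> * real N then (\<lambda>i\<in>{..<N}. k) else y)" for y :: "nat \<Rightarrow> nat \<Rightarrow> real"
  have cnt: "cnt y = real (card {i\<in>{..<N}. y i \<noteq> k})" for y
  proof -
    have "cnt y = (\<Sum>i<N. if y i \<noteq> k then 1 else 0)"
      unfolding cnt_def by (intro sum.cong) auto
    also have "\<dots> = real (card {i\<in>{..<N}. y i \<noteq> k})" by (simp add: sum.If_cases Int_def)
    finally show ?thesis .
  qed
  have indm: "(indicator {k} :: _ \<Rightarrow> real) \<in> borel_measurable (RnM n)"
    using singleton_sets_RnM[OF kx(1)] by simp
  have cntm: "cnt \<in> borel_measurable (SampM n N)"
    unfolding cnt_def[abs_def] SampM_def
    by (intro borel_measurable_sum borel_measurable_diff borel_measurable_const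
        measurable_compose[OF _ indm] measurable_component_singleton) auto
  note [measurable] = cntm
  have const: "(\<lambda>i\<in>{..<N}. k) \<in> space (SampM n N)" using kx by (auto simp: space_SampM)
  have C: "C \<in> adversaries n N \<epsilon>"
  proof -
    have "C \<in> measurable (SampM n N) (SampM n N)"
      unfolding C_def[abs_def] using const by measurable
    moreover have "real (card {i\<in>{..<N}. C y i \<noteq> y i}) \<le> \<epsilon> * real N" for y
    proof (cases "cnt y \<le> \<epsilon> * real N")
      case True
      then have "{i\<in>{..<N}. C y i \<noteq> y i} = {i\<in>{..<N}. y i \<noteq> k}" by (auto simp: C_def)
      then show ?thesis using True cnt by simp
    qed (use \<epsilon> in \<open>simp add: C_def\<close>)
    ultimately show ?thesis by (simp add: adversaries_def)
  qed
  let ?P = "PiM {..<N} (\<lambda>_. D)"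
  have Dp: "prob_space D" by (rule noise_prob_space[OF D])
  interpret P: prob_space ?P by (rule prob_space_PiM) (rule Dp)
  have sm: "shift_sample n N x \<in> measurable ?P (SampM n N)"
    by (rule shift_sample_measurable[OF noise_sets[OF D]])
  note [measurable] = sm
  define E where "E = {\<xi> \<in> space ?P. cnt (shift_sample n N x \<xi>) \<le> \<epsilon> * real N}"
  have E [measurable]: "E \<in> sets ?P"
    unfolding E_def using measurable_compose[OF sm cntm] by measurable
  have vm: "vadd n x \<in> measurable D (RnM n)"
  proof -
    have "(\<lambda>y. y i) \<in> borel_measurable D" if "i < n" for i
      by (rule noise_component_measurable[OF D that])
    then show ?thesis unfolding RnM_def vadd_def[abs_def]
      by (intro measurable_restrict borel_measurable_add) auto
  qed
  define J where "J z = ennreal (1 - indicator {k} (vadd n x z))" for z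
  have Jm: "J \<in> borel_measurable D"
    unfolding J_def using measurable_compose[OF vm indm] by measurable
  have JD: "(\<integral>\<^sup>+z. J z \<partial>D) \<le> ennreal (\<epsilon> / 2)"
  proof -
    let ?f = "\<lambda>b. \<lambda>i\<in>{..<n}. if b then (x i - k i) * (1 / (\<epsilon> / 2) - 1) else k i - x i"
    have f: "?f \<in> measurable (bernoulli_pmf (\<epsilon> / 2)) (RnM n)" by (auto simp: space_RnM Rn_def)
    have "(\<integral>\<^sup>+z. J z \<partial>D) = (\<integral>\<^sup>+b. J (?f b) \<partial>bernoulli_pmf (\<epsilon> / 2))"
      unfolding D_def outlier_noise_def
      by (rule nn_integral_distr[OF f]) (use Jm in \<open>simp add: D_def outlier_noise_def\<close>)
    also have "\<dots> = J (?f True) * ennreal (\<epsilon> / 2) + J (?f False) * ennreal (1 - \<epsilon> / 2)"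
      using \<epsilon> by (subst nn_integral_bernoulli_pmf) auto
    finally have eq: "(\<integral>\<^sup>+z. J z \<partial>D)
      = J (?f True) * ennreal (\<epsilon> / 2) + J (?f False) * ennreal (1 - \<epsilon> / 2)" .
    have "vadd n x (?f False) = k"
      using kx by (auto simp: vadd_def fun_eq_iff Rn_def PiE_def extensional_def)
    then have 0: "J (?f False) = 0" by (simp add: J_def)
    have "J (?f True) \<le> 1" by (simp add: J_def indicator_def)
    then have "J (?f True) * ennreal (\<epsilon> / 2) \<le> 1 * ennreal (\<epsilon> / 2)" by (rule mult_right_mono) simp
    then show ?thesis by (simp only: eq 0 mult_zero_left add_0_right mult_1_left)
  qed
  have J_int: "(\<integral>\<^sup>+\<xi>. J (\<xi> i) \<partial>?P) \<le> ennreal (\<epsilon> / 2)" if "i < N" for i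
  proof -
    have eq: "distr ?P D (\<lambda>\<omega>. \<omega> i) = D" using that Dp by (intro distr_PiM_component) auto
    have "(\<integral>\<^sup>+\<xi>. J (\<xi> i) \<partial>?P) = (\<integral>\<^sup>+z. J z \<partial>distr ?P D (\<lambda>\<omega>. \<omega> i))"
      using that Jm by (intro nn_integral_distr[symmetric] measurable_component_singleton) auto
    then show ?thesis using JD by (simp only: eq)
  qed
  have cntJ: "ennreal (cnt (shift_sample n N x \<xi>)) = (\<Sum>i<N. J (\<xi> i))" for \<xi>
    unfolding cnt_def J_def
    by (subst sum_ennreal) (auto simp: shift_sample_def indicator_def intro!: arg_cong[where f = ennreal] sum.cong)
  have Jcm: "(\<lambda>\<xi>. J (\<xi> i)) \<in> borel_measurable ?P" if "i < N" for i
    using that by (intro measurable_compose[OF _ Jm] measurable_component_singleton) auto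
  have half: "1/2 \<le> measure ?P E"
  proof -
    have "1 = (\<integral>\<^sup>+\<xi>. 1 \<partial>?P)" by (simp add: P.emeasure_space_1)
    also have "\<dots> \<le> (\<integral>\<^sup>+\<xi>. indicator E \<xi> + ennreal (1 / (\<epsilon> * real N)) * (\<Sum>i<N. J (\<xi> i)) \<partial>?P)"
    \<comment> \<open>Markov's inequality pointwise: off \<open>E\<close> the outlier count exceeds
      \<epsilon> N.\<close>
    proof (rule nn_integral_mono)
      fix \<xi> assume \<xi>: "\<xi> \<in> space ?P"
      show "1 \<le> indicator E \<xi> + ennreal (1 / (\<epsilon> * real N)) * (\<Sum>i<N. J (\<xi> i))"
      proof (cases "\<xi> \<in> E")
        case False
        then have "\<epsilon> * real N < cnt (shift_sample n N x \<xi>)" using \<xi> by (auto simp: E_def)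
        then have "1 \<le> 1 / (\<epsilon> * real N) * cnt (shift_sample n N x \<xi>)"
          using \<epsilon> N by (simp add: field_simps)
        then have "ennreal 1 \<le> ennreal (1 / (\<epsilon> * real N) * cnt (shift_sample n N x \<xi>))" by (rule ennreal_leI)
        also have "\<dots> = ennreal (1 / (\<epsilon> * real N)) * (\<Sum>i<N. J (\<xi> i))"
          unfolding cntJ[symmetric] using \<epsilon> by (intro ennreal_mult) (auto simp: cnt)
        finally show ?thesis using False by simp
      qed simp
    qed
    also have "\<dots> = emeasure ?P E + ennreal (1 / (\<epsilon> * real N)) * (\<Sum>i<N. \<integral>\<^sup>+\<xi>. J (\<xi> i) \<partial>?P)"
    proof -
      have sm: "(\<lambda>\<xi>. \<Sum>i<N. J (\<xi> i)) \<in> borel_measurable ?P"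
        by (rule borel_measurable_sum) (use Jcm in auto)
      have "(\<integral>\<^sup>+\<xi>. (\<Sum>i<N. J (\<xi> i)) \<partial>?P) = (\<Sum>i<N. \<integral>\<^sup>+\<xi>. J (\<xi> i) \<partial>?P)"
        by (rule nn_integral_sum) (use Jcm in auto)
      then show ?thesis
        by (subst nn_integral_add) (auto simp: nn_integral_cmult[OF sm] intro!: borel_measurable_times_ennreal sm)
    qed
    also have "\<dots> \<le> emeasure ?P E + ennreal (1 / (\<epsilon> * real N)) * (\<Sum>i<N. ennreal (\<epsilon> / 2))"
      by (intro add_left_mono mult_left_mono sum_mono J_int) auto
    also have "ennreal (1 / (\<epsilon> * real N)) * (\<Sum>i<N. ennreal (\<epsilon> / 2)) = ennreal (1 / (\<epsilon> * real N) * (real N * (\<epsilon> / 2)))"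
    proof -
      have "(\<Sum>i<N. ennreal (\<epsilon> / 2)) = ennreal (real N * (\<epsilon> / 2))"
        using \<epsilon> by (subst sum_ennreal) auto
      then show ?thesis using \<epsilon> by (simp only:) (subst ennreal_mult, auto)
    qed
    also have "1 / (\<epsilon> * real N) * (real N * (\<epsilon> / 2)) = 1/2" using \<epsilon> N by simp
    also have "emeasure ?P E + ennreal (1/2) = ennreal (measure ?P E + 1/2)"
      by (simp add: P.emeasure_eq_measure)
    finally have "ennreal 1 \<le> ennreal (measure ?P E + 1/2)" by simp
    then show ?thesis by (subst (asm) ennreal_le_iff) auto
  qed
  let ?l = "(edist n (est (\<lambda>i\<in>{..<N}. k)) x)\<^sup>2"
  have "ennreal (?l / 2) \<le> ennreal (?l * measure ?P E)"
    using half mult_left_mono[OF half, of ?l] by (intro ennreal_leI) simp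
  also have "\<dots> = ennreal ?l * emeasure ?P E" by (simp add: P.emeasure_eq_measure ennreal_mult)
  also have "\<dots> = (\<integral>\<^sup>+\<xi>. ennreal ?l * indicator E \<xi> \<partial>?P)"
    by (rule nn_integral_cmult_indicator[OF E, symmetric])
  also have "\<dots> \<le> risk n N est x D C"
    unfolding risk_def by (intro nn_integral_mono) (auto simp: indicator_def E_def C_def)
  finally show ?thesis using that D C by blast
qed

text \<open>The distance \<open>a\<close> is the largest one that the covariance bound allows for
  outlier probability \<epsilon>/2. The estimate for the constant sample \<open>k\<close> is at
  least a/2 away from \<open>k\<close> or from \<open>x\<close>, and (a/2)^2/2 = \<epsilon>
  \<sigma>^2/16. For the mean \<open>k\<close> itself the outlier noise is zero, so one construction
  serves both means.\<close>

lemma minimax_risk_lower_contamination: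
  assumes N: "N \<ge> 1" and \<epsilon>: "0 < \<epsilon>" "\<epsilon> < 1" and \<sigma>: "\<sigma> > 0"
    and K: "K \<subseteq> Rn n" "star_shaped n K" "unbounded_n n K"
  shows "ennreal (\<epsilon> * \<sigma>\<^sup>2 / 16) \<le> minimax_risk n N \<sigma> \<epsilon> K"
proof -
  define a where "a = \<sigma> * sqrt (\<epsilon> / 2)"
  have a: "a > 0" "a\<^sup>2 = \<sigma>\<^sup>2 * (\<epsilon> / 2)" using \<epsilon> \<sigma> by (auto simp: a_def power_mult_distrib)
  obtain k x where kx: "k \<in> K" "edist n k x = a" "x \<in> Rn n"
    "\<And>t. t \<in> {0..1} \<Longrightarrow> vcomb n t k x \<in> K"
    using star_shaped_unbounded_ray[OF K(2,3,1) a(1)] by blast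
  have "vcomb n 1 k x = x"
    using kx(3) by (auto simp: vcomb_def Rn_def PiE_def extensional_def)
  then have xK: "x \<in> K" using kx(4)[of 1] by simp
  show ?thesis
  proof (rule minimax_risk_ge)
    fix est assume "est \<in> estimators n N"
    define z where "z = est (\<lambda>i\<in>{..<N}. k)"
    have "a \<le> edist n z k + edist n z x"
      using edist_triangle[of n k x z] kx(2) by (simp add: edist_commute)
    then obtain y where y: "y \<in> {k, x}" "a / 2 \<le> edist n z y"
      by (metis field_sum_of_halves add_le_cancel_left add_mono insertCI linorder_le_cases not_le add_strict_mono)
    have yK: "y \<in> K" using y kx xK by blast
    have "(edist n k y)\<^sup>2 \<le> \<sigma>\<^sup>2 * (\<epsilon> / 2)" using y kx(2) a \<epsilon> by auto
    from outlier_removal_risk[OF N \<epsilon> _ _ this, of est] kx(1) yK K(1)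
    obtain D C where DC: "D \<in> noise_dists n (\<sigma>\<^sup>2)" "C \<in> adversaries n N \<epsilon>"
      "ennreal ((edist n z y)\<^sup>2 / 2) \<le> risk n N est y D C" unfolding z_def by blast
    have "(a / 2)\<^sup>2 \<le> (edist n z y)\<^sup>2" using y(2) a(1) by (intro power_mono) auto
    then have "\<epsilon> * \<sigma>\<^sup>2 / 16 \<le> (edist n z y)\<^sup>2 / 2" by (simp add: power_divide a(2) mult.commute)
    then have "ennreal (\<epsilon> * \<sigma>\<^sup>2 / 16) \<le> ennreal ((edist n z y)\<^sup>2 / 2)" by (rule ennreal_leI)
    with DC yK show "\<exists>\<mu>\<in>K. \<exists>D\<in>noise_dists n (\<sigma>\<^sup>2). \<exists>C\<in>adversaries n N \<epsilon>.
      ennreal (\<epsilon> * \<sigma>\<^sup>2 / 16) \<le> risk n N est \<mu> D C" by (meson order_trans)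
  qed
qed

section \<open>Both bounds in terms of \<open>delta_star\<close>\<close>

lemma minimax_risk_bounds:
  assumes c: "c \<ge> 33" and N: "N \<ge> 1" and \<sigma>: "\<sigma> > 0" and \<epsilon>: "0 < \<epsilon>" "\<epsilon> < 1/32"
    and K: "K \<subseteq> Rn n" "unbounded_n n K" "star_shaped n K"
    and ent: "\<And>\<delta>. \<delta> > 0 \<Longrightarrow> 6 / test_rate * ln (Mloc n K \<delta> c) \<le> real N"
  defines "R \<equiv> max ((delta_star n N \<sigma> K c)\<^sup>2) (\<epsilon> * \<sigma>\<^sup>2)"
  shows "ennreal (1 / (512 * c\<^sup>2) * R) \<le> minimax_risk n N \<sigma> \<epsilon> K"
    and "minimax_risk n N \<sigma> \<epsilon> K \<le> ennreal (1104 / test_rate * R)"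
proof -
  have Kne: "K \<noteq> {}" using K(3) by (auto simp: star_shaped_def)
  define X where "X = {\<delta>. \<delta> \<ge> 0 \<and> real N * \<delta>\<^sup>2 / \<sigma>\<^sup>2 \<le> ln (Mloc n K \<delta> c)}"
  let ?s = "delta_star n N \<sigma> K c"
  have s: "?s = Sup X" by (simp add: delta_star_def X_def)
  have Npos: "real N > 0" using N by simp
  have rate1: "test_rate \<le> 1" by (simp add: test_rate_def)
  \<comment> \<open>The value 33 serves twice: it exceeds e, so the entropy is at least 1, and its
    half exceeds 16, the packing size needed after near-attainment.\<close>
  have M33: "33 \<le> Mloc n K \<delta> c" if "\<delta> > 0" for \<delta>
    using Mloc_ge_of_unbounded[OF K(3,2,1) that, of 32 c] c by simp
  have lnM: "1 \<le> ln (Mloc n K \<delta> c)" if "\<delta> > 0" for \<delta>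
  proof -
    have "exp 1 \<le> Mloc n K \<delta> c" using M33[OF that] exp_le by linarith
    then show ?thesis using M33[OF that] by (subst ln_ge_iff) auto
  qed
  have lnM2: "ln (Mloc n K \<delta> c) \<le> test_rate / 6 * real N" if "\<delta> > 0" for \<delta>
    using ent[OF that] test_rate_pos by (simp add: field_simps)
  \<comment> \<open>Boundedness gives the \<open>Sup\<close> in \<open>delta_star\<close> its
    meaning; that the bound is \<sigma> makes the tilts of the cube noise admissible.\<close>
  have X\<sigma>: "\<delta> \<le> \<sigma>" if "\<delta> \<in> X" for \<delta>
  proof (cases "\<delta> = 0")
    case False
    then have d: "\<delta> > 0" "real N * \<delta>\<^sup>2 / \<sigma>\<^sup>2 \<le> ln (Mloc n K \<delta> c)" using that by (auto simp: X_def)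
    then have "real N * \<delta>\<^sup>2 / \<sigma>\<^sup>2 \<le> test_rate / 6 * real N" using lnM2[OF d(1)] by linarith
    also have "\<dots> \<le> 1 * real N" using rate1 by (intro mult_right_mono) auto
    finally have "\<delta>\<^sup>2 \<le> \<sigma>\<^sup>2" using Npos \<sigma> by (simp add: field_simps)
    then show ?thesis using \<sigma> by (simp add: power2_le_iff_abs_le)
  qed (use \<sigma> in simp)
  have bdd: "bdd_above X" using X\<sigma> by (auto simp: bdd_above_def)
  \<comment> \<open>The parametric rate belongs to the set because the entropy is at least
    1.\<close>
  have low: "\<sigma> / sqrt (real N) \<in> X"
    using lnM[of "\<sigma> / sqrt (real N)"] Npos \<sigma> by (simp add: X_def power_divide)
  have s_ge: "\<sigma> / sqrt (real N) \<le> ?s" unfolding s using low bdd by (rule cSup_upper)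
  then have s_pos: "?s > 0" using \<sigma> Npos by (meson divide_pos_pos less_le_trans real_sqrt_gt_zero)
  have s2: "1 \<le> real N * (?s\<^sup>2 / \<sigma>\<^sup>2)"
  proof -
    have "(\<sigma> / sqrt (real N))\<^sup>2 \<le> ?s\<^sup>2" using s_ge \<sigma> by (intro power_mono) auto
    then show ?thesis using \<sigma> Npos by (simp add: power_divide field_simps)
  qed
  show "ennreal (1 / (512 * c\<^sup>2) * R) \<le> minimax_risk n N \<sigma> \<epsilon> K"
  proof -
    have "ennreal (1 / (512 * c\<^sup>2) * ?s\<^sup>2) \<le> minimax_risk n N \<sigma> \<epsilon> K"
    proof -
      have "?s / 2 < Sup X" using s_pos s by simp
      then obtain \<delta> where \<delta>: "\<delta> \<in> X" "?s / 2 < \<delta>" using low less_cSupD[of X "?s / 2"] by blast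
      have \<delta>0: "\<delta> > 0" using \<delta>(2) s_pos by linarith
      \<comment> \<open>At radius \<delta>/4 the information N \<delta>^2/\<sigma>^2 is divided by
        16 while the entropy does not decrease. The factor 2 lost in near-attainment is absorbed by
        2 card S \<le> (card S)^2, which leaves ln (card S)/8, within the permitted ln (card
        S)/4.\<close>
      have mono: "Mloc n K \<delta> c \<le> Mloc n K (\<delta> / 4) c"
        using \<delta>0 c by (intro Mloc_antimono K) auto
      obtain \<nu> S where S: "\<nu> \<in> K" "S \<subseteq> cballn n \<nu> (\<delta> / 4) \<inter> K" "finite S"
        "separated n (\<delta> / 4 / c) S" "Mloc n K (\<delta> / 4) c / 2 < real (card S)"
        using Mloc_nearly_attained[of "\<delta> / 4" c K "Mloc n K (\<delta> / 4) c / 2" n] \<delta>0 c Kne M33[of "\<delta> / 4"] by auto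
      have m: "16 \<le> card S" using S(5) M33[of "\<delta> / 4"] \<delta>0 by linarith
      have "real N * (\<delta> / 4)\<^sup>2 / \<sigma>\<^sup>2 = (real N * \<delta>\<^sup>2 / \<sigma>\<^sup>2) / 16" by (simp add: power_divide)
      also have "\<dots> \<le> ln (Mloc n K \<delta> c) / 16" using \<delta>(1) by (simp add: X_def)
      also have "\<dots> \<le> ln ((real (card S))\<^sup>2) / 16"
      proof -
        have "2 * real (card S) \<le> (real (card S))\<^sup>2"
          unfolding power2_eq_square using m by (intro mult_right_mono) auto
        then have "Mloc n K \<delta> c \<le> (real (card S))\<^sup>2" using mono S(5) by linarith
        then show ?thesis using M33[OF \<delta>0] m by (simp add: ln_le_cancel_iff)
      qed
      also have "\<dots> \<le> ln (real (card S)) / 4" using m by (simp add: ln_realpow)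
      finally have "ennreal ((\<delta> / 4 / c)\<^sup>2 / 8) \<le> minimax_risk n N \<sigma> \<epsilon> K"
        using X\<sigma>[OF \<delta>(1)] \<delta>0 c \<epsilon> \<sigma>
        by (intro minimax_risk_lower_packing[OF \<sigma> _ S(3,2,4) m]) auto
      \<comment> \<open>512 = 4 * 16 * 8: half of the supremum squared, the radius \<delta>/4
        squared, and the 8 of the packing bound.\<close>
      moreover have "1 / (512 * c\<^sup>2) * ?s\<^sup>2 \<le> (\<delta> / 4 / c)\<^sup>2 / 8"
      proof -
        have "(?s / 2)\<^sup>2 \<le> \<delta>\<^sup>2" using \<delta>(2) s_pos by (intro power_mono) auto
        then have "(?s / 2)\<^sup>2 / (128 * c\<^sup>2) \<le> \<delta>\<^sup>2 / (128 * c\<^sup>2)" by (rule divide_right_mono) simp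
        then show ?thesis by (simp add: power_divide)
      qed
      ultimately show ?thesis by (meson ennreal_leI order_trans)
    qed
    moreover have "ennreal (1 / (512 * c\<^sup>2) * (\<epsilon> * \<sigma>\<^sup>2)) \<le> minimax_risk n N \<sigma> \<epsilon> K"
    proof -
      have "1\<^sup>2 \<le> c\<^sup>2" using c by (intro power_mono) auto
      then have "1 / (512 * c\<^sup>2) \<le> 1 / 16" by (intro frac_le) auto
      then have "1 / (512 * c\<^sup>2) * (\<epsilon> * \<sigma>\<^sup>2) \<le> 1 / 16 * (\<epsilon> * \<sigma>\<^sup>2)"
        using \<epsilon> by (intro mult_right_mono) auto
      then have "ennreal (1 / (512 * c\<^sup>2) * (\<epsilon> * \<sigma>\<^sup>2)) \<le> ennreal (\<epsilon> * \<sigma>\<^sup>2 / 16)"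
        by (intro ennreal_leI) simp
      also have "\<dots> \<le> minimax_risk n N \<sigma> \<epsilon> K"
        using \<epsilon> by (intro minimax_risk_lower_contamination N \<sigma> K) auto
      finally show ?thesis .
    qed
    ultimately show ?thesis unfolding R_def max_def by simp
  qed
  show "minimax_risk n N \<sigma> \<epsilon> K \<le> ennreal (1104 / test_rate * R)"
  proof -
    have R: "?s\<^sup>2 \<le> R" "\<epsilon> * \<sigma>\<^sup>2 \<le> R" by (auto simp: R_def)
    have Rpos: "R > 0" using R(1) s_pos by (meson less_le_trans zero_less_power)
    \<comment> \<open>24 = 6 * 4: the 6 cancels the one in \<open>test_rate / 6\<close>, and the 4
      leaves strict room above \<open>delta_star\<close>. With the factor 46 of the risk bound it
      gives 1104.\<close>
    define r where "r = sqrt (24 / test_rate * R)"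
    have r2: "r\<^sup>2 = 24 / test_rate * R" using Rpos test_rate_pos by (simp add: r_def)
    have r: "r > 0" using Rpos test_rate_pos by (simp add: r_def)
    have "minimax_risk n N \<sigma> \<epsilon> K \<le> ennreal (46 * r\<^sup>2)"
    proof (rule minimax_risk_upper[OF \<sigma> K(1) Kne _ r])
      show "\<epsilon> * \<sigma>\<^sup>2 \<le> 2 * test_rate * r\<^sup>2" unfolding r2 using test_rate_pos R(2) Rpos by simp
      show "4 \<le> test_rate * real N" using lnM[of 1] lnM2[of 1] by simp
      show "1 \<le> test_rate * real N * (r\<^sup>2 / \<sigma>\<^sup>2)"
      proof -
        have "real N * (?s\<^sup>2 / \<sigma>\<^sup>2) \<le> real N * (R / \<sigma>\<^sup>2)"
          using R(1) by (intro mult_left_mono divide_right_mono) auto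
        with s2 have "1 \<le> real N * (R / \<sigma>\<^sup>2)" by linarith
        moreover have "test_rate * real N * (r\<^sup>2 / \<sigma>\<^sup>2) = 24 * (real N * (R / \<sigma>\<^sup>2))"
          unfolding r2 using test_rate_pos by simp
        ultimately show ?thesis by linarith
      qed
      fix i :: nat
      \<comment> \<open>At this smaller radius N \<rho>^2/\<sigma>^2 is exactly the permitted
        entropy. Since \<rho> exceeds \<open>delta_star\<close>, the entropy at \<rho> lies below
        that value, and by monotonicity so does the entropy at \<open>2 ^ i * r\<close>.\<close>
      define \<rho> where "\<rho> = 2 ^ i * r * sqrt (test_rate / 6)"
      have ir: "2 ^ i * r > 0" using r by simp
      have \<rho>0: "\<rho> > 0" using ir test_rate_pos by (simp add: \<rho>_def)
      have \<rho>2: "\<rho>\<^sup>2 = 4 ^ i * r\<^sup>2 * (test_rate / 6)"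
        using test_rate_pos by (simp add: \<rho>_def power_mult_distrib power2_power_eq)
      have \<rho>le: "\<rho> \<le> 2 ^ i * r"
      proof -
        have "sqrt (test_rate / 6) \<le> 1" using rate1 by simp
        then show ?thesis unfolding \<rho>_def using ir by (intro mult_left_le) auto
      qed
      have "?s < \<rho>"
      proof -
        have "\<rho>\<^sup>2 = 4 ^ i * (4 * R)" unfolding \<rho>2 r2 using test_rate_pos by simp
        moreover have "1 * (4 * R) \<le> 4 ^ i * (4 * R)" using Rpos by (intro mult_right_mono) auto
        ultimately have "?s\<^sup>2 < \<rho>\<^sup>2" using R(1) Rpos by linarith
        then show ?thesis using \<rho>0 by (simp add: power_less_imp_less_base)
      qed
      then have "\<rho> \<notin> X" using cSup_upper[OF _ bdd] s by fastforce
      then have "ln (Mloc n K \<rho> c) < real N * \<rho>\<^sup>2 / \<sigma>\<^sup>2" using \<rho>0 by (simp add: X_def)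
      moreover have "ln (Mloc n K (2 ^ i * r) c) \<le> ln (Mloc n K \<rho> c)"
        using Mloc_antimono[OF K(3,1) \<rho>0 \<rho>le, of c] M33[OF ir] M33[OF \<rho>0] c by simp
      moreover have "real N * \<rho>\<^sup>2 / \<sigma>\<^sup>2 = test_rate / 6 * real N * (4 ^ i * (r\<^sup>2 / \<sigma>\<^sup>2))"
        unfolding \<rho>2 by simp
      ultimately have le: "ln (Mloc n K (2 ^ i * r) c) \<le> test_rate / 6 * real N * (4 ^ i * (r\<^sup>2 / \<sigma>\<^sup>2))"
        by linarith
      show "ln (Mloc n K (2 ^ i * r) c) \<le> test_rate / 6 * real N * min 1 (4 ^ i * (r\<^sup>2 / \<sigma>\<^sup>2))"
      proof -
        have min: "l \<le> p \<Longrightarrow> l \<le> p * y \<Longrightarrow> l \<le> p * min 1 y" for l p y :: real by (simp add: min_def)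
        from lnM2[OF ir] le show ?thesis by (rule min)
      qed
    qed (use \<epsilon> c in auto)
    then show ?thesis unfolding r2 by simp
  qed
qed

theorem mainTheorem2:
  shows "\<exists>c0>0. \<forall>c\<ge>c0. \<exists>C0>0. \<exists>A>0. \<exists>B>0.
    \<forall>(n::nat) (N::nat) (\<sigma>::real) (\<epsilon>::real) (K::(nat \<Rightarrow> real) set).
      n \<ge> 1 \<longrightarrow> N \<ge> 1 \<longrightarrow> \<sigma> > 0 \<longrightarrow> 0 < \<epsilon> \<longrightarrow> \<epsilon> < 1/32 \<longrightarrow>
      K \<subseteq> Rn n \<longrightarrow> unbounded_n n K \<longrightarrow> star_shaped n K \<longrightarrow>
      (\<forall>\<delta>>0. C0 * ln (Mloc n K \<delta> c) \<le> real N) \<longrightarrow>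
        ennreal (A * max ((delta_star n N \<sigma> K c)^2) (\<epsilon> * \<sigma>^2)) \<le> minimax_risk n N \<sigma> \<epsilon> K
      \<and> minimax_risk n N \<sigma> \<epsilon> K \<le> ennreal (B * max ((delta_star n N \<sigma> K c)^2) (\<epsilon> * \<sigma>^2))"
proof (rule exI[of _ 33], intro conjI allI impI)
  fix c :: real assume c: "33 \<le> c"
  show "\<exists>C0>0. \<exists>A>0. \<exists>B>0.
    \<forall>(n::nat) (N::nat) (\<sigma>::real) (\<epsilon>::real) (K::(nat \<Rightarrow> real) set).
      n \<ge> 1 \<longrightarrow> N \<ge> 1 \<longrightarrow> \<sigma> > 0 \<longrightarrow> 0 < \<epsilon> \<longrightarrow> \<epsilon> < 1/32 \<longrightarrow>
      K \<subseteq> Rn n \<longrightarrow> unbounded_n n K \<longrightarrow> star_shaped n K \<longrightarrow>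
      (\<forall>\<delta>>0. C0 * ln (Mloc n K \<delta> c) \<le> real N) \<longrightarrow>
        ennreal (A * max ((delta_star n N \<sigma> K c)^2) (\<epsilon> * \<sigma>^2)) \<le> minimax_risk n N \<sigma> \<epsilon> K
      \<and> minimax_risk n N \<sigma> \<epsilon> K \<le> ennreal (B * max ((delta_star n N \<sigma> K c)^2) (\<epsilon> * \<sigma>^2))"
  \<comment> \<open>This constant turns the hypothesis into the bound
    \<open>test_rate / 6 * real N\<close> on the entropy at every radius. Of the constants chosen
    here, only the lower one depends on \<open>c\<close>.\<close>
  proof (rule exI[of _ "6 / test_rate"], rule conjI, goal_cases)
    case 2
    show ?case
    proof (rule exI[of _ "1 / (512 * c\<^sup>2)"], rule conjI, goal_cases)
      case 2
      show ?case
        using test_rate_pos minimax_risk_bounds[OF c]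
        by (intro exI[of _ "1104 / test_rate"]) auto
    qed (use c in simp)
  qed (use test_rate_pos in simp)
qed simp

end
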